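(* In the setting and under the standing assumption of the context, let $\varepsilon<\gamma$ and let $f:\Omega\to\mathbb R$ be a measurable function, nonnegative or in $L^1(\mu_\varepsilon)$ (e.g. bounded or in $L^2(\mu)$). Then $$\lim_{t\to\infty}\frac1t\int_0^tf(\eta_s)\,ds=\mu_\varepsilon(f)\qquad\mathbb P^{(\varepsilon)}_\eta\text{-a.s.}$$ for $\mu_\varepsilon$-a.e. $\eta$.
   Context: Setting. $\Omega$ is a metric space with its Borel $\sigma$-algebra; $C_b(\Omega)$ denotes the bounded continuous real functions. The unperturbed process is a Markov process on $\Omega$ with càdlàg paths $(\eta_t)_{t\ge0}$, with law and expectation $\mathbb P_\eta,\mathbb E_\eta$ when started at $\eta$, and with an invariant distribution $\mu$. $\mu(f)=\int f\,d\mu$; $\|\cdot\|$ is the norm of $L^2(\mu)$ (and the operator norm). $S(t)f(\eta)=\mathbb E_\eta[f(\eta_t)]$ defines a strongly continuous contraction semigroup on $L^2(\mu)$ with generator $L$ of domain $\mathcal D(L)$. The perturbed process is a second Markov process on $\Omega$ with càdlàg paths, with law and expectation $\mathbb P^{(\varepsilon)}_\eta,\mathbb E^{(\varepsilon)}_\eta$ when started at $\eta$. $\hat L_\varepsilon$ is a bounded operator on $L^2(\mu)$ with norm $\varepsilon:=\|\hat L_\varepsilon\|>0$; $L_\varepsilon:=L+\hat L_\varepsilon$ with $\mathcal D(L_\varepsilon)=\mathcal D(L)$ generates a strongly continuous semigroup $(S_\varepsilon(t))_{t\ge0}$ on $L^2(\mu)$. Standing assumption. $\mu$ is invariant and ergodic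 (w.r.t. time translations) for the unperturbed process; for some $\gamma>0$ the Poincaré inequality $\gamma\|f\|^2\le-\mu(fLf)$ holds for all $f\in\mathcal D(L)$ with $\mu(f)=0$; and for all $t\ge0$, $f\in C_b(\Omega)$, $S_\varepsilon(t)f(\eta)=\mathbb E^{(\varepsilon)}_\eta(f(\eta_t))$ for $\mu$-a.e. $\eta$. When $\varepsilon<\gamma$ there is a unique probability measure on $\Omega$ that is absolutely continuous w.r.t. $\mu$ and invariant for the perturbed process; it is denoted $\mu_\varepsilon$. *)

theory Defs
  imports "HOL-Probability.Probability"
begin

section \<open>Markov processes with cadlag paths\<close>

text \<open>Paths live in the extensional product over \<open>{0..}\<close>, so that values at negative times carry
  no information.\<close>

definition cadlag :: "(real \<Rightarrow> 'a::topological_space) \<Rightarrow> bool" where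
  "cadlag \<omega> \<longleftrightarrow> (\<forall>t\<ge>0. (\<omega> \<longlongrightarrow> \<omega> t) (at_right t)) \<and> (\<forall>t>0. \<exists>l. (\<omega> \<longlongrightarrow> l) (at_left t))"

text \<open>Cadlag paths with the \<open>\<sigma>\<close>-algebra generated by the coordinate maps; only the space and
  the measurable sets matter.\<close>

definition path_space :: "(real \<Rightarrow> 'a::metric_space) measure" where
  "path_space = restrict_space (PiM {0..} (\<lambda>_. borel)) {\<omega>. cadlag \<omega>}"

definition past :: "real \<Rightarrow> (real \<Rightarrow> 'a::metric_space) measure" where
  "past s = sigma (space path_space)
     {{\<omega> \<in> space path_space. \<omega> u \<in> B} | u B. 0 \<le> u \<and> u \<le> s \<and> B \<in> sets borel}"

definition time_shift :: "real \<Rightarrow> (real \<Rightarrow> 'a) \<Rightarrow> real \<Rightarrow> 'a" where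
  "time_shift s \<omega> = (\<lambda>t\<in>{0..}. \<omega> (s + t))"

definition markov_process :: "('a::metric_space \<Rightarrow> (real \<Rightarrow> 'a) measure) \<Rightarrow> bool" where
  "markov_process P \<longleftrightarrow>
     P \<in> borel \<rightarrow>\<^sub>M prob_algebra path_space \<and>
     (\<forall>\<eta>. AE \<omega> in P \<eta>. \<omega> 0 = \<eta>) \<and>
     (\<forall>\<eta>. \<forall>s\<ge>0. \<forall>B\<in>sets path_space. AE \<omega> in P \<eta>.
        real_cond_exp (P \<eta>) (past s)
          (indicator {\<omega> \<in> space path_space. time_shift s \<omega> \<in> B}) \<omega> = measure (P (\<omega> s)) B)"

text \<open>\<open>\<nu> \<bind> P\<close> is the law of the process whose initial state has distribution \<open>\<nu>\<close>.\<close>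

definition invariant_distribution ::
    "('a::metric_space \<Rightarrow> (real \<Rightarrow> 'a) measure) \<Rightarrow> 'a measure \<Rightarrow> bool" where
  "invariant_distribution P \<nu> \<longleftrightarrow>
     sets \<nu> = sets borel \<and> prob_space \<nu> \<and>
     (\<forall>t\<ge>0. distr (\<nu> \<bind> P) borel (\<lambda>\<omega>. \<omega> t) = \<nu>)"

definition ergodic_distribution ::
    "('a::metric_space \<Rightarrow> (real \<Rightarrow> 'a) measure) \<Rightarrow> 'a measure \<Rightarrow> bool" where
  "ergodic_distribution P \<nu> \<longleftrightarrow>
     (\<forall>A\<in>sets path_space.
        (\<forall>t\<ge>0. {\<omega> \<in> space path_space. time_shift t \<omega> \<in> A} = A) \<longrightarrow>
        measure (\<nu> \<bind> P) A = 0 \<or> measure (\<nu> \<bind> P) A = 1)"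

definition transition ::
    "('a \<Rightarrow> (real \<Rightarrow> 'a) measure) \<Rightarrow> real \<Rightarrow> ('a \<Rightarrow> real) \<Rightarrow> 'a \<Rightarrow> real" where
  "transition P t f \<eta> = (LINT \<omega>|P \<eta>. f (\<omega> t))"


section \<open>Operators on \<open>L\<^sup>2\<close>\<close>

text \<open>Elements of \<open>L\<^sup>2(\<mu>)\<close> are handled through representatives, and equality in \<open>L\<^sup>2(\<mu>)\<close> is
  almost everywhere equality. An operator on \<open>L\<^sup>2(\<mu>)\<close> is a map on representatives compatible with
  it.\<close>

definition L2 :: "'a measure \<Rightarrow> ('a \<Rightarrow> real) set" where
  "L2 \<mu> = {f \<in> borel_measurable \<mu>. integrable \<mu> (\<lambda>x. (f x)\<^sup>2)}"

definition L2_norm :: "'a measure \<Rightarrow> ('a \<Rightarrow> real) \<Rightarrow> real" where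
  "L2_norm \<mu> f = sqrt (LINT x|\<mu>. (f x)\<^sup>2)"

definition L2_bounded_operator :: "'a measure \<Rightarrow> (('a \<Rightarrow> real) \<Rightarrow> 'a \<Rightarrow> real) \<Rightarrow> bool" where
  "L2_bounded_operator \<mu> T \<longleftrightarrow>
     (\<forall>f\<in>L2 \<mu>. T f \<in> L2 \<mu>) \<and>
     (\<forall>f\<in>L2 \<mu>. \<forall>g\<in>L2 \<mu>. (AE x in \<mu>. f x = g x) \<longrightarrow> (AE x in \<mu>. T f x = T g x)) \<and>
     (\<forall>f\<in>L2 \<mu>. \<forall>g\<in>L2 \<mu>. AE x in \<mu>. T (\<lambda>y. f y + g y) x = T f x + T g x) \<and>
     (\<forall>c. \<forall>f\<in>L2 \<mu>. AE x in \<mu>. T (\<lambda>y. c * f y) x = c * T f x) \<and>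
     (\<exists>C. \<forall>f\<in>L2 \<mu>. L2_norm \<mu> (T f) \<le> C * L2_norm \<mu> f)"

definition L2_operator_norm :: "'a measure \<Rightarrow> (('a \<Rightarrow> real) \<Rightarrow> 'a \<Rightarrow> real) \<Rightarrow> real" where
  "L2_operator_norm \<mu> T = (SUP f\<in>{f \<in> L2 \<mu>. L2_norm \<mu> f \<le> 1}. L2_norm \<mu> (T f))"

definition C0_semigroup :: "'a measure \<Rightarrow> (real \<Rightarrow> ('a \<Rightarrow> real) \<Rightarrow> 'a \<Rightarrow> real) \<Rightarrow> bool" where
  "C0_semigroup \<mu> S \<longleftrightarrow>
     (\<forall>t\<ge>0. L2_bounded_operator \<mu> (S t)) \<and>
     (\<forall>f\<in>L2 \<mu>. AE x in \<mu>. S 0 f x = f x) \<and>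
     (\<forall>s\<ge>0. \<forall>t\<ge>0. \<forall>f\<in>L2 \<mu>. AE x in \<mu>. S (s + t) f x = S s (S t f) x) \<and>
     (\<forall>f\<in>L2 \<mu>. ((\<lambda>t. L2_norm \<mu> (\<lambda>x. S t f x - f x)) \<longlongrightarrow> 0) (at_right 0))"

definition contraction_semigroup ::
    "'a measure \<Rightarrow> (real \<Rightarrow> ('a \<Rightarrow> real) \<Rightarrow> 'a \<Rightarrow> real) \<Rightarrow> bool" where
  "contraction_semigroup \<mu> S \<longleftrightarrow>
     C0_semigroup \<mu> S \<and> (\<forall>t\<ge>0. \<forall>f\<in>L2 \<mu>. L2_norm \<mu> (S t f) \<le> L2_norm \<mu> f)"

text \<open>The generator \<open>A\<close> of a semigroup as its graph: \<open>(f, g)\<close> belongs to it iff \<open>f\<close> is in the domain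
  of \<open>A\<close> and \<open>A f = g\<close>, up to null sets.\<close>

definition generator ::
    "'a measure \<Rightarrow> (real \<Rightarrow> ('a \<Rightarrow> real) \<Rightarrow> 'a \<Rightarrow> real) \<Rightarrow> (('a \<Rightarrow> real) \<times> ('a \<Rightarrow> real)) set" where
  "generator \<mu> S = {(f, g). f \<in> L2 \<mu> \<and> g \<in> L2 \<mu> \<and>
     ((\<lambda>t. L2_norm \<mu> (\<lambda>x. (S t f x - f x) / t - g x)) \<longlongrightarrow> 0) (at_right 0)}"

text \<open>The graph of \<open>A + B\<close> on the domain of \<open>A\<close>, for an operator \<open>A\<close> given by its graph and an
  everywhere defined operator \<open>B\<close>.\<close>

definition perturbed_graph ::
    "'a measure \<Rightarrow> (('a \<Rightarrow> real) \<times> ('a \<Rightarrow> real)) set \<Rightarrow> (('a \<Rightarrow> real) \<Rightarrow> 'a \<Rightarrow> real) \<Rightarrow>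
     (('a \<Rightarrow> real) \<times> ('a \<Rightarrow> real)) set" where
  "perturbed_graph \<mu> A B =
     {(f, h). h \<in> L2 \<mu> \<and> (\<exists>g. (f, g) \<in> A \<and> (AE x in \<mu>. h x = g x + B f x))}"

definition poincare_inequality ::
    "'a measure \<Rightarrow> (('a \<Rightarrow> real) \<times> ('a \<Rightarrow> real)) set \<Rightarrow> real \<Rightarrow> bool" where
  "poincare_inequality \<mu> A \<gamma> \<longleftrightarrow>
     (\<forall>(f, g)\<in>A. (LINT x|\<mu>. f x) = 0 \<longrightarrow> \<gamma> * (L2_norm \<mu> f)\<^sup>2 \<le> - (LINT x|\<mu>. f x * g x))"

end

theory Submission
  imports Defs "HOL-Real_Asymp.Real_Asymp"
begin

text \<open>
  Write \<open>P\<^sub>t g\<close> for \<open>transition Peps t g\<close>, the expectation of \<open>g\<close> at time \<open>t\<close> under the perturbed process.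

  The spectral gap survives the perturbation. Both semigroups fix constants, so \<open>Lhat 1 = 0\<close>
  (\<open>Lhat_one\<close>). For \<open>F\<close> in the domain of the perturbed generator with image \<open>U\<close> and \<open>\<mu>\<close>-mean \<open>m\<close>, the scalar
  product of \<open>F - m\<close> with \<open>U\<close> is therefore at most \<open>- (\<gamma> - \<epsilon>)\<close> times the variance of \<open>F\<close>, while the mean of \<open>U\<close>
  comes from the perturbation alone and is at most \<open>\<epsilon>\<close> times the standard deviation of \<open>F\<close>
  (\<open>generator_energy\<close>). Along an orbit \<open>P\<^sub>t g\<close> these are differential inequalities: the variance decays
  exponentially (\<open>variance_decay\<close>) and the total drift of the mean is bounded by a multiple of the initial
  standard deviation (\<open>mean_drift\<close>).

  The calculus in \<open>L\<^sup>2 \<mu>\<close> is done with bounded functions and pointwise limits. The hypothesis identifies \<open>Seps t\<close>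
  with \<open>P\<^sub>t\<close> on bounded continuous functions, and approximation extends this to all bounded Borel functions
  (\<open>Seps_eq_transition\<close>). Averaging an orbit of a bounded continuous function over a short window of time
  yields bounded functions that are differentiable in time from the right, by right-continuity of the paths;
  bounded convergence turns pointwise into \<open>L\<^sup>2\<close> derivatives (\<open>orbit_average_in_generator\<close>).

  Let \<open>\<nu>\<close> be invariant for the perturbed process and absolutely continuous. Bounded functions with \<open>P\<^sub>1 h = h\<close>
  have variance \<open>0\<close> and are constant almost everywhere (\<open>harmonic_AE_constant\<close>). The decay of the variance
  identifies the \<open>\<nu>\<close>-mean of a bounded function \<open>h\<close> as a limit of \<open>\<mu>\<close>-means of \<open>P\<^sub>t h\<close>, so it is bounded by a multiple of the
  norm of \<open>h\<close> in \<open>L\<^sup>2 \<mu>\<close>; hence \<open>L\<^sup>2 \<mu> \<subseteq> L\<^sup>1 \<nu>\<close> (\<open>L2_subset_invariant_L1\<close>).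

  If a path event \<open>B\<close> is invariant under the shift by one unit of time, its probability as a function of the
  starting point satisfies \<open>P\<^sub>1 h = h\<close>, so it is constant; by the Markov property \<open>B\<close> is then independent of
  the past up to every integer time, hence of itself (\<open>shift_invariant_trivial\<close>). The shift is thus
  ergodic for the stationary process with initial law \<open>\<nu>\<close>, and Birkhoff's theorem (\<open>birkhoff\<close>), applied to the
  integral of \<open>f\<close> along the path over one unit of time, gives convergence along integer times. Monotonicity fills
  the gaps between integers, and truncation treats nonnegative functions of infinite mean.
\<close>

section \<open>Birkhoff's pointwise ergodic theorem\<close>

text \<open>The maximum of the ergodic sums \<open>f x + \<dots> + f (T\<^sup>k\<^sup>-\<^sup>1 x)\<close> over \<open>k \<le> n\<close>, where the empty sum counts
  as \<open>0\<close>. The recursion is the identity on which Garsia's proof of the maximal inequality rests.\<close>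

primrec max_ergodic_sum :: "('a \<Rightarrow> 'a) \<Rightarrow> ('a \<Rightarrow> real) \<Rightarrow> nat \<Rightarrow> 'a \<Rightarrow> real" where
  "max_ergodic_sum T f 0 = (\<lambda>x. 0)"
| "max_ergodic_sum T f (Suc n) = (\<lambda>x. max 0 (f x + max_ergodic_sum T f n (T x)))"

lemma max_ergodic_sum_nonneg: "0 \<le> max_ergodic_sum T f n x"
  by (cases n) auto

lemma max_ergodic_sum_mono: "max_ergodic_sum T f n x \<le> max_ergodic_sum T f (Suc n) x"
proof (induction n arbitrary: x)
  case (Suc n)
  have "max_ergodic_sum T f n (T x) \<le> max_ergodic_sum T f (Suc n) (T x)" by (rule Suc)
  then show ?case by auto
qed simp

lemma ergodic_sum_le_max: "k \<le> n \<Longrightarrow> (\<Sum>i<k. f ((T ^^ i) x)) \<le> max_ergodic_sum T f n x"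
proof (induction n arbitrary: k x)
  case (Suc n)
  show ?case
  proof (cases k)
    case (Suc j)
    have "(\<Sum>i<k. f ((T ^^ i) x)) = f x + (\<Sum>i<j. f ((T ^^ i) (T x)))"
      unfolding Suc by (subst sum.lessThan_Suc_shift) (simp add: funpow_swap1)
    moreover have "(\<Sum>i<j. f ((T ^^ i) (T x))) \<le> max_ergodic_sum T f n (T x)"
      using Suc.prems Suc by (intro Suc.IH) auto
    ultimately show ?thesis by simp
  qed (use max_ergodic_sum_nonneg[of T f "Suc n" x] in simp)
qed simp

locale measure_preserving = prob_space M for M :: "'a measure" +
  fixes T :: "'a \<Rightarrow> 'a"
  assumes measurable_T[measurable]: "T \<in> M \<rightarrow>\<^sub>M M"
    and distr_T: "distr M M T = M"
begin

lemma integrable_T: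
  assumes "integrable M f" shows "integrable M (\<lambda>x. f (T x) :: real)"
proof -
  have "integrable (distr M M T) f" using assms distr_T by simp
  then show ?thesis by (subst (asm) integrable_distr_eq) (use assms in auto)
qed

lemma integral_T:
  assumes [measurable]: "f \<in> borel_measurable M" shows "(\<integral>x. f (T x) \<partial>M) = (\<integral>x. f x \<partial>M :: real)"
  using integral_distr[of T M M f] distr_T by simp

lemma measurable_funpow[measurable]: "(T ^^ n) \<in> M \<rightarrow>\<^sub>M M"
  by (induction n) auto

lemma integrable_max_ergodic_sum:
  assumes "integrable M f" shows "integrable M (max_ergodic_sum T f n)"
proof (induction n)
  case (Suc n)
  then show ?case using assms integrable_T[OF Suc] by simp
qed simp

text \<open>Garsia's argument: where the maximum \<open>M\<^sub>n\<close> is positive, the recursion gives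
  \<open>f = M\<^sub>n - M\<^sub>n\<^sub>-\<^sub>1 \<circ> T \<ge> M\<^sub>n - M\<^sub>n \<circ> T\<close>; elsewhere \<open>M\<^sub>n - M\<^sub>n \<circ> T \<le> 0\<close>. The difference
  \<open>M\<^sub>n - M\<^sub>n \<circ> T\<close> has integral \<open>0\<close> because \<open>T\<close> preserves the measure.\<close>

lemma maximal_ergodic_inequality_finite:
  assumes f: "integrable M f"
  shows "0 \<le> (\<integral>x. f x * indicator {x. 0 < max_ergodic_sum T f n x} x \<partial>M)"
proof (cases n)
  case (Suc m)
  note I = integrable_max_ergodic_sum[OF f]
  note [measurable] = borel_measurable_integrable[OF I] borel_measurable_integrable[OF f]
  have "0 = (\<integral>x. max_ergodic_sum T f n x - max_ergodic_sum T f n (T x) \<partial>M)"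
    by (subst Bochner_Integration.integral_diff) (auto intro!: I integrable_T simp: integral_T)
  also have "\<dots> \<le> (\<integral>x. f x * indicator {x. 0 < max_ergodic_sum T f n x} x \<partial>M)"
  proof (rule integral_mono)
    have m: "{x \<in> space M. 0 < max_ergodic_sum T f n x} \<in> sets M" by measurable
    show "integrable M (\<lambda>x. f x * indicator {x. 0 < max_ergodic_sum T f n x} x)"
      using integrable_mult_indicator[OF m f]
      by (rule Bochner_Integration.integrable_cong[OF refl, THEN iffD1, rotated]) (auto split: split_indicator)
    fix x
    have "max_ergodic_sum T f m (T x) \<le> max_ergodic_sum T f n (T x)"
      unfolding Suc by (rule max_ergodic_sum_mono)
    then show "max_ergodic_sum T f n x - max_ergodic_sum T f n (T x)
        \<le> f x * indicator {x. 0 < max_ergodic_sum T f n x} x"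
      using max_ergodic_sum_nonneg[of T f n "T x"] max_ergodic_sum_nonneg[of T f m "T x"]
      by (auto simp: Suc split: split_indicator)
  qed (auto intro!: I integrable_T Bochner_Integration.integrable_diff)
  finally show ?thesis .
qed simp

lemma maximal_ergodic_inequality:
  fixes f :: "'a \<Rightarrow> real"
  assumes f: "integrable M f" and pos: "AE x in M. \<exists>n. 0 < (\<Sum>i<n. f ((T ^^ i) x))"
  shows "0 \<le> (\<integral>x. f x \<partial>M)"
proof -
  note I = integrable_max_ergodic_sum[OF f]
  note [measurable] = borel_measurable_integrable[OF I] borel_measurable_integrable[OF f]
  have lim: "(\<lambda>n. \<integral>x. f x * indicator {x\<in>space M. 0 < max_ergodic_sum T f n x} x \<partial>M) \<longlonglongrightarrow> (\<integral>x. f x \<partial>M)"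
  proof (rule integral_dominated_convergence[where w = "\<lambda>x. \<bar>f x\<bar>"])
    show "AE x in M. (\<lambda>n. f x * indicator {x\<in>space M. 0 < max_ergodic_sum T f n x} x) \<longlonglongrightarrow> f x"
      using pos AE_space
    proof eventually_elim
      case (elim x)
      then obtain n where n: "0 < (\<Sum>i<n. f ((T ^^ i) x))" by auto
      have "\<forall>\<^sub>F k in sequentially. f x * indicator {x\<in>space M. 0 < max_ergodic_sum T f k x} x = f x"
        using eventually_ge_at_top[of n]
      proof eventually_elim
        case (elim k)
        then show ?case using ergodic_sum_le_max[OF elim, of f T x] n \<open>x \<in> space M\<close> by (auto split: split_indicator)
      qed
      then show ?case by (rule tendsto_eventually)
    qed
  qed (use f in \<open>auto split: split_indicator\<close>)
  have "(\<integral>x. f x * indicator {x\<in>space M. 0 < max_ergodic_sum T f n x} x \<partial>M)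
      = (\<integral>x. f x * indicator {x. 0 < max_ergodic_sum T f n x} x \<partial>M)" for n
    by (rule Bochner_Integration.integral_cong) (auto split: split_indicator)
  then have "0 \<le> (\<integral>x. f x * indicator {x\<in>space M. 0 < max_ergodic_sum T f n x} x \<partial>M)" for n
    using maximal_ergodic_inequality_finite[OF f] by simp
  then show ?thesis by (intro LIMSEQ_le_const[OF lim]) auto
qed

end

locale ergodic_transformation = measure_preserving +
  assumes ergodic: "\<And>B. B \<in> sets M \<Longrightarrow> T -` B \<inter> space M = B \<Longrightarrow> prob B = 0 \<or> prob B = 1"
begin

text \<open>The event that the averages exceed some level above \<open>d\<close> infinitely often is invariant, so it has
  probability \<open>0\<close> or \<open>1\<close>. Probability \<open>1\<close> would make some ergodic sum of \<open>f - d\<close> positive almost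
  everywhere, and then the maximal inequality would give \<open>\<integral>f \<ge> d\<close>.\<close>

lemma birkhoff_upper:
  fixes f :: "'a \<Rightarrow> real"
  assumes f: "integrable M f" and c: "(\<integral>x. f x \<partial>M) < c"
  shows "AE x in M. \<forall>\<^sub>F n in sequentially. (\<Sum>i<n. f ((T ^^ i) x)) / real n \<le> c"
proof -
  note [measurable] = borel_measurable_integrable[OF f]
  define d where "d = ((\<integral>x. f x \<partial>M) + c) / 2"
  have d: "(\<integral>x. f x \<partial>M) < d" "d < c" using c by (auto simp: d_def field_simps)
  define S where "S n x = (\<Sum>i<n. f ((T ^^ i) x))" for n x
  have S_T: "S n (T x) = S (Suc n) x - f x" for n x
    unfolding S_def by (subst sum.lessThan_Suc_shift) (simp add: funpow_swap1)
  have S_meas[measurable]: "S n \<in> borel_measurable M" for n unfolding S_def by measurable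
  \<comment> \<open>The slack \<open>1 / Suc k\<close> absorbs the term by which the sums at \<open>T x\<close> and at \<open>x\<close> differ.\<close>
  define E where "E = {x \<in> space M. \<exists>k. \<exists>\<^sub>F n in sequentially. (d + 1 / real (Suc k)) * real n < S n x}"
  have E_sets[measurable]: "E \<in> sets M"
    unfolding E_def frequently_sequentially by measurable
  have "T x \<in> E \<longleftrightarrow> x \<in> E" if x: "x \<in> space M" for x
  proof -
    have shift: "(\<exists>\<^sub>F n in sequentially. P (Suc n)) \<longleftrightarrow> (\<exists>\<^sub>F n in sequentially. P n)" for P
      unfolding frequently_def using eventually_sequentially_Suc[of "\<lambda>n. \<not> P n"] by simp
    have ev: "\<forall>\<^sub>F n in sequentially. q * (real n + b) + y < p * (real n + a)" if "q < p" for p q a b y :: real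
      using that by real_asymp
    have imp: "\<exists>k. \<exists>\<^sub>F n in sequentially. (d + 1 / real (Suc k)) * (real n + b) < V n"
      if *: "\<exists>\<^sub>F n in sequentially. (d + 1 / real (Suc k)) * (real n + a) < U n" and UV: "\<And>n. U n \<le> V n + y"
      for U V :: "nat \<Rightarrow> real" and y k a b
    proof
      have "\<forall>\<^sub>F n in sequentially. (d + 1 / real (Suc (Suc k))) * (real n + b) + y < (d + 1 / real (Suc k)) * (real n + a)"
        by (rule ev) (simp add: field_simps)
      then show "\<exists>\<^sub>F n in sequentially. (d + 1 / real (Suc (Suc k))) * (real n + b) < V n"
      proof (rule frequently_rev_mp[OF * eventually_mono])
        fix n assume "(d + 1 / real (Suc (Suc k))) * (real n + b) + y < (d + 1 / real (Suc k)) * (real n + a)"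
        then show "(d + 1 / real (Suc k)) * (real n + a) < U n \<longrightarrow> (d + 1 / real (Suc (Suc k))) * (real n + b) < V n"
          using UV[of n] by linarith
      qed
    qed
    have "T x \<in> E \<longleftrightarrow> (\<exists>k. \<exists>\<^sub>F n in sequentially. (d + 1 / real (Suc k)) * (real n + 0) < S (Suc n) x - f x)"
      using x measurable_T[THEN measurable_space] by (simp add: E_def S_T)
    also have "\<dots> \<longleftrightarrow> (\<exists>k. \<exists>\<^sub>F n in sequentially. (d + 1 / real (Suc k)) * (real n + 1) < S (Suc n) x)"
      using imp[of _ 0 "\<lambda>n. S (Suc n) x - f x" "\<lambda>n. S (Suc n) x" "- f x" 1]
        imp[of _ 1 "\<lambda>n. S (Suc n) x" "\<lambda>n. S (Suc n) x - f x" "f x" 0] by auto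
    also have "\<dots> \<longleftrightarrow> (\<exists>k. \<exists>\<^sub>F n in sequentially. (d + 1 / real (Suc k)) * real (Suc n) < S (Suc n) x)"
      by (simp add: add.commute)
    also have "\<dots> \<longleftrightarrow> x \<in> E"
      using x by (simp only: shift[of "\<lambda>n. (d + 1 / real (Suc _)) * real n < S n x"]) (simp add: E_def)
    finally show ?thesis .
  qed
  then have "T -` E \<inter> space M = E" by (auto simp: E_def)
  then consider "prob E = 0" | "prob E = 1" using ergodic[OF E_sets] by blast
  then show ?thesis
  proof cases
    case 1
    then have "AE x in M. x \<notin> E" by (simp add: prob_eq_0)
    then show ?thesis using AE_space
    proof eventually_elim
      case (elim x)
      obtain k where k: "inverse (real (Suc k)) < c - d" using reals_Archimedean[of "c - d"] d by auto
      from elim have "\<forall>\<^sub>F n in sequentially. \<not> (d + 1 / real (Suc k)) * real n < S n x"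
        by (auto simp: E_def not_frequently)
      then show ?case using eventually_gt_at_top[of 0]
      proof eventually_elim
        case (elim n)
        have "S n x \<le> (d + 1 / real (Suc k)) * real n" using elim by simp
        also have "\<dots> \<le> c * real n" using k by (intro mult_right_mono) (auto simp: field_simps)
        finally show ?case using elim by (simp add: S_def field_simps)
      qed
    qed
  next
    case 2
    have "0 \<le> (\<integral>x. f x - d \<partial>M)"
    proof (rule maximal_ergodic_inequality)
      have "AE x in M. x \<in> E" using 2 by (simp add: prob_eq_1)
      then show "AE x in M. \<exists>n. 0 < (\<Sum>i<n. f ((T ^^ i) x) - d)"
      proof eventually_elim
        case (elim x)
        then obtain k where "\<exists>\<^sub>F n in sequentially. (d + 1 / real (Suc k)) * real n < S n x" by (auto simp: E_def)
        then obtain n where "(d + 1 / real (Suc k)) * real n < S n x" by (auto dest: frequently_ex)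
        moreover have "d * real n \<le> (d + 1 / real (Suc k)) * real n" by (intro mult_right_mono) auto
        ultimately show ?case by (intro exI[of _ n]) (simp add: S_def sum_subtractf mult.commute)
      qed
    qed (use f in simp)
    then show ?thesis using f d by (simp add: prob_space)
  qed
qed

theorem birkhoff:
  fixes f :: "'a \<Rightarrow> real"
  assumes f: "integrable M f"
  shows "AE x in M. (\<lambda>n. (\<Sum>i<n. f ((T ^^ i) x)) / real n) \<longlonglongrightarrow> (\<integral>x. f x \<partial>M)"
proof -
  have up: "AE x in M. \<forall>k. \<forall>\<^sub>F n in sequentially. (\<Sum>i<n. g ((T ^^ i) x)) / real n \<le> (\<integral>x. g x \<partial>M) + 1 / real (Suc k)"
    if "integrable M g" for g :: "'a \<Rightarrow> real"
    unfolding AE_all_countable by (intro allI birkhoff_upper that) simp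
  show ?thesis using up[OF f] up[OF integrable_minus[OF f]]
  proof eventually_elim
    case (elim x)
    show ?case
    proof (rule tendstoI)
      fix e :: real assume "e > 0"
      then obtain k where k: "inverse (real (Suc k)) < e" using reals_Archimedean by blast
      from elim(1)[rule_format, of k] elim(2)[rule_format, of k]
      show "\<forall>\<^sub>F n in sequentially. dist ((\<Sum>i<n. f ((T ^^ i) x)) / real n) (\<integral>x. f x \<partial>M) < e"
        by eventually_elim (use k in \<open>auto simp: dist_real_def sum_negf inverse_eq_divide\<close>)
    qed
  qed
qed

end

section \<open>One-sided derivatives and bounded convergence\<close>

text \<open>Right derivatives suffice for monotonicity. Otherwise \<open>w\<close> would, for some \<open>e > 0\<close>, end up above
  the line of slope \<open>e\<close> through \<open>(a, w a)\<close>; at the last point where \<open>w\<close> is not above the line, its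
  right derivative would have to be at least \<open>e\<close>.\<close>

lemma right_derivative_nonpos_imp_le:
  fixes w :: "real \<Rightarrow> real"
  assumes ab: "a \<le> b" and cont: "continuous_on {a..b} w"
    and deriv: "\<And>t. a \<le> t \<Longrightarrow> t < b \<Longrightarrow> \<exists>D\<le>0. (w has_real_derivative D) (at_right t)"
  shows "w b \<le> w a"
proof (rule field_le_epsilon)
  fix e' :: real assume "e' > 0"
  define e where "e = e' / (b - a + 1)"
  have e: "e > 0" "e * (b - a) \<le> e'" using \<open>e' > 0\<close> ab by (auto simp: e_def field_simps)
  have "w b \<le> w a + e * (b - a)"
  proof (rule ccontr)
    assume neg: "\<not> ?thesis"
    define A where "A = {t\<in>{a..b}. w t \<le> w a + e * (t - a)}"
    have "closed A" unfolding A_def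
      by (intro continuous_on_closed_Collect_le cont continuous_intros)
    moreover have "a \<in> A" using ab by (simp add: A_def)
    moreover have bdd: "bdd_above A" by (auto simp: A_def intro: bdd_aboveI[of _ b])
    ultimately have c: "Sup A \<in> A" by (intro closed_contains_Sup) auto
    define c where "c = Sup A"
    have cA: "c \<in> A" using c by (simp add: c_def)
    then have "a \<le> c" "c < b" using neg by (auto simp: A_def less_le)
    from deriv[OF this] obtain D where "D \<le> 0" "(w has_real_derivative D) (at_right c)" by auto
    then have "((\<lambda>t. (w t - w c) / (t - c)) \<longlongrightarrow> D) (at_right c)"
      by (simp add: has_field_derivative_iff)
    then have "\<forall>\<^sub>F t in at_right c. (w t - w c) / (t - c) < e"
      by (rule order_tendstoD(2)) (use \<open>D \<le> 0\<close> e in simp)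
    moreover have "\<forall>\<^sub>F t in at_right c. t \<in> {c<..<b}"
      using \<open>c < b\<close> eventually_at_right_real by blast
    ultimately have "\<exists>t. (w t - w c) / (t - c) < e \<and> t \<in> {c<..<b}"
      by (intro eventually_happens'[of "at_right c"] eventually_conj) auto
    then obtain t where t: "(w t - w c) / (t - c) < e" "c < t" "t < b" by auto
    then have "w t - w c < e * (t - c)" by (simp add: field_simps)
    then have "t \<in> A" using cA t \<open>a \<le> c\<close> by (auto simp: A_def algebra_simps)
    then have "t \<le> c" unfolding c_def using bdd by (rule cSup_upper)
    with t show False by simp
  qed
  then show "w b \<le> w a + e'" using e by simp
qed

lemma gronwall_right:
  fixes v :: "real \<Rightarrow> real"
  assumes "0 \<le> t" and cont: "continuous_on {0..} v"
    and deriv: "\<And>s. 0 \<le> s \<Longrightarrow> (v has_real_derivative D s) (at_right s)"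
    and le: "\<And>s. 0 \<le> s \<Longrightarrow> D s \<le> - k * v s"
  shows "v t \<le> exp (- k * t) * v 0"
proof -
  have "exp (k * t) * v t \<le> exp (k * 0) * v 0"
  proof (rule right_derivative_nonpos_imp_le[OF \<open>0 \<le> t\<close>])
    show "continuous_on {0..t} (\<lambda>t. exp (k * t) * v t)"
      by (intro continuous_intros continuous_on_subset[OF cont]) auto
    fix s :: real assume s: "0 \<le> s"
    have "((\<lambda>t. exp (k * t) * v t) has_real_derivative exp (k * s) * (k * v s + D s)) (at_right s)"
      by (rule derivative_eq_intros refl deriv s | simp add: algebra_simps)+
    moreover have "exp (k * s) * (k * v s + D s) \<le> 0"
      using le[OF s] by (intro mult_nonneg_nonpos) auto
    ultimately show "\<exists>D\<le>0. ((\<lambda>t. exp (k * t) * v t) has_real_derivative D) (at_right s)" by blast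
  qed
  then have "exp (- k * t) * (exp (k * t) * v t) \<le> exp (- k * t) * v 0"
    by (intro mult_left_mono) auto
  then show ?thesis by (simp add: mult.assoc[symmetric] exp_add[symmetric])
qed

text \<open>The total drift of a function whose speed decays like \<open>C * exp (- c * s)\<close>: adding
  \<open>C / c * exp (- c * t)\<close> to \<open>m\<close> or to \<open>- m\<close> makes it nonincreasing.\<close>

lemma right_derivative_exp_decay_bound:
  fixes m :: "real \<Rightarrow> real"
  assumes "0 \<le> t" and c: "c > 0" and C: "C \<ge> 0" and cont: "continuous_on {0..} m"
    and deriv: "\<And>s. 0 \<le> s \<Longrightarrow> (m has_real_derivative D s) (at_right s)"
    and le: "\<And>s. 0 \<le> s \<Longrightarrow> \<bar>D s\<bar> \<le> C * exp (- c * s)"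
  shows "\<bar>m t - m 0\<bar> \<le> C / c"
proof -
  have main: "n t \<le> n 0 + C / c" if n: "n = m \<or> n = (\<lambda>s. - m s)" for n
  proof -
    obtain D' where D': "\<And>s. 0 \<le> s \<Longrightarrow> (n has_real_derivative D' s) (at_right s)" "\<And>s. 0 \<le> s \<Longrightarrow> D' s \<le> C * exp (- c * s)"
    proof (cases "n = m")
      case True
      with deriv le show thesis by (intro that[of D]) (auto simp: abs_le_iff)
    next
      case False
      then have "n = (\<lambda>s. - m s)" using n by auto
      with deriv le show thesis by (intro that[of "\<lambda>s. - D s"]) (auto simp: abs_le_iff intro!: DERIV_minus)
    qed
    have "n t + C / c * exp (- c * t) \<le> n 0 + C / c * exp (- c * 0)"
    proof (rule right_derivative_nonpos_imp_le[OF \<open>0 \<le> t\<close>])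
      show "continuous_on {0..t} (\<lambda>t. n t + C / c * exp (- c * t))"
        using n c by (auto intro!: continuous_intros continuous_on_subset[OF cont])
      fix s :: real assume s: "0 \<le> s"
      have "((\<lambda>t. n t + C / c * exp (- c * t)) has_real_derivative D' s - C * exp (- c * s)) (at_right s)"
        by (rule derivative_eq_intros refl D' s | use c in simp)+
      then show "\<exists>D\<le>0. ((\<lambda>t. n t + C / c * exp (- c * t)) has_real_derivative D) (at_right s)"
        using D'(2)[OF s] by (intro exI[of _ "D' s - C * exp (- c * s)"]) auto
    qed
    moreover have "0 \<le> C / c * exp (- c * t)" using c C by simp
    ultimately show ?thesis by simp
  qed
  show ?thesis using main[of m] main[of "\<lambda>s. - m s"] by (auto simp: abs_le_iff)
qed

lemma (in finite_measure) bounded_convergence: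
  fixes g :: "nat \<Rightarrow> 'a \<Rightarrow> real"
  assumes [measurable]: "\<And>n. g n \<in> borel_measurable M" "h \<in> borel_measurable M"
    and bound: "\<And>n x. x \<in> space M \<Longrightarrow> \<bar>g n x\<bar> \<le> B"
    and lim: "AE x in M. (\<lambda>n. g n x) \<longlonglongrightarrow> h x"
  shows "(\<lambda>n. \<integral>x. g n x \<partial>M) \<longlonglongrightarrow> (\<integral>x. h x \<partial>M)"
  by (rule integral_dominated_convergence[where w = "\<lambda>_. B"]) (auto simp: bound lim)

lemma (in finite_measure) bounded_convergence_at_right:
  fixes g :: "real \<Rightarrow> 'a \<Rightarrow> real"
  assumes "\<And>r. r > t \<Longrightarrow> g r \<in> borel_measurable M" "h \<in> borel_measurable M"
    and "\<And>r x. r > t \<Longrightarrow> x \<in> space M \<Longrightarrow> \<bar>g r x\<bar> \<le> B"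
    and lim: "\<And>x. x \<in> space M \<Longrightarrow> ((\<lambda>r. g r x) \<longlongrightarrow> h x) (at_right t)"
  shows "((\<lambda>r. \<integral>x. g r x \<partial>M) \<longlongrightarrow> (\<integral>x. h x \<partial>M)) (at_right t)"
  unfolding tendsto_at_iff_sequentially comp_def
proof (intro allI impI bounded_convergence AE_I2)
  fix X :: "nat \<Rightarrow> real" and x assume "\<forall>i. X i \<in> {t<..} - {t}" "X \<longlonglongrightarrow> t" "x \<in> space M"
  then show "(\<lambda>i. g (X i) x) \<longlonglongrightarrow> h x"
    using lim unfolding tendsto_at_iff_sequentially comp_def by blast
qed (use assms in auto)

section \<open>Approximation by bounded continuous functions\<close>

definition Cb_approximable :: "'a::metric_space measure \<Rightarrow> ('a \<Rightarrow> real) \<Rightarrow> bool" where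
  "Cb_approximable M h \<longleftrightarrow> integrable M h \<and>
     (\<forall>e>0. \<exists>g. continuous_on UNIV g \<and> bounded (range g) \<and> (\<integral>x. \<bar>g x - h x\<bar> \<partial>M) < e)"

context
  fixes M :: "'a::metric_space measure"
  assumes sets_M[measurable_cong]: "sets M = sets borel" and finite_M: "finite_measure M"
begin

interpretation finite_measure M by (rule finite_M)

lemma integrable_bounded_continuous:
  fixes g :: "'a \<Rightarrow> real"
  assumes "continuous_on UNIV g" "bounded (range g)"
  shows "integrable M g"
proof -
  obtain B where "\<And>x. norm (g x) \<le> B" using assms(2) by (auto simp: bounded_iff)
  moreover have "g \<in> borel_measurable M"
    using borel_measurable_continuous_onI[OF assms(1)] by measurable
  ultimately show ?thesis by (intro integrable_const_bound[of _ B]) auto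
qed

lemma Cb_approximable_bounded_continuous:
  assumes "continuous_on UNIV g" "bounded (range g)" shows "Cb_approximable M g"
  using assms by (auto simp: Cb_approximable_def integrable_bounded_continuous intro!: exI[of _ g])

lemma Cb_approximable_add:
  assumes "Cb_approximable M h" "Cb_approximable M k" shows "Cb_approximable M (\<lambda>x. h x + k x)"
  unfolding Cb_approximable_def
proof safe
  show "integrable M (\<lambda>x. h x + k x)" using assms by (auto simp: Cb_approximable_def)
  fix e :: real assume "e > 0"
  then have "e / 2 > 0" by simp
  with assms obtain g g' where g: "continuous_on UNIV g" "bounded (range g)" "(\<integral>x. \<bar>g x - h x\<bar> \<partial>M) < e / 2"
    and g': "continuous_on UNIV g'" "bounded (range g')" "(\<integral>x. \<bar>g' x - k x\<bar> \<partial>M) < e / 2"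
    unfolding Cb_approximable_def by meson
  have "(\<integral>x. \<bar>(g x + g' x) - (h x + k x)\<bar> \<partial>M) \<le> (\<integral>x. \<bar>g x - h x\<bar> + \<bar>g' x - k x\<bar> \<partial>M)"
    using assms g g' by (intro integral_mono) (auto simp: Cb_approximable_def integrable_bounded_continuous)
  also have "\<dots> < e"
    using assms g g' by (subst Bochner_Integration.integral_add) (auto simp: Cb_approximable_def integrable_bounded_continuous)
  finally show "\<exists>g. continuous_on UNIV g \<and> bounded (range g) \<and> (\<integral>x. \<bar>g x - (h x + k x)\<bar> \<partial>M) < e"
    using g g' by (intro exI[of _ "\<lambda>x. g x + g' x"]) (auto intro!: continuous_intros bounded_plus_comp)
qed

lemma Cb_approximable_cmult:
  assumes "Cb_approximable M h" shows "Cb_approximable M (\<lambda>x. c * h x)"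
  unfolding Cb_approximable_def
proof safe
  show "integrable M (\<lambda>x. c * h x)" using assms by (auto simp: Cb_approximable_def)
  fix e :: real assume "e > 0"
  then have "e / (\<bar>c\<bar> + 1) > 0" by simp
  with assms obtain g where g: "continuous_on UNIV g" "bounded (range g)" "(\<integral>x. \<bar>g x - h x\<bar> \<partial>M) < e / (\<bar>c\<bar> + 1)"
    unfolding Cb_approximable_def by meson
  obtain B where "\<And>x. \<bar>g x\<bar> \<le> B" using g(2) by (auto simp: bounded_iff)
  then have bounded: "bounded (range (\<lambda>x. c * g x))"
    by (auto simp: bounded_iff abs_mult intro!: exI[of _ "\<bar>c\<bar> * B"] mult_left_mono)
  have "(\<integral>x. \<bar>c * g x - c * h x\<bar> \<partial>M) = \<bar>c\<bar> * (\<integral>x. \<bar>g x - h x\<bar> \<partial>M)"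
    by (simp add: abs_mult right_diff_distrib[symmetric])
  also have "\<dots> \<le> (\<bar>c\<bar> + 1) * (\<integral>x. \<bar>g x - h x\<bar> \<partial>M)" by (intro mult_right_mono) auto
  also have "\<dots> < e" using g(3) by (simp add: field_simps)
  finally show "\<exists>g. continuous_on UNIV g \<and> bounded (range g) \<and> (\<integral>x. \<bar>g x - c * h x\<bar> \<partial>M) < e"
    using g bounded by (intro exI[of _ "\<lambda>x. c * g x"]) (auto intro!: continuous_intros)
qed

lemma Cb_approximable_limit:
  assumes s: "\<And>i. Cb_approximable M (s i)" and w: "integrable M w" and [measurable]: "h \<in> borel_measurable M"
    and le: "\<And>i x. \<bar>s i x\<bar> \<le> w x" and lim: "\<And>x. (\<lambda>i. s i x) \<longlonglongrightarrow> h x"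
  shows "Cb_approximable M h"
  unfolding Cb_approximable_def
proof safe
  have s_int: "integrable M (s i)" for i using s by (simp add: Cb_approximable_def)
  note [measurable] = borel_measurable_integrable[OF s_int]
  have h_le: "\<bar>h x\<bar> \<le> w x" for x
    using tendsto_rabs[OF lim] by (rule LIMSEQ_le_const2) (use le in auto)
  show h_int: "integrable M h" using h_le by (intro Bochner_Integration.integrable_bound[OF w]) (auto intro!: AE_I2 intro: order_trans[OF _ abs_ge_self])
  have conv: "(\<lambda>i. \<integral>x. \<bar>s i x - h x\<bar> \<partial>M) \<longlonglongrightarrow> (\<integral>x. 0 \<partial>M)"
  proof (rule integral_dominated_convergence[where w = "\<lambda>x. 2 * w x"])
    show "AE x in M. (\<lambda>i. \<bar>s i x - h x\<bar>) \<longlonglongrightarrow> 0"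
      using lim by (auto intro!: tendsto_rabs_zero simp: LIM_zero_iff)
    show "AE x in M. norm \<bar>s i x - h x\<bar> \<le> 2 * w x" for i
      using le[of i] h_le by (intro AE_I2) (smt (verit) real_norm_def)
  qed (use w in auto)
  fix e :: real assume "e > 0"
  with conv have "\<forall>\<^sub>F i in sequentially. (\<integral>x. \<bar>s i x - h x\<bar> \<partial>M) < e / 2"
    by (intro order_tendstoD) auto
  then obtain i where i: "(\<integral>x. \<bar>s i x - h x\<bar> \<partial>M) < e / 2" by (auto simp: eventually_sequentially)
  from s[of i] \<open>e > 0\<close> obtain g where g: "continuous_on UNIV g" "bounded (range g)" "(\<integral>x. \<bar>g x - s i x\<bar> \<partial>M) < e / 2"
    unfolding Cb_approximable_def by (meson half_gt_zero)
  have "(\<integral>x. \<bar>g x - h x\<bar> \<partial>M) \<le> (\<integral>x. \<bar>g x - s i x\<bar> + \<bar>s i x - h x\<bar> \<partial>M)"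
    using g h_int s_int by (intro integral_mono) (auto simp: integrable_bounded_continuous)
  also have "\<dots> < e" using g i h_int s_int
    by (subst Bochner_Integration.integral_add) (auto simp: integrable_bounded_continuous)
  finally show "\<exists>g. continuous_on UNIV g \<and> bounded (range g) \<and> (\<integral>x. \<bar>g x - h x\<bar> \<partial>M) < e" using g by blast
qed

text \<open>The continuous functions \<open>max 0 (1 - n * infdist x A)\<close> decrease to the indicator of a closed set.\<close>

lemma Cb_approximable_closed:
  assumes "closed A" shows "Cb_approximable M (indicator A)"
proof (cases "A = {}")
  case True
  then show ?thesis using Cb_approximable_bounded_continuous[of "\<lambda>_. 0"] by (simp add: indicator_def[abs_def])
next
  case False
  show ?thesis
  proof (rule Cb_approximable_limit[where w = "\<lambda>_. 1" and s = "\<lambda>n x. max 0 (1 - real n * infdist x A)"])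
    show "Cb_approximable M (\<lambda>x. max 0 (1 - real n * infdist x A))" for n
    proof (rule Cb_approximable_bounded_continuous)
      show "bounded (range (\<lambda>x. max 0 (1 - real n * infdist x A)))"
        by (auto simp: bounded_iff infdist_nonneg intro!: exI[of _ 1])
    qed (intro continuous_intros)
    show "(\<lambda>n. max 0 (1 - real n * infdist x A)) \<longlonglongrightarrow> indicator A x" for x
    proof (cases "x \<in> A")
      case True then show ?thesis by simp
    next
      case x: False
      then have pos: "infdist x A > 0" using \<open>closed A\<close> False
        by (metis in_closed_iff_infdist_zero infdist_nonneg less_eq_real_def)
      obtain N where N: "1 < real N * infdist x A" using reals_Archimedean3[OF pos] by blast
      have "\<forall>\<^sub>F n in sequentially. max 0 (1 - real n * infdist x A) = 0"
        using eventually_ge_at_top[of N]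
      proof eventually_elim
        case (elim n)
        then have "real N * infdist x A \<le> real n * infdist x A" using pos by (intro mult_right_mono) auto
        then show ?case using N by simp
      qed
      then show ?thesis using x by (simp add: tendsto_eventually)
    qed
    show "indicator A \<in> borel_measurable M"
      using borel_closed[OF assms] sets_M by (intro borel_measurable_indicator) simp
  qed (auto simp: infdist_nonneg)
qed

text \<open>Closed sets form an intersection-stable generator of the Borel sets, and the approximable functions
  are closed under complements and disjoint unions of indicators, so a Dynkin argument applies.\<close>

lemma Cb_approximable_indicator:
  assumes "A \<in> sets borel" shows "Cb_approximable M (indicator A)"
proof -
  have *: "A \<in> sigma_sets UNIV (Collect closed)" using assms by (simp add: borel_eq_closed)
  have "Int_stable (Collect closed :: 'a set set)" by (auto simp: Int_stable_def)
  have "(Collect closed :: 'a set set) \<subseteq> Pow UNIV" by simp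
  from \<open>Int_stable (Collect closed :: 'a set set)\<close> this * show ?thesis
  proof (induction rule: sigma_sets_induct_disjoint)
    case (basic A) then show ?case by (simp add: Cb_approximable_closed)
  next
    case empty then show ?case by (rule Cb_approximable_closed) simp
  next
    case (compl A)
    have "Cb_approximable M (\<lambda>x. 1 + (- 1) * indicator A x)"
      by (rule Cb_approximable_add[OF Cb_approximable_bounded_continuous[of "\<lambda>_. 1"] Cb_approximable_cmult[OF compl(2)]]) auto
    moreover have "(\<lambda>x. 1 + (- 1) * indicator A x) = (indicator (UNIV - A) :: 'a \<Rightarrow> real)"
      by (auto split: split_indicator)
    ultimately show ?case by simp
  next
    case (union A)
    have sums: "(\<lambda>i. indicator (A i) x :: real) sums indicator (\<Union>i. A i) x" for x
    proof (cases "x \<in> (\<Union>i. A i)")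
      case True
      then obtain i where i: "x \<in> A i" by auto
      then have "indicator (A j) x = (if j = i then 1 else 0 :: real)" for j
        using union(1) by (auto simp: disjoint_family_on_def split: split_indicator)
      then show ?thesis using True sums_If_finite_set[of "{i}" "\<lambda>_. 1::real"] by simp
    qed simp
    show ?case
    proof (rule Cb_approximable_limit[where w = "\<lambda>_. 1" and s = "\<lambda>n x. \<Sum>i<n. indicator (A i) x"])
      show "Cb_approximable M (\<lambda>x. \<Sum>i<n. indicator (A i) x)" for n
      proof (induction n)
        case 0
        show ?case using Cb_approximable_bounded_continuous[of "\<lambda>_. 0"] by simp
      next
        case (Suc n)
        show ?case using Cb_approximable_add[OF Suc union(3)[of n]] by simp
      qed
      show "(\<lambda>n. \<Sum>i<n. indicator (A i) x :: real) \<longlonglongrightarrow> indicator (\<Union>i. A i) x" for x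
        using sums by (simp add: sums_def)
      show "\<bar>\<Sum>i<n. indicator (A i) x :: real\<bar> \<le> 1" for n x
      proof -
        have "(\<Sum>i<n. indicator (A i) x :: real) \<le> indicator (\<Union>i. A i) x"
          using sum_le_suminf[OF sums_summable[OF sums], of "{..<n}"] sums_unique[OF sums] by auto
        also have "\<dots> \<le> 1" by (auto split: split_indicator)
        finally show ?thesis by (simp add: sum_nonneg)
      qed
      have "range A \<subseteq> sets borel" using union(2) by (simp add: borel_eq_closed)
      then show "indicator (\<Union>i. A i) \<in> borel_measurable M" by (intro borel_measurable_indicator) auto
    qed auto
  qed
qed

lemma Cb_approximable_integrable:
  assumes "integrable M h" shows "Cb_approximable M h"
  using assms
proof (induction rule: integrable_induct)
  case (base A c)
  then show ?case using Cb_approximable_cmult[OF Cb_approximable_indicator[of A], of c] sets_M by (simp add: mult.commute)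
next
  case (add f g) then show ?case by (intro Cb_approximable_add)
next
  case (lim f s)
  have [simp]: "space M = UNIV" using sets_eq_imp_space_eq[OF sets_M] by simp
  show ?case
  proof (rule Cb_approximable_limit)
    show "Cb_approximable M (s i)" for i by (rule lim(5))
    show "integrable M (\<lambda>x. 2 * \<bar>f x\<bar>)" using lim(4) by simp
    show "\<bar>s i x\<bar> \<le> 2 * \<bar>f x\<bar>" for i x using lim(3)[of x i] by simp
    show "(\<lambda>i. s i x) \<longlonglongrightarrow> f x" for x using lim(2)[of x] by simp
  qed (use lim(4) in simp)
qed

text \<open>Approximation in \<open>L\<^sup>1\<close> becomes almost everywhere convergence along a subsequence, and truncation
  at \<open>\<plusminus>B\<close> keeps the uniform bound without spoiling the approximation.\<close>

lemma bounded_borel_AE_limit_of_continuous: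
  fixes h :: "'a \<Rightarrow> real"
  assumes h: "h \<in> borel_measurable borel" and B: "\<And>x. \<bar>h x\<bar> \<le> B"
  shows "\<exists>g. (\<forall>n::nat. continuous_on UNIV (g n) \<and> (\<forall>x. \<bar>g n x\<bar> \<le> B)) \<and> (AE x in M. (\<lambda>n. g n x) \<longlonglongrightarrow> h x)"
proof -
  have hM[measurable]: "h \<in> borel_measurable M" using h by measurable
  have h_int: "integrable M h" using B by (intro integrable_const_bound[of _ B]) auto
  have "\<exists>g. continuous_on UNIV g \<and> bounded (range g) \<and> (\<integral>x. \<bar>g x - h x\<bar> \<partial>M) < 1 / real (Suc n)" for n
    using Cb_approximable_integrable[OF h_int] unfolding Cb_approximable_def by simp
  then obtain g where g: "\<And>n. continuous_on UNIV (g n)" "\<And>n. bounded (range (g n))"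
    "\<And>n. (\<integral>x. \<bar>g n x - h x\<bar> \<partial>M) < 1 / real (Suc n)" by metis
  define k where "k n x = max (- B) (min B (g n x))" for n x
  have B0: "B \<ge> 0" using B[of undefined] by linarith
  have k: "continuous_on UNIV (k n)" "\<bar>k n x\<bar> \<le> B" for n x
    unfolding k_def using g(1) B0 by (auto intro!: continuous_intros)
  have g_int: "integrable M (g n)" and k_int: "integrable M (k n)" for n
    using integrable_bounded_continuous[OF g(1,2)] k by (auto intro!: integrable_bounded_continuous boundedI[of _ B])
  have "(\<lambda>n. \<integral>x. norm (k n x - h x) \<partial>M) \<longlonglongrightarrow> 0"
  proof (rule tendsto_sandwich[OF _ _ tendsto_const LIMSEQ_inverse_real_of_nat])
    show "\<forall>\<^sub>F n in sequentially. (\<integral>x. norm (k n x - h x) \<partial>M) \<le> inverse (real (Suc n))"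
    proof (intro always_eventually allI)
      fix n
      have "(\<integral>x. norm (k n x - h x) \<partial>M) \<le> (\<integral>x. \<bar>g n x - h x\<bar> \<partial>M)"
      proof (rule integral_mono)
        show "norm (k n x - h x) \<le> \<bar>g n x - h x\<bar>" for x using B[of x] by (auto simp: k_def)
      qed (use g_int k_int h_int in auto)
      with g(3)[of n] show "(\<integral>x. norm (k n x - h x) \<partial>M) \<le> inverse (real (Suc n))"
        by (simp add: inverse_eq_divide)
    qed
  qed auto
  then obtain r where "strict_mono r" "AE x in M. (\<lambda>n. k (r n) x - h x) \<longlonglongrightarrow> 0"
    using tendsto_L1_AE_subseq[of M "\<lambda>n x. k n x - h x"] k_int h_int by auto
  then show ?thesis using k by (intro exI[of _ "\<lambda>n. k (r n)"]) (auto simp: LIM_zero_iff)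
qed

end

text \<open>One sequence serves two measures at once: approximate with respect to their sum. This is what makes it
  possible to compare a distribution with its image under a transition kernel before anything is known
  about absolute continuity of the image.\<close>

lemma bounded_borel_AE_limit_of_continuous2:
  fixes M N :: "'a::metric_space measure" and h :: "'a \<Rightarrow> real"
  assumes M: "sets M = sets borel" "finite_measure M" and N: "sets N = sets borel" "finite_measure N"
    and h: "h \<in> borel_measurable borel" and B: "\<And>x. \<bar>h x\<bar> \<le> B"
  obtains g where "\<And>n::nat. continuous_on UNIV (g n)" "\<And>n x. \<bar>g n x\<bar> \<le> B"
    "AE x in M. (\<lambda>n. g n x) \<longlonglongrightarrow> h x" "AE x in N. (\<lambda>n. g n x) \<longlonglongrightarrow> h x"
proof -
  define S where "S = measure_of UNIV (sets borel) (\<lambda>A. emeasure M A + emeasure N A)"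
  have S_sets: "sets S = sets borel" unfolding S_def
    using sets.sigma_sets_eq[of "borel :: 'a measure"] by simp
  have S: "emeasure S A = emeasure M A + emeasure N A" if "A \<in> sets borel" for A
  proof (rule emeasure_measure_of[OF S_def])
    show "countably_additive (sets S) (\<lambda>A. emeasure M A + emeasure N A)"
      unfolding countably_additive_def
    proof safe
      fix A :: "nat \<Rightarrow> 'a set" assume A: "range A \<subseteq> sets S" "disjoint_family A"
      then have "range A \<subseteq> sets M" "range A \<subseteq> sets N" using S_sets M N by auto
      then show "(\<Sum>i. emeasure M (A i) + emeasure N (A i)) = emeasure M (\<Union> (range A)) + emeasure N (\<Union> (range A))"
        using A by (subst suminf_add[symmetric]) (auto simp: suminf_emeasure)
    qed
    show "positive (sets S) (\<lambda>A. emeasure M A + emeasure N A)" by (simp add: positive_def)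
    show "A \<in> sets S" using that S_sets by simp
  qed simp
  have "finite_measure S"
  proof
    show "emeasure S (space S) \<noteq> \<infinity>"
      using S[of UNIV] sets_eq_imp_space_eq[OF S_sets] finite_measure.emeasure_finite[OF M(2)] finite_measure.emeasure_finite[OF N(2)]
      by simp
  qed
  from bounded_borel_AE_limit_of_continuous[OF S_sets this h B] obtain g where
    g: "\<And>n::nat. continuous_on UNIV (g n)" "\<And>n x. \<bar>g n x\<bar> \<le> B" "AE x in S. (\<lambda>n. g n x) \<longlonglongrightarrow> h x" by blast
  have "null_sets S \<subseteq> null_sets M" "null_sets S \<subseteq> null_sets N"
    using S S_sets M N by (auto simp: null_sets_def)
  moreover obtain Z where "{x \<in> space S. \<not> (\<lambda>n. g n x) \<longlonglongrightarrow> h x} \<subseteq> Z" "Z \<in> null_sets S"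
    using g(3) by (auto simp: eventually_ae_filter)
  ultimately have Z: "Z \<in> null_sets M" "Z \<in> null_sets N" "\<And>x. x \<notin> Z \<Longrightarrow> (\<lambda>n. g n x) \<longlonglongrightarrow> h x"
    using sets_eq_imp_space_eq[OF S_sets] by auto
  have "AE x in M. (\<lambda>n. g n x) \<longlonglongrightarrow> h x"
    using AE_not_in[OF Z(1)] by eventually_elim (rule Z(3))
  moreover have "AE x in N. (\<lambda>n. g n x) \<longlonglongrightarrow> h x"
    using AE_not_in[OF Z(2)] by eventually_elim (rule Z(3))
  ultimately show thesis by (rule that[OF g(1,2)])
qed

section \<open>Cadlag paths and time shifts\<close>

text \<open>Joint measurability: \<open>X t\<close> is the limit of \<open>X\<close> at the grid times \<open>(k + 1) / (n + 1) > t\<close>, which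
  take countably many values. Times are cut off at \<open>0\<close> since nothing is known about \<open>X\<close> at negative times.\<close>

lemma right_continuous_process_measurable:
  fixes X :: "real \<Rightarrow> 'b \<Rightarrow> 'c::metric_space"
  assumes meas: "\<And>t. 0 \<le> t \<Longrightarrow> X t \<in> borel_measurable M"
    and cont: "\<And>x t. x \<in> space M \<Longrightarrow> 0 \<le> t \<Longrightarrow> ((\<lambda>s. X s x) \<longlongrightarrow> X t x) (at_right t)"
  shows "(\<lambda>p. X (max 0 (fst p)) (snd p)) \<in> borel_measurable (borel \<Otimes>\<^sub>M M)"
proof (rule borel_measurable_LIMSEQ_metric)
  define k where "k n s = nat \<lfloor>real (Suc n) * max 0 s\<rfloor>" for n and s :: real
  fix n
  have "(\<lambda>p. k n (fst p)) \<in> (borel \<Otimes>\<^sub>M M) \<rightarrow>\<^sub>M count_space UNIV"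
    unfolding k_def by measurable
  then show "(\<lambda>p. X (real (Suc (k n (fst p))) / real (Suc n)) (snd p)) \<in> borel_measurable (borel \<Otimes>\<^sub>M M)"
    by (rule measurable_compose_countable[rotated]) (intro measurable_compose[OF measurable_snd meas], simp)
  fix p :: "real \<times> 'b" assume p: "p \<in> space (borel \<Otimes>\<^sub>M M)"
  define a where "a = max 0 (fst p)"
  have "filterlim (\<lambda>n. real (Suc (k n (fst p))) / real (Suc n)) (at_right a) sequentially"
  proof (rule filterlim_at_withinI)
    have *: "real (Suc n) * a < real (Suc (k n (fst p)))" "real (Suc (k n (fst p))) \<le> real (Suc n) * a + 1" for n
    proof -
      have "real (k n (fst p)) = of_int \<lfloor>real (Suc n) * a\<rfloor>" by (simp add: k_def a_def)
      then show "real (Suc n) * a < real (Suc (k n (fst p)))" "real (Suc (k n (fst p))) \<le> real (Suc n) * a + 1"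
        by linarith+
    qed
    have lower: "a < real (Suc (k n (fst p))) / real (Suc n)" for n
      using *(1)[of n] by (simp add: field_simps)
    have upper: "real (Suc (k n (fst p))) / real (Suc n) \<le> a + inverse (real (Suc n))" for n
    proof -
      have "real (Suc (k n (fst p))) / real (Suc n) \<le> (real (Suc n) * a + 1) / real (Suc n)"
        using *(2)[of n] by (rule divide_right_mono) simp
      also have "\<dots> = a + inverse (real (Suc n))" by (simp add: field_simps)
      finally show ?thesis .
    qed
    show "(\<lambda>n. real (Suc (k n (fst p))) / real (Suc n)) \<longlonglongrightarrow> a"
      by (rule tendsto_sandwich[OF _ _ tendsto_const LIMSEQ_inverse_real_of_nat_add])
        (use lower upper in \<open>auto intro!: always_eventually less_imp_le\<close>)
    show "\<forall>\<^sub>F n in sequentially. real (Suc (k n (fst p))) / real (Suc n) \<in> {a<..} - {a}"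
      using lower by auto
  qed
  moreover have "((\<lambda>s. X s (snd p)) \<longlongrightarrow> X a (snd p)) (at_right a)"
    using p by (intro cont) (auto simp: space_pair_measure a_def)
  ultimately show "(\<lambda>n. X (real (Suc (k n (fst p))) / real (Suc n)) (snd p)) \<longlonglongrightarrow> X (max 0 (fst p)) (snd p)"
    unfolding a_def[symmetric] by (rule filterlim_compose[rotated])
qed

lemma space_path_space: "space path_space = {\<omega> \<in> extensional {0..}. cadlag \<omega>}"
  by (auto simp: path_space_def space_restrict_space space_PiM PiE_def)

lemma measurable_eval[measurable (raw)]: "0 \<le> t \<Longrightarrow> (\<lambda>\<omega>. \<omega> t) \<in> path_space \<rightarrow>\<^sub>M borel"
  unfolding path_space_def by (intro measurable_restrict_space1 measurable_component_singleton) simp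

lemma measurable_eval_pair: "(\<lambda>p. (snd p) (max 0 (fst p) :: real)) \<in> borel \<Otimes>\<^sub>M path_space \<rightarrow>\<^sub>M borel"
  by (rule right_continuous_process_measurable[where X = "\<lambda>t \<omega>. \<omega> t"])
    (auto simp: space_path_space cadlag_def)

lemma cadlag_time_shift:
  assumes "cadlag \<omega>" "0 \<le> s" shows "cadlag (time_shift s \<omega>)"
  unfolding cadlag_def
proof safe
  fix t :: real assume "0 \<le> t"
  have "filterlim (\<lambda>u. s + u) (at_right (s + t)) (at_right t)"
  proof (rule filterlim_at_withinI)
    show "((\<lambda>u. s + u) \<longlongrightarrow> s + t) (at_right t)" by (intro tendsto_intros)
    show "\<forall>\<^sub>F u in at_right t. s + u \<in> {s + t<..} - {s + t}"
      using eventually_at_right_less[of t] by eventually_elim simp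
  qed
  then have "((\<lambda>u. \<omega> (s + u)) \<longlongrightarrow> \<omega> (s + t)) (at_right t)"
    by (rule filterlim_compose[rotated]) (use assms \<open>0 \<le> t\<close> in \<open>simp add: cadlag_def\<close>)
  moreover have "\<forall>\<^sub>F u in at_right t. \<omega> (s + u) = time_shift s \<omega> u"
    using eventually_at_right_less[of t] by eventually_elim (use \<open>0 \<le> t\<close> in \<open>simp add: time_shift_def\<close>)
  ultimately have "(time_shift s \<omega> \<longlongrightarrow> \<omega> (s + t)) (at_right t)"
    using filterlim_cong[OF refl refl, of "\<lambda>u. \<omega> (s + u)" "time_shift s \<omega>"] by blast
  then show "(time_shift s \<omega> \<longlongrightarrow> time_shift s \<omega> t) (at_right t)"
    using \<open>0 \<le> t\<close> by (simp add: time_shift_def)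
next
  fix t :: real assume "0 < t"
  have "filterlim (\<lambda>u. s + u) (at_left (s + t)) (at_left t)"
  proof (rule filterlim_at_withinI)
    show "((\<lambda>u. s + u) \<longlongrightarrow> s + t) (at_left t)" by (intro tendsto_intros)
    show "\<forall>\<^sub>F u in at_left t. s + u \<in> {..<s + t} - {s + t}"
      using eventually_at_left_real[OF \<open>0 < t\<close>] by eventually_elim simp
  qed
  moreover obtain l where "(\<omega> \<longlongrightarrow> l) (at_left (s + t))"
    using assms \<open>0 < t\<close> unfolding cadlag_def by (meson add_nonneg_pos)
  ultimately have "((\<lambda>u. \<omega> (s + u)) \<longlongrightarrow> l) (at_left t)" by (rule filterlim_compose[rotated])
  moreover have "\<forall>\<^sub>F u in at_left t. \<omega> (s + u) = time_shift s \<omega> u"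
    using eventually_at_left_real[OF \<open>0 < t\<close>] by eventually_elim (simp add: time_shift_def)
  ultimately show "\<exists>l. (time_shift s \<omega> \<longlongrightarrow> l) (at_left t)"
    using filterlim_cong[OF refl refl, of "\<lambda>u. \<omega> (s + u)" "time_shift s \<omega>"] by blast
qed

lemma measurable_time_shift[measurable]: "0 \<le> s \<Longrightarrow> time_shift s \<in> path_space \<rightarrow>\<^sub>M path_space"
proof -
  assume s: "0 \<le> s"
  have "time_shift s \<in> path_space \<rightarrow>\<^sub>M (PiM {0..} (\<lambda>_. borel) :: (real \<Rightarrow> 'a) measure)"
    unfolding time_shift_def[abs_def] using s by (intro measurable_restrict measurable_eval) auto
  moreover have "time_shift s \<in> space path_space \<rightarrow> {\<omega>. cadlag \<omega>}"
    using s by (auto simp: space_path_space cadlag_time_shift)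
  ultimately show ?thesis
    by (subst (2) path_space_def) (intro measurable_restrict_space2)
qed

lemma time_shift_space: "0 \<le> s \<Longrightarrow> \<omega> \<in> space path_space \<Longrightarrow> time_shift s \<omega> \<in> space path_space"
  using measurable_space[OF measurable_time_shift] .

lemma time_shift_time_shift: "0 \<le> a \<Longrightarrow> time_shift a (time_shift b \<omega>) = time_shift (a + b) \<omega>"
  by (auto simp: time_shift_def fun_eq_iff restrict_def add_ac)

lemma time_shift_apply: "0 \<le> t \<Longrightarrow> time_shift s \<omega> t = \<omega> (s + t)"
  by (simp add: time_shift_def)

lemma time_shift_0: "\<omega> \<in> space path_space \<Longrightarrow> time_shift 0 \<omega> = \<omega>"
  by (auto simp: time_shift_def space_path_space extensional_def fun_eq_iff)

lemma funpow_time_shift: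
  "\<omega> \<in> space path_space \<Longrightarrow> (time_shift 1 ^^ n) \<omega> = time_shift (real n) \<omega>"
  by (induction n) (auto simp: time_shift_0 time_shift_time_shift)

lemma time_shift_vimage_nat:
  fixes B :: "(real \<Rightarrow> 'a::metric_space) set"
  assumes "time_shift 1 -` B \<inter> space path_space = B"
  shows "{\<omega> \<in> space path_space. time_shift (real n) \<omega> \<in> B} = B"
proof (induction n)
  case 0
  have "{\<omega> \<in> space path_space. time_shift 0 \<omega> \<in> B} = B \<inter> space path_space" by (auto simp: time_shift_0)
  then show ?case using assms by auto
next
  case (Suc n)
  have "time_shift (real (Suc n)) \<omega> = time_shift (real n) (time_shift 1 \<omega>)" for \<omega> :: "real \<Rightarrow> 'a"
    by (subst time_shift_time_shift) (auto simp: add.commute)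
  then have "{\<omega> \<in> space path_space. time_shift (real (Suc n)) \<omega> \<in> B}
     = time_shift 1 -` {\<omega> \<in> space path_space. time_shift (real n) \<omega> \<in> B} \<inter> space path_space"
    using time_shift_space[of 1] by auto
  then show ?case using Suc assms by simp
qed

lemma space_past[simp]: "space (past s) = space path_space"
  unfolding past_def by (subst space_measure_of) auto

lemma past_generator: "sets (past s) = sigma_sets (space path_space)
     {{\<omega> \<in> space path_space. \<omega> u \<in> B} | u B. 0 \<le> u \<and> u \<le> s \<and> B \<in> sets borel}"
  unfolding past_def by (subst sets_measure_of) auto

lemma sets_past_subset: "sets (past s) \<subseteq> sets path_space"
  unfolding past_generator by (rule sets.sigma_sets_subset) auto

lemma sets_past_mono: "s \<le> t \<Longrightarrow> sets (past s) \<subseteq> sets (past t)"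
  unfolding past_generator by (rule sigma_sets_mono') (auto intro: order_trans)

text \<open>The union over the integers is already a generator, and it is stable under intersections because the
  pasts increase. Both facts are needed to extend independence of the past to independence of every event.\<close>

lemma sets_path_space_eq_past:
  "sets (path_space :: (real \<Rightarrow> 'a::metric_space) measure) = sigma_sets (space path_space) (\<Union>n::nat. sets (past (real n)))"
proof
  let ?S = "sigma (space path_space) (\<Union>n::nat. sets (past (real n))) :: (real \<Rightarrow> 'a) measure"
  have sub: "(\<Union>n::nat. sets (past (real n))) \<subseteq> Pow (space (path_space :: (real \<Rightarrow> 'a) measure))"
    using sets.sets_into_space[of _ "past _ :: (real \<Rightarrow> 'a) measure"] by fastforce
  have sets_S: "sets ?S = sigma_sets (space path_space) (\<Union>n::nat. sets (past (real n)))"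
    using sub by (rule sets_measure_of)
  have space_S: "space ?S = space path_space" using sub by (rule space_measure_of)
  show "sigma_sets (space path_space) (\<Union>n::nat. sets (past (real n))) \<subseteq> sets (path_space :: (real \<Rightarrow> 'a) measure)"
    using sets_past_subset by (intro sets.sigma_sets_subset) auto
  have "(\<lambda>\<omega>. \<omega>) \<in> ?S \<rightarrow>\<^sub>M restrict_space (PiM {0..} (\<lambda>_. borel)) {\<omega>. cadlag \<omega>}"
  proof (rule measurable_restrict_space2)
    show "(\<lambda>\<omega>. \<omega>) \<in> space ?S \<rightarrow> {\<omega>. cadlag \<omega>}" unfolding space_S by (auto simp: space_path_space)
    show "(\<lambda>\<omega>. \<omega>) \<in> ?S \<rightarrow>\<^sub>M PiM {0..} (\<lambda>_. borel)"
    proof (rule measurable_PiM_single)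
      show "(\<lambda>\<omega>. \<omega>) \<in> space ?S \<rightarrow> (\<Pi>\<^sub>E i\<in>{0..}. space borel)"
        unfolding space_S by (auto simp: space_path_space PiE_def)
      fix A :: "'a set" and i :: real assume i: "i \<in> {0..}" and A: "A \<in> sets borel"
      obtain n :: nat where "i \<le> real n" using real_arch_simple by blast
      then have "{\<omega> \<in> space path_space. \<omega> i \<in> A} \<in> sets (past (real n))"
        unfolding past_generator using i A by (intro sigma_sets.Basic) auto
      then show "{\<omega> \<in> space ?S. \<omega> i \<in> A} \<in> sets ?S"
        unfolding sets_S space_S by (intro sigma_sets.Basic) auto
    qed
  qed
  then have "(\<lambda>\<omega>. \<omega>) \<in> ?S \<rightarrow>\<^sub>M path_space" by (simp add: path_space_def)
  then show "sets (path_space :: (real \<Rightarrow> 'a) measure) \<subseteq> sigma_sets (space path_space) (\<Union>n::nat. sets (past (real n)))"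
    using measurable_sets[of "\<lambda>\<omega>. \<omega>" ?S path_space] sets.sets_into_space[of _ "path_space :: (real \<Rightarrow> 'a) measure"]
    unfolding sets_S space_S by (force simp: Int_absorb2)
qed

section \<open>Markov processes and their transition operators\<close>

locale cadlag_markov_process =
  fixes P :: "'a::metric_space \<Rightarrow> (real \<Rightarrow> 'a) measure"
  assumes markov: "markov_process P"
begin

lemma kernel[measurable]: "P \<in> borel \<rightarrow>\<^sub>M prob_algebra path_space"
  using markov by (simp add: markov_process_def)

lemma kernel_subprob[measurable]: "P \<in> borel \<rightarrow>\<^sub>M subprob_algebra path_space"
  using kernel by (rule measurable_prob_algebraD)

lemma prob_space_P: "prob_space (P \<eta>)"
  using measurable_space[OF kernel, of \<eta>] by (simp add: space_prob_algebra)

lemma sets_P[measurable_cong, simp]: "sets (P \<eta>) = sets path_space"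
  using measurable_space[OF kernel, of \<eta>] by (simp add: space_prob_algebra)

lemma space_P[simp]: "space (P \<eta>) = space path_space"
  by (rule sets_eq_imp_space_eq) simp

lemma measure_P_space[simp]: "measure (P \<eta>) (space path_space) = 1"
  using prob_space.prob_space[OF prob_space_P, of \<eta>] by simp

lemma start: "AE \<omega> in P \<eta>. \<omega> 0 = \<eta>"
  using markov by (simp add: markov_process_def)

lemma measurable_measure_P: "B \<in> sets path_space \<Longrightarrow> (\<lambda>\<eta>. measure (P \<eta>) B) \<in> borel_measurable borel"
  using measurable_compose[OF kernel_subprob measurable_measure_subprob_algebra] .

text \<open>The defining conditional expectation, integrated over an event of the past.\<close>

lemma markov_property:
  assumes s: "0 \<le> s" and A: "A \<in> sets (past s)" and B: "B \<in> sets path_space"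
  shows "measure (P \<eta>) (A \<inter> {\<omega> \<in> space path_space. time_shift s \<omega> \<in> B}) = (\<integral>\<omega>. indicator A \<omega> * measure (P (\<omega> s)) B \<partial>P \<eta>)"
proof -
  interpret prob_space "P \<eta>" by (rule prob_space_P)
  interpret finite_measure_subalgebra "P \<eta>" "past s"
    by standard (simp add: subalgebra_def sets_past_subset)
  let ?E = "{\<omega> \<in> space path_space. time_shift s \<omega> \<in> B}"
  have [measurable]: "time_shift s \<in> path_space \<rightarrow>\<^sub>M path_space" using s by (rule measurable_time_shift)
  have E[measurable]: "?E \<in> sets path_space" using B by measurable
  have A'[measurable]: "A \<in> sets path_space" using A sets_past_subset by auto
  have "measure (P \<eta>) (A \<inter> ?E) = (\<integral>\<omega>. indicator (A \<inter> ?E) \<omega> \<partial>P \<eta>)"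
    using A' E sets.sets_into_space[OF A'] by (simp add: Int_absorb2 Int_assoc)
  also have "\<dots> = (\<integral>\<omega>\<in>A. indicator ?E \<omega> \<partial>P \<eta>)"
    by (simp add: set_lebesgue_integral_def indicator_inter_arith)
  also have "\<dots> = (\<integral>\<omega>\<in>A. real_cond_exp (P \<eta>) (past s) (indicator ?E) \<omega> \<partial>P \<eta>)"
    by (rule real_cond_exp_intA[OF _ A]) (auto intro!: integrable_real_indicator simp: emeasure_eq_measure)
  also have "\<dots> = (\<integral>\<omega>. indicator A \<omega> * measure (P (\<omega> s)) B \<partial>P \<eta>)"
    unfolding set_lebesgue_integral_def
  proof (rule integral_cong_AE)
    have "AE \<omega> in P \<eta>. real_cond_exp (P \<eta>) (past s) (indicator ?E) \<omega> = measure (P (\<omega> s)) B"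
      using markov s B by (simp add: markov_process_def)
    then show "AE \<omega> in P \<eta>. indicator A \<omega> *\<^sub>R real_cond_exp (P \<eta>) (past s) (indicator ?E) \<omega>
        = indicator A \<omega> * measure (P (\<omega> s)) B"
      by eventually_elim simp
    have "(\<lambda>\<omega>. measure (P (\<omega> s)) B) \<in> borel_measurable path_space"
      by (rule measurable_compose[OF measurable_eval[OF s] measurable_measure_P[OF B]])
    then show "(\<lambda>\<omega>. indicator A \<omega> * measure (P (\<omega> s)) B) \<in> borel_measurable (P \<eta>)"
      by measurable
    show "(\<lambda>\<omega>. indicator A \<omega> *\<^sub>R real_cond_exp (P \<eta>) (past s) (indicator ?E) \<omega>) \<in> borel_measurable (P \<eta>)"
      by (intro borel_measurable_scaleR borel_measurable_indicator) auto
  qed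
  finally show ?thesis .
qed

text \<open>The Markov property as an identity of laws: the shifted path is a fresh path started at the position
  at time \<open>s\<close>. The semigroup law and stationarity both follow by integrating against it.\<close>

lemma distr_time_shift:
  assumes s: "0 \<le> s"
  shows "distr (P \<eta>) path_space (time_shift s) = distr (P \<eta>) borel (\<lambda>\<omega>. \<omega> s) \<bind> P"
proof (rule measure_eqI)
  interpret prob_space "P \<eta>" by (rule prob_space_P)
  have [measurable]: "time_shift s \<in> path_space \<rightarrow>\<^sub>M path_space" using s by (rule measurable_time_shift)
  have ev[measurable]: "(\<lambda>\<omega>. \<omega> s) \<in> path_space \<rightarrow>\<^sub>M borel" using s by (rule measurable_eval)
  show "sets (distr (P \<eta>) path_space (time_shift s)) = sets (distr (P \<eta>) borel (\<lambda>\<omega>. \<omega> s) \<bind> P)"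
    by (subst sets_bind[where N = path_space]) auto
  fix B assume "B \<in> sets (distr (P \<eta>) path_space (time_shift s))"
  then have B: "B \<in> sets path_space" by simp
  have meas: "(\<lambda>\<omega>. measure (P (\<omega> s)) B) \<in> borel_measurable (P \<eta>)"
    using measurable_compose[OF ev measurable_measure_P[OF B]] by measurable
  have "emeasure (distr (P \<eta>) path_space (time_shift s)) B = ennreal (measure (P \<eta>) (space path_space \<inter> {\<omega> \<in> space path_space. time_shift s \<omega> \<in> B}))"
    using B by (subst emeasure_distr) (auto simp: emeasure_eq_measure intro!: arg_cong[where f = prob])
  also have "\<dots> = ennreal (\<integral>\<omega>. measure (P (\<omega> s)) B \<partial>P \<eta>)"
    using sets.top[of "past s :: (real \<Rightarrow> 'a) measure"]
    by (subst markov_property[OF s _ B]) (auto intro!: arg_cong[where f = ennreal] Bochner_Integration.integral_cong)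
  also have "\<dots> = (\<integral>\<^sup>+\<omega>. ennreal (measure (P (\<omega> s)) B) \<partial>P \<eta>)"
    by (rule nn_integral_eq_integral[symmetric])
      (auto intro!: integrable_const_bound[of _ 1] meas simp: prob_space.prob_le_1[OF prob_space_P])
  also have "\<dots> = (\<integral>\<^sup>+\<omega>. emeasure (P (\<omega> s)) B \<partial>P \<eta>)"
    by (simp add: finite_measure.emeasure_eq_measure[OF prob_space.finite_measure[OF prob_space_P]])
  also have "\<dots> = emeasure (distr (P \<eta>) borel (\<lambda>\<omega>. \<omega> s) \<bind> P) B"
    using B by (subst emeasure_bind[where N = path_space]) (auto simp: nn_integral_distr)
  finally show "emeasure (distr (P \<eta>) path_space (time_shift s)) B = emeasure (distr (P \<eta>) borel (\<lambda>\<omega>. \<omega> s) \<bind> P) B" .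
qed

lemma measurable_transition[measurable]:
  assumes s: "0 \<le> s" and [measurable]: "g \<in> borel_measurable borel"
  shows "transition P s g \<in> borel_measurable borel"
proof -
  have [measurable]: "(\<lambda>\<omega>. \<omega> s) \<in> path_space \<rightarrow>\<^sub>M borel" using s by (rule measurable_eval)
  have "(\<lambda>\<omega>. g (\<omega> s)) \<in> borel_measurable path_space" by measurable
  from measurable_compose[OF kernel_subprob integral_measurable_subprob_algebra[OF this]]
  show ?thesis by (simp add: transition_def[abs_def])
qed

lemma integrable_eval:
  fixes g :: "'a \<Rightarrow> real"
  assumes s: "0 \<le> s" and [measurable]: "g \<in> borel_measurable borel" and B: "\<And>x. \<bar>g x\<bar> \<le> B"
  shows "integrable (P \<eta>) (\<lambda>\<omega>. g (\<omega> s))"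
proof -
  interpret prob_space "P \<eta>" by (rule prob_space_P)
  have [measurable]: "(\<lambda>\<omega>. \<omega> s) \<in> path_space \<rightarrow>\<^sub>M borel" using s by (rule measurable_eval)
  show ?thesis using B by (intro integrable_const_bound[of _ B]) auto
qed

lemma transition_bound:
  assumes s: "0 \<le> s" and g: "g \<in> borel_measurable borel" and B: "\<And>x. \<bar>g x\<bar> \<le> B"
  shows "\<bar>transition P s g \<eta>\<bar> \<le> B"
proof -
  interpret prob_space "P \<eta>" by (rule prob_space_P)
  have "\<bar>transition P s g \<eta>\<bar> \<le> (\<integral>\<omega>. \<bar>g (\<omega> s)\<bar> \<partial>P \<eta>)" unfolding transition_def by (rule integral_abs_bound)
  also have "\<dots> \<le> (\<integral>\<omega>. B \<partial>P \<eta>)" using B integrable_eval[OF s g B] by (intro integral_mono) auto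
  finally show ?thesis by (simp add: prob_space)
qed

lemma transition_0:
  assumes [measurable]: "g \<in> borel_measurable borel" shows "transition P 0 g \<eta> = g \<eta>"
proof -
  interpret prob_space "P \<eta>" by (rule prob_space_P)
  have "transition P 0 g \<eta> = (\<integral>\<omega>. g \<eta> \<partial>P \<eta>)" unfolding transition_def
    by (rule integral_cong_AE) (use start[of \<eta>] in \<open>auto elim!: eventually_mono\<close>)
  then show ?thesis by (simp add: prob_space)
qed

lemma transition_transition:
  assumes s: "0 \<le> s" and t: "0 \<le> t" and g[measurable]: "g \<in> borel_measurable borel" and B: "\<And>x. \<bar>g x\<bar> \<le> B"
  shows "transition P s (transition P t g) \<eta> = transition P (s + t) g \<eta>"
proof -
  interpret prob_space "P \<eta>" by (rule prob_space_P)
  have [measurable]: "time_shift s \<in> path_space \<rightarrow>\<^sub>M path_space" using s by (rule measurable_time_shift)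
  have ev[measurable]: "(\<lambda>\<omega>. \<omega> s) \<in> path_space \<rightarrow>\<^sub>M borel" "(\<lambda>\<omega>. \<omega> t) \<in> path_space \<rightarrow>\<^sub>M borel"
    using s t by (auto intro: measurable_eval)
  have "transition P (s + t) g \<eta> = (\<integral>\<omega>. g (\<omega> t) \<partial>distr (P \<eta>) path_space (time_shift s))"
    unfolding transition_def by (subst integral_distr) (auto simp: time_shift_apply t)
  also have "\<dots> = (\<integral>x. \<integral>\<omega>. g (\<omega> t) \<partial>P x \<partial>distr (P \<eta>) borel (\<lambda>\<omega>. \<omega> s))"
    unfolding distr_time_shift[OF s]
  proof (rule integral_bind[where K = path_space and B = B and B' = 1])
    show "finite_measure (distr (P \<eta>) borel (\<lambda>\<omega>. \<omega> s))" by (intro finite_measure_distr) auto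
  qed (auto simp: B prob_space.emeasure_space_1[OF prob_space_P, simplified])
  also have "\<dots> = transition P s (transition P t g) \<eta>"
  proof (subst integral_distr)
    show "(\<lambda>x. \<integral>\<omega>. g (\<omega> t) \<partial>P x) \<in> borel_measurable borel"
      using measurable_transition[OF t g] by (simp add: transition_def[abs_def])
  qed (simp_all add: transition_def)
  finally show ?thesis ..
qed

text \<open>Continuity of \<open>g\<close> passes the right-continuity of the paths on to \<open>s \<mapsto> g (\<omega> s)\<close>.\<close>

lemma transition_right_continuous:
  fixes g :: "'a \<Rightarrow> real"
  assumes t: "0 \<le> t" and g: "continuous_on UNIV g" and B: "\<And>x. \<bar>g x\<bar> \<le> B"
  shows "((\<lambda>s. transition P s g \<eta>) \<longlongrightarrow> transition P t g \<eta>) (at_right t)"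
  unfolding transition_def
proof -
  interpret prob_space "P \<eta>" by (rule prob_space_P)
  have [measurable]: "g \<in> borel_measurable borel" using g by (rule borel_measurable_continuous_onI)
  show "((\<lambda>s. \<integral>\<omega>. g (\<omega> s) \<partial>P \<eta>) \<longlongrightarrow> (\<integral>\<omega>. g (\<omega> t) \<partial>P \<eta>)) (at_right t)"
  proof (rule bounded_convergence_at_right[where B = B])
    fix \<omega> assume "\<omega> \<in> space (P \<eta>)"
    then have "(\<omega> \<longlongrightarrow> \<omega> t) (at_right t)" using t by (simp add: space_path_space cadlag_def)
    then show "((\<lambda>s. g (\<omega> s)) \<longlongrightarrow> g (\<omega> t)) (at_right t)"
      using g by (auto intro: isCont_tendsto_compose simp: continuous_on_eq_continuous_at)
  qed (use t B in \<open>auto intro!: measurable_compose[OF measurable_eval] simp: measurable_cong_sets[OF sets_P refl]\<close>)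
qed

lemma transition_jointly_measurable:
  fixes g :: "'a \<Rightarrow> real"
  assumes g: "continuous_on UNIV g" and B: "\<And>x. \<bar>g x\<bar> \<le> B"
  shows "(\<lambda>p. transition P (max 0 (fst p)) g (snd p)) \<in> borel_measurable (borel \<Otimes>\<^sub>M borel)"
  by (rule right_continuous_process_measurable)
    (auto intro: measurable_transition borel_measurable_continuous_onI g transition_right_continuous[OF _ g B])

lemma
  fixes g :: "'a \<Rightarrow> real"
  assumes \<nu>: "sets \<nu> = sets borel" "prob_space \<nu>" and s: "0 \<le> s"
  shows prob_space_marginal: "prob_space (distr (\<nu> \<bind> P) borel (\<lambda>\<omega>. \<omega> s))"
    and integral_marginal: "g \<in> borel_measurable borel \<Longrightarrow> (\<And>x. \<bar>g x\<bar> \<le> B) \<Longrightarrow>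
      (\<integral>x. g x \<partial>distr (\<nu> \<bind> P) borel (\<lambda>\<omega>. \<omega> s)) = (\<integral>x. transition P s g x \<partial>\<nu>)"
proof -
  interpret prob_space \<nu> by fact
  have [measurable]: "(\<lambda>\<omega>. \<omega> s) \<in> path_space \<rightarrow>\<^sub>M borel" using s by (rule measurable_eval)
  have K: "P \<in> \<nu> \<rightarrow>\<^sub>M subprob_algebra path_space"
    using kernel_subprob measurable_cong_sets[OF \<nu>(1) refl] by blast
  have sets: "sets (\<nu> \<bind> P) = sets path_space"
    by (rule sets_bind[OF sets_kernel[OF K] not_empty])
  have "prob_space (\<nu> \<bind> P)"
    by (rule prob_space_bind[OF _ K]) (simp add: prob_space_P)
  have ev: "(\<lambda>\<omega>. \<omega> s) \<in> (\<nu> \<bind> P) \<rightarrow>\<^sub>M borel"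
    using measurable_eval[OF s] measurable_cong_sets[OF sets refl] by blast
  show "prob_space (distr (\<nu> \<bind> P) borel (\<lambda>\<omega>. \<omega> s))"
    by (rule prob_space.prob_space_distr[OF \<open>prob_space (\<nu> \<bind> P)\<close> ev])
  assume g: "g \<in> borel_measurable borel" and B: "\<And>x. \<bar>g x\<bar> \<le> B"
  have "(\<integral>x. g x \<partial>distr (\<nu> \<bind> P) borel (\<lambda>\<omega>. \<omega> s)) = (\<integral>\<omega>. g (\<omega> s) \<partial>(\<nu> \<bind> P))"
    by (rule integral_distr[OF ev g])
  also have "\<dots> = (\<integral>x. \<integral>\<omega>. g (\<omega> s) \<partial>P x \<partial>\<nu>)"
  proof (rule integral_bind[where K = path_space and B = B and B' = 1, OF _ B K finite_measure_axioms])
    show "(\<lambda>\<omega>. g (\<omega> s)) \<in> borel_measurable path_space"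
      using g by measurable
  qed (simp add: prob_space.emeasure_space_1[OF prob_space_P, simplified])
  finally show "(\<integral>x. g x \<partial>distr (\<nu> \<bind> P) borel (\<lambda>\<omega>. \<omega> s)) = (\<integral>x. transition P s g x \<partial>\<nu>)"
    by (simp add: transition_def)
qed

lemma integral_transition_invariant:
  fixes g :: "'a \<Rightarrow> real"
  assumes \<nu>: "invariant_distribution P \<nu>" and s: "0 \<le> s"
    and g: "g \<in> borel_measurable borel" "\<And>x. \<bar>g x\<bar> \<le> B"
  shows "(\<integral>x. transition P s g x \<partial>\<nu>) = (\<integral>x. g x \<partial>\<nu>)"
  using integral_marginal[OF _ _ s g, of \<nu>] \<nu> s by (simp add: invariant_distribution_def)

end

section \<open>Stationary processes and shift-invariant events\<close>

locale stationary_markov_process = cadlag_markov_process P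
  for P :: "'a::metric_space \<Rightarrow> (real \<Rightarrow> 'a) measure" +
  fixes \<nu> :: "'a measure"
  assumes invariant: "invariant_distribution P \<nu>"
begin

definition "Q = \<nu> \<bind> P"

lemma sets_\<nu>[measurable_cong, simp]: "sets \<nu> = sets borel"
  using invariant by (simp add: invariant_distribution_def)

lemma space_\<nu>[simp]: "space \<nu> = UNIV"
  using sets_eq_imp_space_eq[OF sets_\<nu>] by simp

lemma prob_space_\<nu>: "prob_space \<nu>"
  using invariant by (simp add: invariant_distribution_def)

lemma kernel_\<nu>[measurable]: "P \<in> \<nu> \<rightarrow>\<^sub>M subprob_algebra path_space"
  using kernel_subprob measurable_cong_sets[OF sets_\<nu> refl] by blast

lemma sets_Q[measurable_cong, simp]: "sets Q = sets path_space"
  unfolding Q_def by (rule sets_bind[where N = path_space]) auto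

lemma space_Q[simp]: "space Q = space path_space"
  by (rule sets_eq_imp_space_eq) simp

lemma prob_space_Q: "prob_space Q"
  unfolding Q_def
  by (rule prob_space.prob_space_bind[OF prob_space_\<nu> _ kernel_\<nu>]) (simp add: prob_space_P)

lemma distr_Q_eval: "0 \<le> t \<Longrightarrow> distr Q borel (\<lambda>\<omega>. \<omega> t) = \<nu>"
  using invariant by (simp add: invariant_distribution_def Q_def)

lemma distr_Q_time_shift:
  assumes s: "0 \<le> s" shows "distr Q path_space (time_shift s) = Q"
proof -
  have [measurable]: "time_shift s \<in> path_space \<rightarrow>\<^sub>M path_space" using s by (rule measurable_time_shift)
  have ev[measurable]: "(\<lambda>\<omega>. \<omega> s) \<in> path_space \<rightarrow>\<^sub>M borel" using s by (rule measurable_eval)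
  have "distr Q path_space (time_shift s) = \<nu> \<bind> (\<lambda>\<eta>. distr (P \<eta>) path_space (time_shift s))"
    unfolding Q_def by (rule distr_bind[OF kernel_\<nu>]) auto
  also have "\<dots> = \<nu> \<bind> (\<lambda>\<eta>. distr (P \<eta>) borel (\<lambda>\<omega>. \<omega> s) \<bind> P)"
    by (simp add: distr_time_shift s)
  also have "\<dots> = (\<nu> \<bind> (\<lambda>\<eta>. distr (P \<eta>) borel (\<lambda>\<omega>. \<omega> s))) \<bind> P"
    by (rule bind_assoc[symmetric, where N = borel and R = path_space])
       (auto intro!: measurable_compose[OF kernel_\<nu> measurable_distr])
  also have "\<nu> \<bind> (\<lambda>\<eta>. distr (P \<eta>) borel (\<lambda>\<omega>. \<omega> s)) = distr Q borel (\<lambda>\<omega>. \<omega> s)"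
    unfolding Q_def by (rule distr_bind[OF kernel_\<nu>, symmetric]) auto
  also have "\<dots> = \<nu>" using s by (rule distr_Q_eval)
  finally show ?thesis by (simp add: Q_def)
qed

lemma measure_Q: "B \<in> sets path_space \<Longrightarrow> measure Q B = (\<integral>x. measure (P x) B \<partial>\<nu>)"
  unfolding Q_def
  by (rule subprob_space.measure_bind[OF prob_space_imp_subprob_space[OF prob_space_\<nu>] kernel_\<nu>])

text \<open>Invariance turns the Markov property at time \<open>n\<close>, applied to \<open>B\<close> itself, into harmonicity of the
  probability of \<open>B\<close> as a function of the starting point.\<close>

lemma shift_invariant_harmonic:
  assumes B: "B \<in> sets path_space" and inv: "time_shift 1 -` B \<inter> space path_space = B"
  shows "transition P (real n) (\<lambda>x. measure (P x) B) \<eta> = measure (P \<eta>) B"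
proof -
  have "measure (P \<eta>) (space path_space \<inter> {\<omega> \<in> space path_space. time_shift (real n) \<omega> \<in> B})
     = (\<integral>\<omega>. indicator (space path_space) \<omega> * measure (P (\<omega> (real n))) B \<partial>P \<eta>)"
    by (rule markov_property[OF of_nat_0_le_iff _ B]) (metis sets.top space_past)
  also have "\<dots> = transition P (real n) (\<lambda>x. measure (P x) B) \<eta>"
    unfolding transition_def by (rule Bochner_Integration.integral_cong) auto
  finally show ?thesis
    unfolding time_shift_vimage_nat[OF inv] using sets.sets_into_space[OF B] by (simp add: Int_absorb1)
qed

text \<open>By invariance and the Markov property, the conditional probability of \<open>B\<close> given the past up to time
  \<open>n\<close> is the probability of \<open>B\<close> for a path started at the position at time \<open>n\<close>, hence the constant \<open>c\<close>.
  So \<open>B\<close> is independent of every past, therefore of every event, therefore of itself.\<close>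

lemma shift_invariant_trivial:
  assumes B: "B \<in> sets path_space" and inv: "time_shift 1 -` B \<inter> space path_space = B"
    and const: "AE x in \<nu>. measure (P x) B = c"
  shows "measure Q B = 0 \<or> measure Q B = 1"
proof -
  interpret \<nu>: prob_space \<nu> by (rule prob_space_\<nu>)
  interpret Q: prob_space Q by (rule prob_space_Q)
  note [measurable] = measurable_measure_P[OF B]
  have QB: "measure Q B = c"
  proof -
    have "measure Q B = (\<integral>x. c \<partial>\<nu>)" unfolding measure_Q[OF B] by (rule integral_cong_AE) (use const in auto)
    then show ?thesis using \<nu>.prob_space by simp
  qed
  have past: "measure Q (A \<inter> B) = measure Q A * c" if A: "A \<in> sets (past (real n))" for A n
  proof -
    have A'[measurable]: "A \<in> sets path_space" using A sets_past_subset by auto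
    have ev[measurable]: "(\<lambda>\<omega>. \<omega> (real n)) \<in> path_space \<rightarrow>\<^sub>M borel" by (rule measurable_eval) simp
    have meas: "(\<lambda>\<omega>. indicator A \<omega> * measure (P (\<omega> (real n))) B) \<in> borel_measurable path_space"
      by measurable
    have "measure Q (A \<inter> B) = (\<integral>x. measure (P x) (A \<inter> B) \<partial>\<nu>)"
      using A' B by (intro measure_Q) auto
    also have "\<dots> = (\<integral>x. \<integral>\<omega>. indicator A \<omega> * measure (P (\<omega> (real n))) B \<partial>P x \<partial>\<nu>)"
      using markov_property[OF _ A B] time_shift_vimage_nat[OF inv] by simp
    also have "\<dots> = (\<integral>\<omega>. indicator A \<omega> * measure (P (\<omega> (real n))) B \<partial>Q)"
      unfolding Q_def
      by (rule integral_bind[where K = path_space and B = 1 and B' = 1, symmetric])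
        (use meas in \<open>auto simp: prob_space.emeasure_space_1[OF prob_space_P, simplified] \<nu>.finite_measure_axioms
            prob_space.prob_le_1[OF prob_space_P] split: split_indicator\<close>)
    also have "\<dots> = (\<integral>\<omega>. indicator A \<omega> * c \<partial>Q)"
    proof (rule integral_cong_AE)
      have "AE x in distr Q borel (\<lambda>\<omega>. \<omega> (real n)). measure (P x) B = c"
        using const unfolding distr_Q_eval[OF of_nat_0_le_iff] .
      then have "AE \<omega> in Q. measure (P (\<omega> (real n))) B = c" by (subst (asm) AE_distr_iff) auto
      then show "AE \<omega> in Q. indicator A \<omega> * measure (P (\<omega> (real n))) B = indicator A \<omega> * c"
        by eventually_elim simp
    qed (use meas in auto)
    also have "\<dots> = measure Q A * c" by simp
    finally show ?thesis .
  qed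
  have "measure Q (A \<inter> B) = measure Q A * c" if "A \<in> sets path_space" for A
  proof -
    let ?G = "\<Union>n::nat. sets (past (real n)) :: (real \<Rightarrow> 'a) set set"
    have "Int_stable ?G"
    proof (rule Int_stableI)
      fix a b assume "a \<in> ?G" "b \<in> ?G"
      then obtain m n where "a \<in> sets (past (real m))" "b \<in> sets (past (real n))" by auto
      then have "a \<in> sets (past (real (max m n)))" "b \<in> sets (past (real (max m n)))"
        using sets_past_mono[of "real m" "real (max m n)"] sets_past_mono[of "real n" "real (max m n)"] by auto
      then have "a \<inter> b \<in> sets (past (real (max m n)))" by (rule sets.Int)
      then show "a \<inter> b \<in> ?G" by blast
    qed
    moreover have "?G \<subseteq> Pow (space path_space)"
      using sets_past_subset sets.sets_into_space by blast
    moreover have "A \<in> sigma_sets (space path_space) ?G" using that unfolding sets_path_space_eq_past .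
    ultimately show ?thesis
    proof (induction rule: sigma_sets_induct_disjoint)
      case (basic A) then show ?case using past by auto
    next
      case empty then show ?case by simp
    next
      case (compl A)
      then have A: "A \<in> sets path_space" unfolding sets_path_space_eq_past by simp
      have "measure Q ((space path_space - A) \<inter> B) = measure Q (B - A \<inter> B)"
        using sets.sets_into_space[OF B] by (intro arg_cong[where f = "measure Q"]) auto
      also have "\<dots> = c - measure Q A * c"
        using A B by (subst Q.finite_measure_Diff) (auto simp: compl QB)
      also have "\<dots> = measure Q (space path_space - A) * c"
        using Q.prob_compl[of A] A by (simp add: left_diff_distrib)
      finally show ?case .
    next
      case (union A)
      then have A: "range A \<subseteq> sets path_space" unfolding sets_path_space_eq_past by simp
      have "(\<lambda>i. measure Q (A i \<inter> B)) sums measure Q (\<Union>i. A i \<inter> B)"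
        using A B union(1) by (intro Q.finite_measure_UNION) (auto simp: disjoint_family_on_def)
      moreover have "(\<lambda>i. measure Q (A i) * c) sums (measure Q (\<Union>i. A i) * c)"
        using A union(1) by (intro sums_mult2 Q.finite_measure_UNION) auto
      ultimately show ?case using union(3) by (auto dest: sums_unique2)
    qed
  qed
  from this[OF B] have "c = c * c" by (simp add: QB)
  then show ?thesis by (simp add: QB)
qed

end

section \<open>Square-integrable functions\<close>

lemma L2_norm_nonneg[simp]: "0 \<le> L2_norm M f"
  by (simp add: L2_norm_def)

lemma L2_norm_sq: "(L2_norm M f)\<^sup>2 = (\<integral>x. (f x)\<^sup>2 \<partial>M)"
  by (simp add: L2_norm_def)

lemma L2_norm_cong_AE:
  assumes "f \<in> borel_measurable M" "g \<in> borel_measurable M" "AE x in M. f x = g x"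
  shows "L2_norm M f = L2_norm M g"
proof -
  have "(\<integral>x. (f x)\<^sup>2 \<partial>M) = (\<integral>x. (g x)\<^sup>2 \<partial>M)"
    using assms by (intro integral_cong_AE) (auto elim!: eventually_mono)
  then show ?thesis by (simp add: L2_norm_def)
qed

lemma L2_measurable: "f \<in> L2 M \<Longrightarrow> f \<in> borel_measurable M"
  by (simp add: L2_def)

lemma L2_square_integrable: "f \<in> L2 M \<Longrightarrow> integrable M (\<lambda>x. (f x)\<^sup>2)"
  by (simp add: L2_def)

lemma L2_mult_integrable:
  assumes "f \<in> L2 M" "g \<in> L2 M" shows "integrable M (\<lambda>x. f x * g x)"
proof (rule Bochner_Integration.integrable_bound)
  show "integrable M (\<lambda>x. (f x)\<^sup>2 + (g x)\<^sup>2)" using assms by (simp add: L2_square_integrable)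
  have "\<bar>a * b\<bar> \<le> a\<^sup>2 + b\<^sup>2" for a b :: real
    using sum_squares_bound[of "\<bar>a\<bar>" "\<bar>b\<bar>", unfolded power2_abs]
      mult_nonneg_nonneg[OF abs_ge_zero abs_ge_zero, of a b] unfolding abs_mult by linarith
  then show "AE x in M. norm (f x * g x) \<le> norm ((f x)\<^sup>2 + (g x)\<^sup>2)" by simp
  show "(\<lambda>x. f x * g x) \<in> borel_measurable M" by (intro borel_measurable_times L2_measurable assms)
qed

lemma L2_cmult: "f \<in> L2 M \<Longrightarrow> (\<lambda>x. c * f x) \<in> L2 M"
  by (auto simp: L2_def power_mult_distrib)

lemma L2_add:
  assumes "f \<in> L2 M" "g \<in> L2 M" shows "(\<lambda>x. f x + g x) \<in> L2 M"
  using assms L2_mult_integrable[OF assms] by (auto simp: L2_def power2_sum mult.assoc)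

lemma L2_diff:
  assumes "f \<in> L2 M" "g \<in> L2 M" shows "(\<lambda>x. f x - g x) \<in> L2 M"
  using L2_add[OF assms(1) L2_cmult[OF assms(2), of "-1"]] by simp

lemma L2_norm_cmult: "L2_norm M (\<lambda>x. c * f x) = \<bar>c\<bar> * L2_norm M f"
  by (simp add: L2_norm_def power_mult_distrib real_sqrt_mult)

lemma L2_norm_eq_0_AE:
  assumes "f \<in> L2 M" "L2_norm M f = 0" shows "AE x in M. f x = 0"
proof -
  have "(\<integral>x. (f x)\<^sup>2 \<partial>M) = 0" using assms(2) by (simp add: L2_norm_def)
  then show ?thesis
    using integral_nonneg_eq_0_iff_AE[OF L2_square_integrable[OF assms(1)]] by simp
qed

context prob_space
begin

lemma L2_bounded:
  fixes f :: "'a \<Rightarrow> real"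
  assumes "f \<in> borel_measurable M" "\<And>x. \<bar>f x\<bar> \<le> B" shows "f \<in> L2 M"
proof -
  have "integrable M (\<lambda>x. (f x)\<^sup>2)"
    using assms abs_le_square_iff[of "f _" B] abs_ge_zero
    by (intro integrable_const_bound[of _ "B\<^sup>2"]) (auto intro!: AE_I2 power2_le_imp_le simp: abs_le_square_iff[symmetric] order.trans[OF assms(2) abs_ge_self])
  then show ?thesis using assms by (simp add: L2_def)
qed

lemma L2_integrable:
  assumes "f \<in> L2 M" shows "integrable M f"
  using L2_mult_integrable[OF assms L2_bounded[of "\<lambda>_. 1" 1]] by simp

lemma abs_integral_le_L2_norm:
  assumes f: "f \<in> L2 M" shows "\<bar>\<integral>x. f x \<partial>M\<bar> \<le> L2_norm M f"
proof -
  have "0 \<le> variance f" by simp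
  then have "(\<integral>x. f x \<partial>M)\<^sup>2 \<le> (\<integral>x. (f x)\<^sup>2 \<partial>M)"
    using variance_eq[OF L2_integrable[OF f] L2_square_integrable[OF f]] by simp
  then show ?thesis unfolding L2_norm_def by (metis real_sqrt_abs real_sqrt_le_mono)
qed

lemma integral_abs_le_L2_norm:
  assumes f: "f \<in> L2 M" shows "(\<integral>x. \<bar>f x\<bar> \<partial>M) \<le> L2_norm M f"
proof -
  have "(\<lambda>x. \<bar>f x\<bar>) \<in> L2 M" using f by (auto simp: L2_def)
  from abs_integral_le_L2_norm[OF this] show ?thesis by (simp add: L2_norm_def)
qed

text \<open>Differentiation under the integral sign from the right; the Lipschitz bound dominates the difference
  quotients.\<close>

lemma right_derivative_integral:
  fixes G :: "real \<Rightarrow> 'a \<Rightarrow> real"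
  assumes meas: "\<And>r. t \<le> r \<Longrightarrow> G r \<in> borel_measurable M" "G' \<in> borel_measurable M"
    and B: "\<And>r x. t \<le> r \<Longrightarrow> \<bar>G r x\<bar> \<le> B r"
    and lip: "\<And>r x. t \<le> r \<Longrightarrow> \<bar>G r x - G t x\<bar> \<le> K * (r - t)"
    and deriv: "\<And>x. ((\<lambda>r. G r x) has_real_derivative G' x) (at_right t)"
  shows "((\<lambda>r. \<integral>x. G r x \<partial>M) has_real_derivative (\<integral>x. G' x \<partial>M)) (at_right t)"
proof -
  have int: "integrable M (G r)" if "t \<le> r" for r
    using meas(1)[OF that] B[OF that] by (intro integrable_const_bound[of _ "B r"]) auto
  have "((\<lambda>r. \<integral>x. (G r x - G t x) / (r - t) \<partial>M) \<longlongrightarrow> (\<integral>x. G' x \<partial>M)) (at_right t)"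
  proof (rule bounded_convergence_at_right[where B = K])
    fix r x assume "r > t"
    then show "\<bar>(G r x - G t x) / (r - t)\<bar> \<le> K" using lip[of r x] by (simp add: field_simps)
  next
    fix x show "((\<lambda>r. (G r x - G t x) / (r - t)) \<longlongrightarrow> G' x) (at_right t)"
      using deriv[of x] by (simp add: has_field_derivative_iff)
  qed (use meas in \<open>auto intro!: borel_measurable_divide borel_measurable_diff\<close>)
  moreover have "\<forall>\<^sub>F r in at_right t. (\<integral>x. (G r x - G t x) / (r - t) \<partial>M) = ((\<integral>x. G r x \<partial>M) - (\<integral>x. G t x \<partial>M)) / (r - t)"
    using eventually_at_right_less[of t] by eventually_elim (simp add: int)
  ultimately show ?thesis
    unfolding has_field_derivative_iff using filterlim_cong[OF refl refl] by fast
qed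

lemma lipschitz_mean_continuous:
  fixes G :: "real \<Rightarrow> 'a \<Rightarrow> real"
  assumes meas: "\<And>t. 0 \<le> t \<Longrightarrow> G t \<in> borel_measurable M" and bound: "\<And>t x. 0 \<le> t \<Longrightarrow> \<bar>G t x\<bar> \<le> A"
    and lip: "\<And>s t x. 0 \<le> s \<Longrightarrow> s \<le> t \<Longrightarrow> \<bar>G t x - G s x\<bar> \<le> K * (t - s)" and K: "0 \<le> K"
  shows "continuous_on {0..} (\<lambda>t. \<integral>x. G t x \<partial>M)"
proof (rule lipschitz_on_continuous_on[where L = K], rule lipschitz_onI[OF _ K])
  have int: "integrable M (G t)" if "0 \<le> t" for t
    using that by (intro L2_integrable L2_bounded[OF meas bound])
  have le: "\<bar>(\<integral>x. G t x \<partial>M) - (\<integral>x. G s x \<partial>M)\<bar> \<le> K * (t - s)" if "0 \<le> s" "s \<le> t" for s t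
  proof -
    have "\<bar>(\<integral>x. G t x \<partial>M) - (\<integral>x. G s x \<partial>M)\<bar> = \<bar>\<integral>x. G t x - G s x \<partial>M\<bar>"
      using int that by simp
    also have "\<dots> \<le> (\<integral>x. \<bar>G t x - G s x\<bar> \<partial>M)" by (rule integral_abs_bound)
    also have "\<dots> \<le> (\<integral>x. K * (t - s) \<partial>M)" using int that lip by (intro integral_mono) auto
    also have "\<dots> = K * (t - s)" using prob_space by simp
    finally show ?thesis .
  qed
  fix s t :: real assume "s \<in> {0..}" "t \<in> {0..}"
  then show "dist (\<integral>x. G s x \<partial>M) (\<integral>x. G t x \<partial>M) \<le> K * dist s t"
    using le[of s t] le[of t s] by (cases "s \<le> t") (auto simp: dist_real_def abs_minus_commute)
qed

end

lemma L2_operator_add: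
  "L2_bounded_operator M T \<Longrightarrow> f \<in> L2 M \<Longrightarrow> g \<in> L2 M \<Longrightarrow> AE x in M. T (\<lambda>y. f y + g y) x = T f x + T g x"
  unfolding L2_bounded_operator_def by blast

lemma L2_operator_cmult:
  "L2_bounded_operator M T \<Longrightarrow> f \<in> L2 M \<Longrightarrow> AE x in M. T (\<lambda>y. c * f y) x = c * T f x"
  unfolding L2_bounded_operator_def by blast

lemma L2_operator_diff:
  assumes T: "L2_bounded_operator M T" and f: "f \<in> L2 M" and g: "g \<in> L2 M"
  shows "AE x in M. T (\<lambda>y. f y - g y) x = T f x - T g x"
proof -
  have "AE x in M. T (\<lambda>y. f y + (- 1) * g y) x = T f x + T (\<lambda>y. (- 1) * g y) x"
    by (rule L2_operator_add[OF T f L2_cmult[OF g]])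
  moreover have "AE x in M. T (\<lambda>y. (- 1) * g y) x = (- 1) * T g x"
    by (rule L2_operator_cmult[OF T g])
  ultimately show ?thesis by eventually_elim simp
qed

lemma L2_operator_norm_bound:
  assumes T: "L2_bounded_operator M T" and f: "f \<in> L2 M"
  shows "L2_norm M (T f) \<le> L2_operator_norm M T * L2_norm M f"
proof -
  obtain C where C: "\<And>f. f \<in> L2 M \<Longrightarrow> L2_norm M (T f) \<le> C * L2_norm M f"
    using T unfolding L2_bounded_operator_def by blast
  show ?thesis
  proof (cases "L2_norm M f = 0")
    case True
    then show ?thesis using C[OF f] by simp
  next
    case False
    define a where "a = L2_norm M f"
    have a: "a > 0" using False L2_norm_nonneg[of M f] unfolding a_def by linarith
    define g where "g x = inverse a * f x" for x
    have g: "g \<in> L2 M" unfolding g_def using f by (rule L2_cmult)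
    have "L2_norm M g = 1"
      unfolding g_def L2_norm_cmult using a by (simp add: a_def)
    then have "L2_norm M (T g) \<le> L2_operator_norm M T"
      unfolding L2_operator_norm_def
    proof (intro cSUP_upper)
      show "bdd_above ((\<lambda>f. L2_norm M (T f)) ` {f \<in> L2 M. L2_norm M f \<le> 1})"
      proof (rule bdd_aboveI2)
        fix f assume "f \<in> {f \<in> L2 M. L2_norm M f \<le> 1}"
        then have "L2_norm M (T f) \<le> C * L2_norm M f" "L2_norm M f \<le> 1" using C by auto
        moreover have "C * L2_norm M f \<le> \<bar>C\<bar> * L2_norm M f" by (intro mult_right_mono) auto
        moreover have "\<bar>C\<bar> * L2_norm M f \<le> \<bar>C\<bar> * 1" using calculation by (intro mult_left_mono) auto
        ultimately show "L2_norm M (T f) \<le> \<bar>C\<bar>" by simp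
      qed
    qed (use g in simp)
    moreover have "L2_norm M (T g) = inverse a * L2_norm M (T f)"
    proof -
      have "AE x in M. T g x = inverse a * T f x"
        using T f unfolding L2_bounded_operator_def g_def[abs_def] by blast
      moreover have "T g \<in> L2 M" "T f \<in> L2 M" using T f g by (auto simp: L2_bounded_operator_def)
      ultimately have "L2_norm M (T g) = L2_norm M (\<lambda>x. inverse a * T f x)"
        by (intro L2_norm_cong_AE) (auto dest: L2_measurable)
      then show ?thesis using a by (simp add: L2_norm_cmult)
    qed
    ultimately show ?thesis using a by (simp add: a_def[symmetric] field_simps)
  qed
qed

section \<open>Time integrals along orbits of the transition operators\<close>

lemma set_integrable_const: "set_integrable lborel {a..b::real} (\<lambda>s. c::real)"
  unfolding set_integrable_def
  using emeasure_compact_finite[of "{a..b}"] by (intro integrable_scaleR_left integrable_real_indicator) auto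

context cadlag_markov_process
begin

context
  fixes f :: "'a \<Rightarrow> real" and B :: real
  assumes f_cont: "continuous_on UNIV f" and f_bound: "\<And>x. \<bar>f x\<bar> \<le> B"
begin

lemma observable_borel[measurable]: "f \<in> borel_measurable borel"
  using f_cont by (rule borel_measurable_continuous_onI)

text \<open>The time integral of \<open>s \<mapsto> transition P s f x\<close> over \<open>{0..a}\<close>, taken separately for each \<open>x\<close>. Since \<open>f\<close>
  is bounded and continuous, it stands in for the \<open>L\<^sup>2\<close>-valued integral of semigroup theory. The cut-off
  \<open>max 0 s\<close> makes the integrand measurable on the whole line.\<close>

definition orbit_integral :: "real \<Rightarrow> 'a \<Rightarrow> real" where
  "orbit_integral a x = (LINT s:{0..a}|lborel. transition P (max 0 s) f x)"

lemma orbit_measurable[measurable]: "(\<lambda>s. transition P (max 0 s) f x) \<in> borel_measurable borel"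
proof -
  have "(\<lambda>s. transition P (max 0 (fst (s, x))) f (snd (s, x))) \<in> borel_measurable borel"
    by (rule measurable_compose[OF _ transition_jointly_measurable[OF f_cont f_bound]]) measurable
  then show ?thesis by simp
qed

lemma orbit_set_integrable: "set_integrable lborel {a..b} (\<lambda>s. transition P (max 0 s) f x)"
proof (rule set_integrable_bound)
  show "set_integrable lborel {a..b} (\<lambda>s. B)"
    by (rule set_integrable_const)
  show "AE s in lborel. s \<in> {a..b} \<longrightarrow> norm (transition P (max 0 s) f x) \<le> norm B"
    using transition_bound[OF _ observable_borel f_bound] by (auto intro!: AE_I2 order.trans[OF _ abs_ge_self])
qed (simp add: set_borel_measurable_def)

lemma orbit_integral_split:
  assumes "0 \<le> a" "a \<le> b"
  shows "orbit_integral b x = orbit_integral a x + (LINT s:{a..b}|lborel. transition P (max 0 s) f x)"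
proof -
  have eq: "(LINT s:{a..b}|lborel. transition P (max 0 s) f x) = integral {a..b} (\<lambda>s. transition P (max 0 s) f x)" for a b
    by (rule set_borel_integral_eq_integral[OF orbit_set_integrable])
  show ?thesis unfolding orbit_integral_def eq
    by (rule Henstock_Kurzweil_Integration.integral_combine[symmetric, OF assms])
       (rule set_borel_integral_eq_integral[OF orbit_set_integrable])
qed

lemma orbit_integral_lipschitz:
  assumes "0 \<le> a" "a \<le> b"
  shows "\<bar>orbit_integral b x - orbit_integral a x\<bar> \<le> B * (b - a)"
proof -
  have "\<bar>LINT s:{a..b}|lborel. transition P (max 0 s) f x\<bar> \<le> (LINT s:{a..b}|lborel. \<bar>transition P (max 0 s) f x\<bar>)"
    using set_integral_norm_bound[OF orbit_set_integrable, of a b x] by simp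
  also have "\<dots> \<le> (LINT s:{a..b}|lborel. B)"
    using set_integrable_norm[OF orbit_set_integrable, of a b x] transition_bound[OF _ observable_borel f_bound]
    by (intro set_integral_mono set_integrable_const) auto
  also have "\<dots> = B * (b - a)" using assms by (simp add: set_lebesgue_integral_def)
  finally show ?thesis using orbit_integral_split[OF assms] by simp
qed

lemma orbit_integral_bound: "0 \<le> a \<Longrightarrow> \<bar>orbit_integral a x\<bar> \<le> B * a"
  using orbit_integral_lipschitz[of 0 a x] orbit_integral_split[of 0 0 x] by (simp add: orbit_integral_def)

lemma orbit_integral_right_derivative:
  assumes t: "0 \<le> t"
  shows "((\<lambda>u. orbit_integral u x) has_real_derivative transition P t f x) (at_right t)"
  unfolding has_field_derivative_iff
proof (rule tendstoI)
  fix e :: real assume "e > 0"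
  have "\<forall>\<^sub>F s in at_right t. dist (transition P s f x) (transition P t f x) < e / 2"
    by (rule tendstoD[OF transition_right_continuous[OF t f_cont f_bound]]) (use \<open>e > 0\<close> in simp)
  then obtain b where b: "b > t" "\<And>s. t < s \<Longrightarrow> s < b \<Longrightarrow> dist (transition P s f x) (transition P t f x) < e / 2"
    unfolding eventually_at_right_field by blast
  have "\<forall>\<^sub>F u in at_right t. u \<in> {t<..<b}"
    using \<open>b > t\<close> by (rule eventually_at_right_real)
  then show "\<forall>\<^sub>F u in at_right t. dist ((orbit_integral u x - orbit_integral t x) / (u - t)) (transition P t f x) < e"
  proof eventually_elim
    case (elim u)
    have "\<bar>(orbit_integral u x - orbit_integral t x) - transition P t f x * (u - t)\<bar>
        = \<bar>LINT s:{t..u}|lborel. transition P (max 0 s) f x - transition P t f x\<bar>"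
      using elim t orbit_integral_split[OF t, of u x]
      by (subst set_integral_diff[OF orbit_set_integrable set_integrable_const])
        (simp_all add: set_lebesgue_integral_def[of _ _ "\<lambda>_. transition P t f x"] mult.commute)
    also have "\<dots> \<le> (LINT s:{t..u}|lborel. \<bar>transition P (max 0 s) f x - transition P t f x\<bar>)"
      using set_integral_norm_bound[OF set_integral_diff(1)[OF orbit_set_integrable set_integrable_const], of t u x] by simp
    also have "\<dots> \<le> (LINT s:{t..u}|lborel. e / 2)"
    proof (rule set_integral_mono)
      show "set_integrable lborel {t..u} (\<lambda>s. \<bar>transition P (max 0 s) f x - transition P t f x\<bar>)"
        using set_integrable_norm[OF set_integral_diff(1)[OF orbit_set_integrable set_integrable_const], of t u x] by simp
      fix s assume "s \<in> {t..u}"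
      then show "\<bar>transition P (max 0 s) f x - transition P t f x\<bar> \<le> e / 2"
        using b(2)[of s] elim t \<open>e > 0\<close> by (cases "s = t") (auto simp: dist_real_def max_def)
    qed (rule set_integrable_const)
    also have "\<dots> = e / 2 * (u - t)" using elim by (simp add: set_lebesgue_integral_def)
    also have "\<dots> < e * (u - t)" using elim \<open>e > 0\<close> by simp
    finally have "\<bar>(orbit_integral u x - orbit_integral t x) - transition P t f x * (u - t)\<bar> / (u - t) < e"
      using elim by (simp add: field_simps)
    moreover have "\<bar>(orbit_integral u x - orbit_integral t x) - transition P t f x * (u - t)\<bar> / (u - t)
       = \<bar>(orbit_integral u x - orbit_integral t x) / (u - t) - transition P t f x\<bar>"
      using elim by (simp add: abs_div_pos diff_divide_distrib)
    ultimately show ?case by (simp add: dist_real_def)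
  qed
qed

lemma orbit_integral_measurable[measurable]: "orbit_integral a \<in> borel_measurable borel"
proof -
  have "(\<lambda>p. transition P (max 0 (snd p)) f (fst p)) \<in> borel_measurable (borel \<Otimes>\<^sub>M lborel)"
    using measurable_compose[OF measurable_pair_swap' transition_jointly_measurable[OF f_cont f_bound]]
    by (simp add: case_prod_beta')
  then show ?thesis
    unfolding orbit_integral_def[abs_def] set_lebesgue_integral_def
    by (intro sigma_finite_measure.borel_measurable_lebesgue_integral[OF lborel.sigma_finite_measure_axioms]) (simp add: case_prod_beta')
qed

text \<open>Fubini and the semigroup law: applying the transition operator shifts the window of integration.\<close>

lemma transition_orbit_integral:
  assumes r: "0 \<le> r" and a: "0 \<le> a"
  shows "transition P r (orbit_integral a) x = orbit_integral (a + r) x - orbit_integral r x"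
proof -
  interpret prob_space "P x" by (rule prob_space_P)
  interpret pair: pair_sigma_finite lborel "P x" by standard
  have [measurable]: "(\<lambda>\<omega>. \<omega> r) \<in> path_space \<rightarrow>\<^sub>M borel" using r by (rule measurable_eval)
  let ?g = "\<lambda>s \<omega>. indicator {0..a} s * transition P (max 0 s) f (\<omega> r)"
  have meas: "case_prod ?g \<in> borel_measurable (lborel \<Otimes>\<^sub>M P x)"
  proof -
    have "(\<lambda>p. (fst p, (snd p) r)) \<in> lborel \<Otimes>\<^sub>M P x \<rightarrow>\<^sub>M borel \<Otimes>\<^sub>M borel" by measurable
    from measurable_compose[OF this transition_jointly_measurable[OF f_cont f_bound]]
    show ?thesis by (simp add: case_prod_beta')
  qed
  have "integrable (lborel \<Otimes>\<^sub>M P x) (case_prod ?g)"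
  proof (rule Bochner_Integration.integrable_bound)
    have "emeasure (lborel \<Otimes>\<^sub>M P x) ({0..a} \<times> space (P x)) < \<infinity>"
      by (subst emeasure_pair_measure_Times) (use a in \<open>auto simp: emeasure_eq_measure ennreal_mult_less_top\<close>)
    then show "integrable (lborel \<Otimes>\<^sub>M P x) (\<lambda>p. B * indicator ({0..a} \<times> space (P x)) p)"
      by (intro integrable_mult_right integrable_real_indicator) auto
    show "AE p in lborel \<Otimes>\<^sub>M P x. norm (case_prod ?g p) \<le> norm (B * indicator ({0..a} \<times> space (P x)) p)"
    proof (rule AE_I2)
      fix p :: "real \<times> (real \<Rightarrow> 'a)" assume "p \<in> space (lborel \<Otimes>\<^sub>M P x)"
      then have "indicator ({0..a} \<times> space (P x)) p = (indicator {0..a} (fst p) :: real)"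
        by (auto simp: space_pair_measure split: split_indicator)
      moreover have "\<bar>transition P (max 0 (fst p)) f (snd p r)\<bar> \<le> \<bar>B\<bar>"
        using transition_bound[OF _ observable_borel f_bound, of "max 0 (fst p)" "snd p r"] by simp
      ultimately show "norm (case_prod ?g p) \<le> norm (B * indicator ({0..a} \<times> space (P x)) p)"
        by (simp add: case_prod_beta' abs_mult mult.commute[of "\<bar>B\<bar>"] mult_left_mono)
    qed
  qed (rule meas)
  note Fubini = pair.Fubini_integral[OF this]
  have "transition P r (orbit_integral a) x = (\<integral>\<omega>. \<integral>s. ?g s \<omega> \<partial>lborel \<partial>P x)"
    by (simp add: transition_def[of P r] orbit_integral_def set_lebesgue_integral_def)
  also have "\<dots> = (\<integral>s. \<integral>\<omega>. ?g s \<omega> \<partial>P x \<partial>lborel)" by (rule Fubini)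
  also have "\<dots> = (\<integral>s. indicator {r..a + r} (r + s) * transition P (max 0 (r + s)) f x \<partial>lborel)"
  proof (rule Bochner_Integration.integral_cong[OF refl])
    fix s :: real
    have "(\<integral>\<omega>. transition P (max 0 s) f (\<omega> r) \<partial>P x) = transition P (r + max 0 s) f x"
      using transition_transition[OF r _ observable_borel f_bound, of "max 0 s" x] by (simp add: transition_def[of P r])
    then show "(\<integral>\<omega>. ?g s \<omega> \<partial>P x) = indicator {r..a + r} (r + s) * transition P (max 0 (r + s)) f x"
      using r by (auto split: split_indicator simp: max_def)
  qed
  also have "\<dots> = (\<integral>s. indicator {r..a + r} s * transition P (max 0 s) f x \<partial>lborel)"
    using lborel_integral_real_affine[of 1 "\<lambda>s. indicator {r..a + r} s * transition P (max 0 s) f x" r] by simp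
  also have "\<dots> = orbit_integral (a + r) x - orbit_integral r x"
    using orbit_integral_split[of r "a + r" x] r a by (simp add: set_lebesgue_integral_def)
  finally show ?thesis .
qed

end

end

context cadlag_markov_process
begin

lemma transition_diff:
  fixes g h :: "'a \<Rightarrow> real"
  assumes "0 \<le> t" "g \<in> borel_measurable borel" "\<And>x. \<bar>g x\<bar> \<le> A" "h \<in> borel_measurable borel" "\<And>x. \<bar>h x\<bar> \<le> B"
  shows "transition P t (\<lambda>x. g x - h x) x = transition P t g x - transition P t h x"
  unfolding transition_def
  by (rule Bochner_Integration.integral_diff[OF integrable_eval[OF assms(1-3)] integrable_eval[OF assms(1,4,5)]])

lemma transition_const: "transition P t (\<lambda>_. c) x = c"
  by (simp add: transition_def)

lemma transition_divide: "transition P t (\<lambda>x. g x / c) x = transition P t g x / c"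
  by (simp add: transition_def)

text \<open>The approximating sequence is chosen for \<open>M\<close> and for the law at time \<open>t\<close> of the process started from
  \<open>M\<close> simultaneously; convergence under the latter is convergence of the transition operator in
  \<open>L\<^sup>1 M\<close>.\<close>

lemma transition_continuous_approximation:
  fixes h :: "'a \<Rightarrow> real"
  assumes M: "sets M = sets borel" "prob_space M" and t: "0 \<le> t"
    and h: "h \<in> borel_measurable borel" and B: "\<And>x. \<bar>h x\<bar> \<le> B"
  obtains g where "\<And>n::nat. continuous_on UNIV (g n)" "\<And>n x. \<bar>g n x\<bar> \<le> B"
    "AE x in M. (\<lambda>n. g n x) \<longlonglongrightarrow> h x"
    "(\<lambda>n. \<integral>x. \<bar>transition P t (g n) x - transition P t h x\<bar> \<partial>M) \<longlonglongrightarrow> 0"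
proof -
  let ?N = "distr (M \<bind> P) borel (\<lambda>\<omega>. \<omega> t)"
  interpret M: prob_space M by (rule M)
  interpret N: prob_space ?N by (rule prob_space_marginal[OF M t])
  obtain g where g: "\<And>n::nat. continuous_on UNIV (g n)" "\<And>n x. \<bar>g n x\<bar> \<le> B"
    "AE x in M. (\<lambda>n. g n x) \<longlonglongrightarrow> h x" "AE x in ?N. (\<lambda>n. g n x) \<longlonglongrightarrow> h x"
    using bounded_borel_AE_limit_of_continuous2[OF M(1) M.finite_measure_axioms _ N.finite_measure_axioms h B] by auto
  have g_meas: "g n \<in> borel_measurable borel" for n using g(1) by (rule borel_measurable_continuous_onI)
  have diff_meas: "(\<lambda>x. \<bar>g n x - h x\<bar>) \<in> borel_measurable borel" for n
    using g_meas h by measurable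
  have diff_bound: "\<bar>\<bar>g n x - h x\<bar>\<bar> \<le> 2 * B" for n x
    using g(2)[of n x] B[of x] by simp
  have le: "(\<integral>x. \<bar>transition P t (g n) x - transition P t h x\<bar> \<partial>M) \<le> (\<integral>x. \<bar>g n x - h x\<bar> \<partial>?N)" for n
  proof -
    have trans_meas: "transition P t k \<in> borel_measurable M" if "k \<in> borel_measurable borel" for k
      using measurable_transition[OF t that] measurable_cong_sets[OF M(1) refl] by blast
    have "(\<integral>x. \<bar>transition P t (g n) x - transition P t h x\<bar> \<partial>M) \<le> (\<integral>x. transition P t (\<lambda>x. \<bar>g n x - h x\<bar>) x \<partial>M)"
    proof (rule integral_mono)
      have "\<bar>transition P t (g n) x - transition P t h x\<bar> \<le> 2 * B" for x
        using transition_bound[OF t g_meas g(2), of n x] transition_bound[OF t h B, of x] by simp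
      then show "integrable M (\<lambda>x. \<bar>transition P t (g n) x - transition P t h x\<bar>)"
        by (intro M.integrable_const_bound[of _ "2 * B"]) (auto intro!: borel_measurable_abs borel_measurable_diff trans_meas g_meas h)
      show "integrable M (transition P t (\<lambda>x. \<bar>g n x - h x\<bar>))"
        using transition_bound[OF t diff_meas diff_bound]
        by (intro M.integrable_const_bound[of _ "2 * B"]) (auto intro!: trans_meas diff_meas)
      show "\<bar>transition P t (g n) x - transition P t h x\<bar> \<le> transition P t (\<lambda>x. \<bar>g n x - h x\<bar>) x" for x
        unfolding transition_diff[OF t g_meas g(2) h B, symmetric]
        unfolding transition_def by (rule integral_abs_bound)
    qed
    then show ?thesis by (simp only: integral_marginal[OF M t diff_meas diff_bound])
  qed
  have "(\<lambda>n. \<integral>x. \<bar>g n x - h x\<bar> \<partial>?N) \<longlonglongrightarrow> (\<integral>x. 0 \<partial>?N)"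
  proof (rule N.bounded_convergence[where B = "2 * B"])
    show "AE x in ?N. (\<lambda>n. \<bar>g n x - h x\<bar>) \<longlonglongrightarrow> 0"
      using g(4) by eventually_elim (auto intro!: tendsto_rabs_zero simp: LIM_zero_iff)
  qed (use diff_meas diff_bound in \<open>simp_all\<close>)
  then have lim: "(\<lambda>n. \<integral>x. \<bar>g n x - h x\<bar> \<partial>?N) \<longlonglongrightarrow> 0" by simp
  show thesis
  proof (rule that[OF g(1-3)])
    show "(\<lambda>n. \<integral>x. \<bar>transition P t (g n) x - transition P t h x\<bar> \<partial>M) \<longlonglongrightarrow> 0"
      by (rule Lim_null_comparison[OF _ lim]) (use le in simp)
  qed
qed

end

section \<open>The generator of the perturbed semigroup\<close>

locale l2_perturbation = base: cadlag_markov_process P + pert: cadlag_markov_process Peps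
  for P Peps :: "'a::metric_space \<Rightarrow> (real \<Rightarrow> 'a) measure" +
  fixes \<mu> :: "'a measure" and Lhat :: "('a \<Rightarrow> real) \<Rightarrow> 'a \<Rightarrow> real"
    and Seps :: "real \<Rightarrow> ('a \<Rightarrow> real) \<Rightarrow> 'a \<Rightarrow> real" and \<gamma> :: real
  assumes \<mu>_invariant: "invariant_distribution P \<mu>"
    and Lhat: "L2_bounded_operator \<mu> Lhat"
    and Lhat_pos: "0 < L2_operator_norm \<mu> Lhat"
    and Seps: "C0_semigroup \<mu> Seps"
    and generator_Seps: "generator \<mu> Seps = perturbed_graph \<mu> (generator \<mu> (transition P)) Lhat"
    and poincare: "poincare_inequality \<mu> (generator \<mu> (transition P)) \<gamma>"
    and agree: "\<And>t g. t \<ge> 0 \<Longrightarrow> continuous_on UNIV g \<Longrightarrow> bounded (range g) \<Longrightarrow>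
           AE \<eta> in \<mu>. Seps t g \<eta> = transition Peps t g \<eta>"
    and gap: "L2_operator_norm \<mu> Lhat < \<gamma>"
begin

abbreviation "\<epsilon> \<equiv> L2_operator_norm \<mu> Lhat"

lemma sets_\<mu>[measurable_cong, simp]: "sets \<mu> = sets borel"
  using \<mu>_invariant by (simp add: invariant_distribution_def)

lemma space_\<mu>[simp]: "space \<mu> = UNIV"
  using sets_eq_imp_space_eq[OF sets_\<mu>] by simp

lemma measurable_\<mu>: "g \<in> borel_measurable \<mu> \<longleftrightarrow> g \<in> borel_measurable borel"
  using measurable_cong_sets[OF sets_\<mu> refl] by blast

sublocale \<mu>: prob_space \<mu>
  using \<mu>_invariant by (simp add: invariant_distribution_def)

lemma L2_bounded_borel:
  fixes g :: "'a \<Rightarrow> real"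
  shows "g \<in> borel_measurable borel \<Longrightarrow> (\<And>x. \<bar>g x\<bar> \<le> B) \<Longrightarrow> g \<in> L2 \<mu>"
  using \<mu>.L2_bounded[of g B] measurable_\<mu> by blast

lemma L2_transition:
  fixes g :: "'a \<Rightarrow> real"
  assumes "0 \<le> t" "g \<in> borel_measurable borel" "\<And>x. \<bar>g x\<bar> \<le> B"
  shows "transition Peps t g \<in> L2 \<mu>" "transition P t g \<in> L2 \<mu>"
  using assms
  by (auto intro!: L2_bounded_borel[of _ B] pert.measurable_transition base.measurable_transition
      pert.transition_bound base.transition_bound)

lemma Seps_L2: "0 \<le> t \<Longrightarrow> f \<in> L2 \<mu> \<Longrightarrow> Seps t f \<in> L2 \<mu>"
  using Seps by (simp add: C0_semigroup_def L2_bounded_operator_def)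

text \<open>Both sides are continuous along the approximating sequence of \<open>h\<close> by bounded continuous functions: the
  left one because \<open>Seps t\<close> is bounded on \<open>L\<^sup>2\<close>, the right one by the choice of the sequence.\<close>

lemma Seps_eq_transition:
  fixes h :: "'a \<Rightarrow> real"
  assumes t: "0 \<le> t" and h: "h \<in> borel_measurable borel" and B: "\<And>x. \<bar>h x\<bar> \<le> B"
  shows "AE x in \<mu>. Seps t h x = transition Peps t h x"
proof -
  obtain g where g: "\<And>n::nat. continuous_on UNIV (g n)" "\<And>n x. \<bar>g n x\<bar> \<le> B"
    "AE x in \<mu>. (\<lambda>n. g n x) \<longlonglongrightarrow> h x"
    "(\<lambda>n. \<integral>x. \<bar>transition Peps t (g n) x - transition Peps t h x\<bar> \<partial>\<mu>) \<longlonglongrightarrow> 0"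
    using pert.transition_continuous_approximation[OF sets_\<mu> \<mu>.prob_space_axioms t h B] by blast
  have g_meas: "g n \<in> borel_measurable borel" for n using g(1) by (rule borel_measurable_continuous_onI)
  note g_L2 = L2_bounded_borel[OF g_meas g(2)] and h_L2 = L2_bounded_borel[OF h B]
  have T: "L2_bounded_operator \<mu> (Seps t)" using Seps t by (simp add: C0_semigroup_def)
  define C where "C = L2_operator_norm \<mu> (Seps t)"
  define R where "R = (\<integral>x. \<bar>Seps t h x - transition Peps t h x\<bar> \<partial>\<mu>)"
  have int: "integrable \<mu> (\<lambda>x. \<bar>Seps t h x - transition Peps t h x\<bar>)"
    by (intro integrable_abs \<mu>.L2_integrable L2_diff Seps_L2 L2_transition[OF t h B] t h_L2)
  have R_le: "R \<le> C * L2_norm \<mu> (\<lambda>x. h x - g n x) + (\<integral>x. \<bar>transition Peps t (g n) x - transition Peps t h x\<bar> \<partial>\<mu>)" for n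
  proof -
    have int1: "integrable \<mu> (\<lambda>x. \<bar>Seps t (\<lambda>x. h x - g n x) x\<bar>)"
      by (intro integrable_abs \<mu>.L2_integrable Seps_L2 L2_diff t h_L2 g_L2)
    have int2: "integrable \<mu> (\<lambda>x. \<bar>transition Peps t (g n) x - transition Peps t h x\<bar>)"
      by (intro integrable_abs \<mu>.L2_integrable L2_diff L2_transition[OF t h B] L2_transition[OF t g_meas g(2)])
    have "R \<le> (\<integral>x. \<bar>Seps t (\<lambda>x. h x - g n x) x\<bar> + \<bar>transition Peps t (g n) x - transition Peps t h x\<bar> \<partial>\<mu>)"
      unfolding R_def
    proof (rule integral_mono_AE)
      have "AE x in \<mu>. Seps t (g n) x = transition Peps t (g n) x"
        using g(2) by (intro agree t g(1)) (auto simp: bounded_iff)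
      then show "AE x in \<mu>. \<bar>Seps t h x - transition Peps t h x\<bar>
          \<le> \<bar>Seps t (\<lambda>x. h x - g n x) x\<bar> + \<bar>transition Peps t (g n) x - transition Peps t h x\<bar>"
        using L2_operator_diff[OF T h_L2 g_L2[of n]] by eventually_elim simp
    qed (use int int1 int2 in auto)
    also have "\<dots> = (\<integral>x. \<bar>Seps t (\<lambda>x. h x - g n x) x\<bar> \<partial>\<mu>) + (\<integral>x. \<bar>transition Peps t (g n) x - transition Peps t h x\<bar> \<partial>\<mu>)"
      using int1 int2 by (rule Bochner_Integration.integral_add)
    also have "(\<integral>x. \<bar>Seps t (\<lambda>x. h x - g n x) x\<bar> \<partial>\<mu>) \<le> L2_norm \<mu> (Seps t (\<lambda>x. h x - g n x))"
      by (intro \<mu>.integral_abs_le_L2_norm Seps_L2 L2_diff t h_L2 g_L2)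
    also have "\<dots> \<le> C * L2_norm \<mu> (\<lambda>x. h x - g n x)"
      unfolding C_def by (intro L2_operator_norm_bound T L2_diff h_L2 g_L2)
    finally show ?thesis by simp
  qed
  have "(\<lambda>n. \<integral>x. (h x - g n x)\<^sup>2 \<partial>\<mu>) \<longlonglongrightarrow> (\<integral>x. 0 \<partial>\<mu>)"
  proof (rule \<mu>.bounded_convergence[where B = "(2 * B)\<^sup>2"])
    show "AE x in \<mu>. (\<lambda>n. (h x - g n x)\<^sup>2) \<longlonglongrightarrow> 0"
      using g(3)
    proof eventually_elim
      case (elim x)
      have "(\<lambda>n. (h x - g n x)\<^sup>2) \<longlonglongrightarrow> (h x - h x)\<^sup>2" by (intro tendsto_intros elim)
      then show ?case by simp
    qed
    show "\<bar>(h x - g n x)\<^sup>2\<bar> \<le> (2 * B)\<^sup>2" for n x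
    proof -
      have "\<bar>h x - g n x\<bar> \<le> \<bar>2 * B\<bar>" using g(2)[of n x] B[of x] by simp
      then show ?thesis unfolding abs_le_square_iff by simp
    qed
  qed (use measurable_\<mu> h g_meas in auto)
  then have "(\<lambda>n. L2_norm \<mu> (\<lambda>x. h x - g n x)) \<longlonglongrightarrow> 0"
    unfolding L2_norm_def using tendsto_real_sqrt by fastforce
  then have "(\<lambda>n. C * L2_norm \<mu> (\<lambda>x. h x - g n x) + (\<integral>x. \<bar>transition Peps t (g n) x - transition Peps t h x\<bar> \<partial>\<mu>)) \<longlonglongrightarrow> C * 0 + 0"
    by (intro tendsto_intros g(4))
  then have "R \<le> 0" by (intro LIMSEQ_le_const) (use R_le in auto)
  moreover have "0 \<le> R" unfolding R_def by simp
  ultimately have "R = 0" by linarith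
  then have "(\<integral>x. \<bar>Seps t h x - transition Peps t h x\<bar> \<partial>\<mu>) = 0" by (simp add: R_def)
  then show ?thesis using integral_nonneg_eq_0_iff_AE[OF int] by simp
qed

text \<open>The perturbed semigroup fixes constants, so the constant \<open>1\<close> is in the domain of the perturbed generator
  and is mapped to \<open>0\<close>; by the description of that generator it is in the domain of the unperturbed one.\<close>

lemma const_in_generators:
  obtains G where "(\<lambda>_. 1, G) \<in> generator \<mu> (transition P)" "AE x in \<mu>. 0 = G x + Lhat (\<lambda>_. 1) x"
proof -
  have one: "(\<lambda>_. 1) \<in> L2 \<mu>" by (rule L2_bounded_borel[of _ 1]) auto
  have "(\<lambda>_. 1, \<lambda>_. 0) \<in> generator \<mu> Seps"
  proof -
    have "L2_norm \<mu> (\<lambda>x. (Seps t (\<lambda>_. 1) x - 1) / t - 0) = 0" if "t > 0" for t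
    proof -
      have "AE x in \<mu>. Seps t (\<lambda>_. 1) x = transition Peps t (\<lambda>_. 1) x"
        using that by (intro agree) auto
      then have "L2_norm \<mu> (\<lambda>x. (Seps t (\<lambda>_. 1) x - 1) / t - 0) = L2_norm \<mu> (\<lambda>x. 0)"
        using Seps_L2[OF _ one, of t] that
        by (intro L2_norm_cong_AE) (auto dest!: L2_measurable simp: pert.transition_const)
      then show ?thesis by (simp add: L2_norm_def)
    qed
    then have "\<forall>\<^sub>F t in at_right 0. L2_norm \<mu> (\<lambda>x. (Seps t (\<lambda>_. 1) x - 1) / t - 0) = 0"
      using eventually_at_right_less[of "0::real"] by (rule eventually_mono[rotated])
    moreover have "(\<lambda>_. 0) \<in> L2 \<mu>" by (rule L2_bounded_borel[of _ 0]) auto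
    ultimately show ?thesis
      using one by (auto simp: generator_def intro: tendsto_eventually)
  qed
  then show thesis using that unfolding generator_Seps perturbed_graph_def by blast
qed

text \<open>Both generators annihilate constants, so their difference does. Hence the perturbation acts on centred
  functions only, which is why its norm competes with the spectral gap.\<close>

lemma Lhat_one: "AE x in \<mu>. Lhat (\<lambda>_. 1) x = 0"
proof -
  obtain G where G: "(\<lambda>_. 1, G) \<in> generator \<mu> (transition P)" "AE x in \<mu>. 0 = G x + Lhat (\<lambda>_. 1) x"
    by (rule const_in_generators)
  then have "G \<in> L2 \<mu>" and "((\<lambda>t. L2_norm \<mu> (\<lambda>x. (transition P t (\<lambda>_. 1) x - 1) / t - G x)) \<longlongrightarrow> 0) (at_right 0)"
    by (auto simp: generator_def)
  then have "((\<lambda>t. L2_norm \<mu> G) \<longlongrightarrow> 0) (at_right (0::real))"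
    by (simp add: base.transition_const L2_norm_def)
  then have "L2_norm \<mu> G = 0" by (simp add: tendsto_const_iff)
  with \<open>G \<in> L2 \<mu>\<close> have "AE x in \<mu>. G x = 0" by (rule L2_norm_eq_0_AE)
  with G(2) show ?thesis by eventually_elim simp
qed

lemma Lhat_add_const:
  assumes F: "F \<in> L2 \<mu>" shows "AE x in \<mu>. Lhat (\<lambda>y. F y + c) x = Lhat F x"
proof -
  have one: "(\<lambda>_. 1) \<in> L2 \<mu>" by (rule L2_bounded_borel[of _ 1]) auto
  have "AE x in \<mu>. Lhat (\<lambda>y. F y + c * 1) x = Lhat F x + Lhat (\<lambda>y. c * 1) x"
    by (rule L2_operator_add[OF Lhat F L2_cmult[OF one]])
  moreover have "AE x in \<mu>. Lhat (\<lambda>y. c * 1) x = c * Lhat (\<lambda>_. 1) x"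
    by (rule L2_operator_cmult[OF Lhat one])
  ultimately show ?thesis using Lhat_one by eventually_elim simp
qed

text \<open>Invariance of \<open>\<mu>\<close>: the difference quotients have mean \<open>0\<close>, and \<open>L\<^sup>2\<close> convergence implies convergence of
  means.\<close>

lemma generator_integral_zero:
  assumes FG: "(F, G) \<in> generator \<mu> (transition P)"
    and F: "F \<in> borel_measurable borel" "\<And>x. \<bar>F x\<bar> \<le> B"
  shows "(\<integral>x. G x \<partial>\<mu>) = 0"
proof -
  have G: "G \<in> L2 \<mu>" and lim: "((\<lambda>t. L2_norm \<mu> (\<lambda>x. (transition P t F x - F x) / t - G x)) \<longlongrightarrow> 0) (at_right 0)"
    using FG by (auto simp: generator_def)
  have "\<bar>\<integral>x. G x \<partial>\<mu>\<bar> \<le> L2_norm \<mu> (\<lambda>x. (transition P t F x - F x) / t - G x)" if "t > 0" for t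
  proof -
    have q: "(\<lambda>x. (transition P t F x - F x) / t) \<in> L2 \<mu>"
      using L2_cmult[OF L2_diff[OF L2_transition(2)[OF _ F] L2_bounded_borel[OF F]], of t "1 / t"] that by simp
    have "(\<integral>x. (transition P t F x - F x) / t \<partial>\<mu>) = 0"
      using \<mu>.L2_integrable[OF L2_transition(2)[OF _ F], of t] \<mu>.L2_integrable[OF L2_bounded_borel[OF F]]
        base.integral_transition_invariant[OF \<mu>_invariant _ F, of t] that by simp
    then have "(\<integral>x. G x \<partial>\<mu>) = - (\<integral>x. (transition P t F x - F x) / t - G x \<partial>\<mu>)"
      using \<mu>.L2_integrable[OF q] \<mu>.L2_integrable[OF G] by simp
    then show ?thesis using \<mu>.abs_integral_le_L2_norm[OF L2_diff[OF q G]] by simp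
  qed
  then have "\<forall>\<^sub>F t in at_right 0. \<bar>\<integral>x. G x \<partial>\<mu>\<bar> \<le> L2_norm \<mu> (\<lambda>x. (transition P t F x - F x) / t - G x)"
    using eventually_at_right_less[of "0::real"] by (rule eventually_mono[rotated])
  then have "\<bar>\<integral>x. G x \<partial>\<mu>\<bar> \<le> 0" by (rule tendsto_lowerbound[OF lim]) simp
  then show ?thesis by simp
qed

text \<open>The Poincare inequality bounds the part of the unperturbed generator by \<open>- \<gamma>\<close> times the variance, and
  the Cauchy-Schwarz inequality bounds the part of the perturbation by \<open>\<epsilon>\<close> times the variance. For the mean,
  only the perturbation contributes.\<close>

lemma generator_energy:
  fixes F :: "'a \<Rightarrow> real"
  assumes FU: "(F, U) \<in> generator \<mu> Seps"
    and F: "F \<in> borel_measurable borel" "\<And>x. \<bar>F x\<bar> \<le> B"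
  defines "m \<equiv> (\<integral>x. F x \<partial>\<mu>)"
  shows "(\<integral>x. (F x - m) * U x \<partial>\<mu>) \<le> - (\<gamma> - \<epsilon>) * (L2_norm \<mu> (\<lambda>x. F x - m))\<^sup>2"
    and "\<bar>\<integral>x. U x \<partial>\<mu>\<bar> \<le> \<epsilon> * L2_norm \<mu> (\<lambda>x. F x - m)"
proof -
  obtain G where FG: "(F, G) \<in> generator \<mu> (transition P)" and U: "U \<in> L2 \<mu>" "AE x in \<mu>. U x = G x + Lhat F x"
    using FU unfolding generator_Seps perturbed_graph_def by auto
  define F' where "F' x = F x - m" for x
  have F_L2: "F \<in> L2 \<mu>" and G: "G \<in> L2 \<mu>" using FG by (auto simp: generator_def)
  have m_L2: "(\<lambda>_. m) \<in> L2 \<mu>" by (rule L2_bounded_borel[of _ "\<bar>m\<bar>"]) auto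
  have F': "F' \<in> L2 \<mu>" unfolding F'_def using L2_diff[OF F_L2 m_L2] .
  have LF': "Lhat F' \<in> L2 \<mu>" using Lhat F' by (simp add: L2_bounded_operator_def)
  have "(F', G) \<in> generator \<mu> (transition P)"
  proof -
    have "\<forall>\<^sub>F t in at_right 0. L2_norm \<mu> (\<lambda>x. (transition P t F x - F x) / t - G x)
       = L2_norm \<mu> (\<lambda>x. (transition P t F' x - F' x) / t - G x)"
      using eventually_at_right_less[of "0::real"]
    proof eventually_elim
      case (elim t)
      then have "transition P t F' x = transition P t F x - m" for x
        unfolding F'_def[abs_def] using base.transition_diff[OF _ F, of t "\<lambda>_. m" "\<bar>m\<bar>" x]
        by (simp add: base.transition_const)
      then show ?case by (simp add: F'_def)
    qed
    then show ?thesis using FG F' G Lim_transform_eventually by (fastforce simp: generator_def)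
  qed
  moreover have "(\<integral>x. F' x \<partial>\<mu>) = 0"
    unfolding F'_def using \<mu>.L2_integrable[OF F_L2] using \<mu>.prob_space by (simp add: m_def)
  ultimately have poinc: "\<gamma> * (L2_norm \<mu> F')\<^sup>2 \<le> - (\<integral>x. F' x * G x \<partial>\<mu>)"
    using poincare by (auto simp: poincare_inequality_def)
  have "AE x in \<mu>. Lhat (\<lambda>y. F' y + m) x = Lhat F' x" by (rule Lhat_add_const[OF F'])
  then have U': "AE x in \<mu>. U x = G x + Lhat F' x" using U(2) by eventually_elim (simp add: F'_def)
  have LF'_norm: "L2_norm \<mu> (Lhat F') \<le> \<epsilon> * L2_norm \<mu> F'" by (rule L2_operator_norm_bound[OF Lhat F'])
  \<comment> \<open>Cauchy-Schwarz through the inequality \<open>2 * a * b \<le> \<epsilon> * a\<^sup>2 + b\<^sup>2 / \<epsilon>\<close>, which is sharp at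
    \<open>b = \<epsilon> * a\<close>.\<close>
  have "(\<integral>x. F' x * Lhat F' x \<partial>\<mu>) \<le> (\<integral>x. \<epsilon> / 2 * (F' x)\<^sup>2 + 1 / (2 * \<epsilon>) * (Lhat F' x)\<^sup>2 \<partial>\<mu>)"
  proof (rule integral_mono)
    show "F' x * Lhat F' x \<le> \<epsilon> / 2 * (F' x)\<^sup>2 + 1 / (2 * \<epsilon>) * (Lhat F' x)\<^sup>2" for x
    proof -
      have "0 \<le> (\<epsilon> * F' x - Lhat F' x)\<^sup>2 / (2 * \<epsilon>)" using Lhat_pos by simp
      also have "\<dots> = \<epsilon> / 2 * (F' x)\<^sup>2 + 1 / (2 * \<epsilon>) * (Lhat F' x)\<^sup>2 - F' x * Lhat F' x"
        using Lhat_pos by (simp add: power2_eq_square field_simps)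
      finally show ?thesis by simp
    qed
  qed (use L2_mult_integrable[OF F' LF'] L2_square_integrable[OF F'] L2_square_integrable[OF LF'] in auto)
  also have "\<dots> = \<epsilon> / 2 * (L2_norm \<mu> F')\<^sup>2 + 1 / (2 * \<epsilon>) * (L2_norm \<mu> (Lhat F'))\<^sup>2"
    using L2_square_integrable[OF F'] L2_square_integrable[OF LF'] by (simp add: L2_norm_sq)
  also have "\<dots> \<le> \<epsilon> / 2 * (L2_norm \<mu> F')\<^sup>2 + 1 / (2 * \<epsilon>) * (\<epsilon> * L2_norm \<mu> F')\<^sup>2"
    using LF'_norm Lhat_pos by (intro add_left_mono mult_left_mono power_mono) auto
  also have "\<dots> = \<epsilon> * (L2_norm \<mu> F')\<^sup>2" using Lhat_pos by (simp add: power2_eq_square field_simps)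
  finally have pert: "(\<integral>x. F' x * Lhat F' x \<partial>\<mu>) \<le> \<epsilon> * (L2_norm \<mu> F')\<^sup>2" .
  have "(\<integral>x. F' x * U x \<partial>\<mu>) = (\<integral>x. F' x * G x + F' x * Lhat F' x \<partial>\<mu>)"
    using U' by (intro integral_cong_AE) (use F' U G LF' in \<open>auto dest!: L2_measurable simp: distrib_left elim!: eventually_mono\<close>)
  also have "\<dots> = (\<integral>x. F' x * G x \<partial>\<mu>) + (\<integral>x. F' x * Lhat F' x \<partial>\<mu>)"
    by (intro Bochner_Integration.integral_add L2_mult_integrable F' G LF')
  also have "\<dots> \<le> - (\<gamma> - \<epsilon>) * (L2_norm \<mu> F')\<^sup>2" using poinc pert by (simp add: algebra_simps)
  finally show "(\<integral>x. (F x - m) * U x \<partial>\<mu>) \<le> - (\<gamma> - \<epsilon>) * (L2_norm \<mu> (\<lambda>x. F x - m))\<^sup>2"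
    by (simp add: F'_def[abs_def])
  have "(\<integral>x. U x \<partial>\<mu>) = (\<integral>x. G x + Lhat F' x \<partial>\<mu>)"
    using U' by (intro integral_cong_AE) (use U G LF' in \<open>auto dest!: L2_measurable\<close>)
  also have "\<dots> = (\<integral>x. Lhat F' x \<partial>\<mu>)"
    using generator_integral_zero[OF FG F] \<mu>.L2_integrable[OF G] \<mu>.L2_integrable[OF LF'] by simp
  finally have "\<bar>\<integral>x. U x \<partial>\<mu>\<bar> \<le> L2_norm \<mu> (Lhat F')" using \<mu>.abs_integral_le_L2_norm[OF LF'] by simp
  with LF'_norm show "\<bar>\<integral>x. U x \<partial>\<mu>\<bar> \<le> \<epsilon> * L2_norm \<mu> (\<lambda>x. F x - m)" by (simp add: F'_def[abs_def])
qed

end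

section \<open>Exponential decay of the variance\<close>

context l2_perturbation
begin

definition variance_\<mu> :: "('a \<Rightarrow> real) \<Rightarrow> real" where
  "variance_\<mu> g = (\<integral>x. (g x - (\<integral>y. g y \<partial>\<mu>))\<^sup>2 \<partial>\<mu>)"

lemma variance_\<mu>_nonneg: "0 \<le> variance_\<mu> g"
  by (simp add: variance_\<mu>_def)

lemma variance_\<mu>_eq:
  assumes "g \<in> borel_measurable borel" "\<And>x. \<bar>g x\<bar> \<le> B"
  shows "variance_\<mu> g = (\<integral>x. (g x)\<^sup>2 \<partial>\<mu>) - (\<integral>x. g x \<partial>\<mu>)\<^sup>2"
  unfolding variance_\<mu>_def using L2_bounded_borel[OF assms]
  by (intro \<mu>.variance_eq \<mu>.L2_integrable L2_square_integrable)

lemma variance_\<mu>_L2_norm: "variance_\<mu> g = (L2_norm \<mu> (\<lambda>x. g x - (\<integral>y. g y \<partial>\<mu>)))\<^sup>2"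
  by (simp add: variance_\<mu>_def L2_norm_sq)

context
  fixes f :: "'a \<Rightarrow> real" and B h :: real
  assumes f: "continuous_on UNIV f" and B: "\<And>x. \<bar>f x\<bar> \<le> B" and h: "0 < h"
begin

text \<open>The average of the orbit \<open>s \<mapsto> transition Peps s f\<close> over the window \<open>{t..t + h}\<close>. For \<open>h\<close> tending to \<open>0\<close> it
  recovers the orbit, and for every \<open>h > 0\<close> it is differentiable from the right in time, with derivative \<open>orbit_increment\<close>,
  so it stays in the domain of the generator.\<close>

definition orbit_average :: "real \<Rightarrow> 'a \<Rightarrow> real" where
  "orbit_average t x = (pert.orbit_integral f (t + h) x - pert.orbit_integral f t x) / h"

definition orbit_increment :: "real \<Rightarrow> 'a \<Rightarrow> real" where
  "orbit_increment t x = (transition Peps (t + h) f x - transition Peps t f x) / h"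

lemma observable_measurable: "f \<in> borel_measurable borel"
  using f by (rule borel_measurable_continuous_onI)

lemma observable_bound_nonneg: "0 \<le> B"
  using B[of undefined] by linarith

lemma orbit_average_measurable: "orbit_average t \<in> borel_measurable borel"
  using pert.orbit_integral_measurable[OF f B] unfolding orbit_average_def[abs_def] by measurable

lemma orbit_average_bound: "0 \<le> t \<Longrightarrow> \<bar>orbit_average t x\<bar> \<le> B"
  using pert.orbit_integral_lipschitz[OF f B, of t "t + h" x] h by (simp add: orbit_average_def field_simps)

lemma orbit_average_lipschitz:
  assumes "0 \<le> s" "s \<le> t"
  shows "\<bar>orbit_average t x - orbit_average s x\<bar> \<le> 2 * B / h * (t - s)"
proof -
  have "\<bar>(pert.orbit_integral f (t + h) x - pert.orbit_integral f (s + h) x) - (pert.orbit_integral f t x - pert.orbit_integral f s x)\<bar>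
      \<le> 2 * B * (t - s)"
    using pert.orbit_integral_lipschitz[OF f B, of "s + h" "t + h" x] pert.orbit_integral_lipschitz[OF f B, of s t x] assms h
    by (simp add: algebra_simps)
  then have "\<bar>(pert.orbit_integral f (t + h) x - pert.orbit_integral f (s + h) x) - (pert.orbit_integral f t x - pert.orbit_integral f s x)\<bar> / h
      \<le> 2 * B * (t - s) / h"
    using h by (intro divide_right_mono) auto
  moreover have "orbit_average t x - orbit_average s x
      = ((pert.orbit_integral f (t + h) x - pert.orbit_integral f (s + h) x) - (pert.orbit_integral f t x - pert.orbit_integral f s x)) / h"
    by (simp add: orbit_average_def diff_divide_distrib)
  ultimately show ?thesis by (simp add: abs_divide abs_of_pos[OF h] del: divide_le_cancel)
qed

lemma orbit_increment_measurable: "0 \<le> t \<Longrightarrow> orbit_increment t \<in> borel_measurable borel"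
  unfolding orbit_increment_def[abs_def] using h
  by (intro borel_measurable_divide borel_measurable_diff pert.measurable_transition observable_measurable measurable_const) auto

lemma orbit_increment_bound: "0 \<le> t \<Longrightarrow> \<bar>orbit_increment t x\<bar> \<le> 2 * B / h"
  using pert.transition_bound[OF _ observable_measurable B, of "t + h" x] pert.transition_bound[OF _ observable_measurable B, of t x] h
  unfolding orbit_increment_def by (simp add: divide_right_mono abs_div_pos[symmetric])

lemma orbit_average_right_derivative:
  assumes t: "0 \<le> t"
  shows "((\<lambda>u. orbit_average u x) has_real_derivative orbit_increment t x) (at_right t)"
proof -
  have "((\<lambda>u. pert.orbit_integral f (u + h) x) has_real_derivative transition Peps (t + h) f x) (at_right t)"
  proof -
    have "(+) h ` {t<..} = {h + t<..}" by (auto simp: image_iff intro!: bexI[of _ "_ - h"])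
    moreover have "((\<lambda>u. pert.orbit_integral f u x) has_real_derivative transition Peps (h + t) f x) (at_right (h + t))"
      using t h by (intro pert.orbit_integral_right_derivative[OF f B]) simp
    ultimately show ?thesis
      using DERIV_at_within_shift[of "\<lambda>u. pert.orbit_integral f u x" "transition Peps (h + t) f x" h t "{t<..}"]
      by (simp add: add.commute)
  qed
  then show ?thesis
    unfolding orbit_average_def orbit_increment_def
    by (intro DERIV_cdivide DERIV_diff pert.orbit_integral_right_derivative[OF f B t])
qed

lemma transition_orbit_average:
  assumes r: "0 \<le> r" and t: "0 \<le> t"
  shows "transition Peps r (orbit_average t) x = orbit_average (t + r) x"
proof -
  have "transition Peps r (\<lambda>x. pert.orbit_integral f (t + h) x - pert.orbit_integral f t x) x
     = transition Peps r (pert.orbit_integral f (t + h)) x - transition Peps r (pert.orbit_integral f t) x"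
    using pert.orbit_integral_bound[OF f B] t h
    by (intro pert.transition_diff[where A = "B * (t + h)" and B = "B * t"] r pert.orbit_integral_measurable[OF f B]) auto
  then show ?thesis
    using pert.transition_orbit_integral[OF f B r] t h
    by (simp add: orbit_average_def[abs_def] pert.transition_divide add_ac)
qed

text \<open>The difference quotients of the average converge pointwise and boundedly, hence in \<open>L\<^sup>2\<close>.\<close>

lemma orbit_average_in_generator:
  assumes t: "0 \<le> t"
  shows "(orbit_average t, orbit_increment t) \<in> generator \<mu> Seps"
proof -
  note F = orbit_average_measurable orbit_average_bound[OF t]
  have F_L2: "orbit_average t \<in> L2 \<mu>" by (rule L2_bounded_borel[OF F])
  have U_L2: "orbit_increment t \<in> L2 \<mu>"
    by (rule L2_bounded_borel[OF orbit_increment_measurable[OF t] orbit_increment_bound[OF t]])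
  define q where "q r x = (orbit_average (t + r) x - orbit_average t x) / r - orbit_increment t x" for r x
  have q_meas: "q r \<in> borel_measurable borel" for r
    using orbit_average_measurable orbit_increment_measurable[OF t] unfolding q_def[abs_def] by measurable
  have q_bound: "\<bar>q r x\<bar> \<le> 4 * B / h" if "r > 0" for r x
  proof -
    have "\<bar>(orbit_average (t + r) x - orbit_average t x) / r\<bar> \<le> 2 * B / h"
      using orbit_average_lipschitz[OF t, of "t + r" x] that by (simp add: field_simps)
    with orbit_increment_bound[OF t, of x] show ?thesis unfolding q_def by linarith
  qed
  have "((\<lambda>r. \<integral>x. (q r x)\<^sup>2 \<partial>\<mu>) \<longlongrightarrow> (\<integral>x. 0 \<partial>\<mu>)) (at_right 0)"
  proof (rule \<mu>.bounded_convergence_at_right[where B = "(4 * B / h)\<^sup>2"])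
    show "(\<lambda>x. (q r x)\<^sup>2) \<in> borel_measurable \<mu>" for r
      using q_meas measurable_\<mu> by measurable
    show "\<bar>(q r x)\<^sup>2\<bar> \<le> (4 * B / h)\<^sup>2" if "r > 0" for r x
    proof -
      have "\<bar>q r x\<bar> \<le> \<bar>4 * B / h\<bar>" using q_bound[OF that, of x] by linarith
      then show ?thesis unfolding abs_le_square_iff by simp
    qed
    fix x
    have "((\<lambda>u. (orbit_average u x - orbit_average t x) / (u - t)) \<longlongrightarrow> orbit_increment t x) (at_right t)"
      using orbit_average_right_derivative[OF t, of x] by (simp add: has_field_derivative_iff)
    moreover have "filterlim (\<lambda>r. t + r) (at_right t) (at_right 0)"
    proof (rule filterlim_at_withinI)
      have "((\<lambda>r. t + r) \<longlongrightarrow> t + 0) (at_right 0)" by (intro tendsto_intros)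
      then show "((\<lambda>r. t + r) \<longlongrightarrow> t) (at_right 0)" by simp
      show "\<forall>\<^sub>F r in at_right 0. t + r \<in> {t<..} - {t}"
        using eventually_at_right_less[of "0::real"] by eventually_elim simp
    qed
    ultimately have "((\<lambda>r. (orbit_average (t + r) x - orbit_average t x) / (t + r - t)) \<longlongrightarrow> orbit_increment t x) (at_right 0)"
      by (rule filterlim_compose)
    then have "((\<lambda>r. q r x) \<longlongrightarrow> orbit_increment t x - orbit_increment t x) (at_right 0)"
      unfolding q_def by (intro tendsto_intros) simp
    then have "((\<lambda>r. (q r x)\<^sup>2) \<longlongrightarrow> (orbit_increment t x - orbit_increment t x)\<^sup>2) (at_right 0)"
      by (rule tendsto_power)
    then show "((\<lambda>r. (q r x)\<^sup>2) \<longlongrightarrow> 0) (at_right 0)" by simp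
  qed simp
  then have "((\<lambda>r. L2_norm \<mu> (q r)) \<longlongrightarrow> sqrt (\<integral>x. 0 \<partial>\<mu>)) (at_right 0)"
    unfolding L2_norm_def by (rule tendsto_real_sqrt)
  moreover have "\<forall>\<^sub>F r in at_right 0. L2_norm \<mu> (q r) = L2_norm \<mu> (\<lambda>x. (Seps r (orbit_average t) x - orbit_average t x) / r - orbit_increment t x)"
    using eventually_at_right_less[of "0::real"]
  proof eventually_elim
    case (elim r)
    have "AE x in \<mu>. Seps r (orbit_average t) x = transition Peps r (orbit_average t) x"
      using elim by (intro Seps_eq_transition[OF _ F]) auto
    moreover have "(\<lambda>x. (Seps r (orbit_average t) x - orbit_average t x) / r - orbit_increment t x) \<in> borel_measurable \<mu>"
      using Seps_L2[OF _ F_L2, of r] F_L2 U_L2 elim by (auto dest!: L2_measurable)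
    ultimately show ?case
      using elim t q_meas measurable_\<mu>
      by (intro L2_norm_cong_AE) (auto simp: q_def transition_orbit_average)
  qed
  ultimately have "((\<lambda>r. L2_norm \<mu> (\<lambda>x. (Seps r (orbit_average t) x - orbit_average t x) / r - orbit_increment t x)) \<longlongrightarrow> 0) (at_right 0)"
    using Lim_transform_eventually by fastforce
  then show ?thesis using F_L2 U_L2 by (simp add: generator_def)
qed

lemma mean_orbit_average_right_derivative:
  assumes t: "0 \<le> t"
  shows "((\<lambda>u. \<integral>x. orbit_average u x \<partial>\<mu>) has_real_derivative (\<integral>x. orbit_increment t x \<partial>\<mu>)) (at_right t)"
  using t orbit_average_lipschitz[OF t] orbit_average_bound
  by (intro \<mu>.right_derivative_integral[where K = "2 * B / h" and B = "\<lambda>_. B"])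
    (auto simp: measurable_\<mu> orbit_average_measurable orbit_increment_measurable intro!: orbit_average_right_derivative)

lemma square_orbit_average_lipschitz:
  assumes "0 \<le> s" "s \<le> t"
  shows "\<bar>(orbit_average t x)\<^sup>2 - (orbit_average s x)\<^sup>2\<bar> \<le> 4 * B\<^sup>2 / h * (t - s)"
proof -
  have "\<bar>(orbit_average t x)\<^sup>2 - (orbit_average s x)\<^sup>2\<bar> = \<bar>orbit_average t x - orbit_average s x\<bar> * \<bar>orbit_average t x + orbit_average s x\<bar>"
    by (simp add: abs_mult[symmetric] power2_eq_square algebra_simps)
  also have "\<dots> \<le> (2 * B / h * (t - s)) * (2 * B)"
    using orbit_average_lipschitz[OF assms, of x] orbit_average_bound[of s x] orbit_average_bound[of t x] assms
    by (intro mult_mono) auto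
  also have "\<dots> = 4 * B\<^sup>2 / h * (t - s)" by (simp add: power2_eq_square)
  finally show ?thesis .
qed

lemma square_orbit_average_bound: "0 \<le> t \<Longrightarrow> \<bar>(orbit_average t x)\<^sup>2\<bar> \<le> B\<^sup>2"
  using orbit_average_bound[of t x] observable_bound_nonneg by (simp add: abs_le_square_iff[symmetric])

lemma mean_orbit_average_continuous: "continuous_on {0..} (\<lambda>t. \<integral>x. orbit_average t x \<partial>\<mu>)"
  using h observable_bound_nonneg
  by (intro \<mu>.lipschitz_mean_continuous[where A = B and K = "2 * B / h"]
      orbit_average_bound orbit_average_lipschitz) (auto simp: measurable_\<mu> orbit_average_measurable)

lemma variance_orbit_average:
  "0 \<le> t \<Longrightarrow> variance_\<mu> (orbit_average t) = (\<integral>x. (orbit_average t x)\<^sup>2 \<partial>\<mu>) - (\<integral>x. orbit_average t x \<partial>\<mu>)\<^sup>2"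
  by (rule variance_\<mu>_eq[OF orbit_average_measurable orbit_average_bound])

text \<open>The energy estimate is a differential inequality for the variance along the orbit.\<close>

lemma variance_orbit_average_decay:
  assumes t: "0 \<le> t"
  shows "variance_\<mu> (orbit_average t) \<le> exp (- (2 * (\<gamma> - \<epsilon>)) * t) * variance_\<mu> (orbit_average 0)"
proof -
  define v where "v t = (\<integral>x. (orbit_average t x)\<^sup>2 \<partial>\<mu>) - (\<integral>x. orbit_average t x \<partial>\<mu>)\<^sup>2" for t
  define D where "D s = 2 * (\<integral>x. (orbit_average s x - (\<integral>y. orbit_average s y \<partial>\<mu>)) * orbit_increment s x \<partial>\<mu>)" for s
  have "v t \<le> exp (- (2 * (\<gamma> - \<epsilon>)) * t) * v 0"
  proof (rule gronwall_right[OF t])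
    show "continuous_on {0..} v" unfolding v_def
      using h observable_bound_nonneg
      by (intro continuous_intros mean_orbit_average_continuous \<mu>.lipschitz_mean_continuous[where A = "B\<^sup>2" and K = "4 * B\<^sup>2 / h"]
          square_orbit_average_bound square_orbit_average_lipschitz)
        (auto simp: measurable_\<mu> intro: borel_measurable_power orbit_average_measurable)
    fix s :: real assume s: "0 \<le> s"
    let ?m = "\<integral>y. orbit_average s y \<partial>\<mu>"
    have F: "integrable \<mu> (\<lambda>x. orbit_average s x * orbit_increment s x)" "integrable \<mu> (orbit_increment s)"
      using orbit_average_in_generator[OF s]
      by (auto simp: generator_def intro: L2_mult_integrable \<mu>.L2_integrable)
    have "((\<lambda>u. \<integral>x. (orbit_average u x)\<^sup>2 \<partial>\<mu>) has_real_derivative (\<integral>x. 2 * (orbit_average s x * orbit_increment s x) \<partial>\<mu>)) (at_right s)"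
    proof (rule \<mu>.right_derivative_integral[where K = "4 * B\<^sup>2 / h" and B = "\<lambda>_. B\<^sup>2"])
      show "((\<lambda>r. (orbit_average r x)\<^sup>2) has_real_derivative 2 * (orbit_average s x * orbit_increment s x)) (at_right s)" for x
        by (rule derivative_eq_intros orbit_average_right_derivative s refl | simp)+
    qed (use s square_orbit_average_lipschitz square_orbit_average_bound orbit_average_measurable orbit_increment_measurable in
        \<open>auto simp: measurable_\<mu>\<close>)
    from DERIV_diff[OF this DERIV_power[OF mean_orbit_average_right_derivative[OF s], of 2]]
    have "(v has_real_derivative (\<integral>x. 2 * (orbit_average s x * orbit_increment s x) \<partial>\<mu>) - 2 * ?m * (\<integral>x. orbit_increment s x \<partial>\<mu>)) (at_right s)"
      by (simp add: v_def[abs_def] mult_ac)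
    moreover have "(\<integral>x. 2 * (orbit_average s x * orbit_increment s x) \<partial>\<mu>) - 2 * ?m * (\<integral>x. orbit_increment s x \<partial>\<mu>) = D s"
      using F by (simp add: D_def left_diff_distrib)
    ultimately show "(v has_real_derivative D s) (at_right s)" by simp
    have "v s = (L2_norm \<mu> (\<lambda>x. orbit_average s x - ?m))\<^sup>2"
      using variance_orbit_average[OF s] by (simp add: v_def variance_\<mu>_L2_norm)
    with generator_energy(1)[OF orbit_average_in_generator[OF s] orbit_average_measurable orbit_average_bound[OF s]]
    have "D s \<le> 2 * (- (\<gamma> - \<epsilon>) * v s)" unfolding D_def by (intro mult_left_mono) auto
    then show "D s \<le> - (2 * (\<gamma> - \<epsilon>)) * v s" by (simp only: mult_minus_left mult.assoc mult_minus_right)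
  qed
  then show ?thesis using t by (simp add: v_def variance_orbit_average)
qed

text \<open>The mean moves at most at speed \<open>\<epsilon>\<close> times the standard deviation, which decays exponentially at
  rate \<open>\<gamma> - \<epsilon>\<close>.\<close>

lemma mean_orbit_average_drift:
  assumes t: "0 \<le> t"
  shows "\<bar>(\<integral>x. orbit_average t x \<partial>\<mu>) - (\<integral>x. orbit_average 0 x \<partial>\<mu>)\<bar> \<le> \<epsilon> / (\<gamma> - \<epsilon>) * sqrt (variance_\<mu> (orbit_average 0))"
proof -
  have "\<bar>(\<integral>x. orbit_average t x \<partial>\<mu>) - (\<integral>x. orbit_average 0 x \<partial>\<mu>)\<bar> \<le> \<epsilon> * sqrt (variance_\<mu> (orbit_average 0)) / (\<gamma> - \<epsilon>)"
  proof (rule right_derivative_exp_decay_bound[OF t _ _ mean_orbit_average_continuous mean_orbit_average_right_derivative])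
    fix s :: real assume s: "0 \<le> s"
    have "\<bar>\<integral>x. orbit_increment s x \<partial>\<mu>\<bar> \<le> \<epsilon> * sqrt (variance_\<mu> (orbit_average s))"
      using generator_energy(2)[OF orbit_average_in_generator[OF s] orbit_average_measurable orbit_average_bound[OF s]]
      by (simp add: variance_\<mu>_L2_norm)
    also have "\<dots> \<le> \<epsilon> * sqrt (exp (- (2 * (\<gamma> - \<epsilon>)) * s) * variance_\<mu> (orbit_average 0))"
      using variance_orbit_average_decay[OF s] Lhat_pos by (intro mult_left_mono real_sqrt_le_mono) auto
    also have "exp (- (2 * (\<gamma> - \<epsilon>)) * s) = (exp (- (\<gamma> - \<epsilon>) * s))\<^sup>2"
      by (simp add: exp_double[symmetric] algebra_simps)
    finally show "\<bar>\<integral>x. orbit_increment s x \<partial>\<mu>\<bar> \<le> \<epsilon> * sqrt (variance_\<mu> (orbit_average 0)) * exp (- (\<gamma> - \<epsilon>) * s)"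
      by (simp add: real_sqrt_mult mult_ac)
  qed (use gap Lhat_pos variance_\<mu>_nonneg in auto)
  then show ?thesis by simp
qed

end

end

context l2_perturbation
begin

lemma bounded_limit_mean_variance:
  fixes g :: "nat \<Rightarrow> 'a \<Rightarrow> real"
  assumes g: "\<And>n. g n \<in> borel_measurable borel" "\<And>n x. \<bar>g n x\<bar> \<le> B"
    and k: "k \<in> borel_measurable borel" "\<And>x. \<bar>k x\<bar> \<le> B" and lim: "AE x in \<mu>. (\<lambda>n. g n x) \<longlonglongrightarrow> k x"
  shows "(\<lambda>n. \<integral>x. g n x \<partial>\<mu>) \<longlonglongrightarrow> (\<integral>x. k x \<partial>\<mu>)" and "(\<lambda>n. variance_\<mu> (g n)) \<longlonglongrightarrow> variance_\<mu> k"
proof -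
  show mean: "(\<lambda>n. \<integral>x. g n x \<partial>\<mu>) \<longlonglongrightarrow> (\<integral>x. k x \<partial>\<mu>)"
    by (rule \<mu>.bounded_convergence[where B = B]) (use g k lim measurable_\<mu> in auto)
  have "(\<lambda>n. \<integral>x. (g n x)\<^sup>2 \<partial>\<mu>) \<longlonglongrightarrow> (\<integral>x. (k x)\<^sup>2 \<partial>\<mu>)"
  proof (rule \<mu>.bounded_convergence[where B = "B\<^sup>2"])
    show "\<bar>(g n x)\<^sup>2\<bar> \<le> B\<^sup>2" for n x
    proof -
      have "\<bar>g n x\<bar> \<le> \<bar>B\<bar>" using g(2)[of n x] by linarith
      then show ?thesis unfolding abs_le_square_iff by simp
    qed
    show "AE x in \<mu>. (\<lambda>n. (g n x)\<^sup>2) \<longlonglongrightarrow> (k x)\<^sup>2"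
      using lim by eventually_elim (intro tendsto_intros)
  qed (use g k measurable_\<mu> in auto)
  from tendsto_diff[OF this tendsto_power[OF mean, of 2]]
  show "(\<lambda>n. variance_\<mu> (g n)) \<longlonglongrightarrow> variance_\<mu> k"
    by (simp add: variance_\<mu>_eq[OF g] variance_\<mu>_eq[OF k])
qed

lemma
  fixes f :: "'a \<Rightarrow> real"
  assumes t: "0 \<le> t" and f: "continuous_on UNIV f" and B: "\<And>x. \<bar>f x\<bar> \<le> B"
  shows variance_decay_continuous: "variance_\<mu> (transition Peps t f) \<le> exp (- (2 * (\<gamma> - \<epsilon>)) * t) * variance_\<mu> f"
    and mean_drift_continuous: "\<bar>(\<integral>x. transition Peps t f x \<partial>\<mu>) - (\<integral>x. f x \<partial>\<mu>)\<bar> \<le> \<epsilon> / (\<gamma> - \<epsilon>) * sqrt (variance_\<mu> f)"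
proof -
  define h where "h n = inverse (real (Suc n))" for n
  have h: "0 < h n" for n by (simp add: h_def)
  have f_meas: "f \<in> borel_measurable borel" using f by (rule borel_measurable_continuous_onI)
  have lim: "(\<lambda>n. orbit_average f (h n) s x) \<longlonglongrightarrow> transition Peps s f x" if s: "0 \<le> s" for s x
  proof -
    have "((\<lambda>u. (pert.orbit_integral f u x - pert.orbit_integral f s x) / (u - s)) \<longlongrightarrow> transition Peps s f x) (at_right s)"
      using pert.orbit_integral_right_derivative[OF f B s, of x] by (simp add: has_field_derivative_iff)
    moreover have "filterlim (\<lambda>n. s + h n) (at_right s) sequentially"
    proof (rule filterlim_at_withinI)
      have "(\<lambda>n. s + h n) \<longlonglongrightarrow> s + 0" unfolding h_def by (intro tendsto_intros LIMSEQ_inverse_real_of_nat)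
      then show "(\<lambda>n. s + h n) \<longlonglongrightarrow> s" by simp
    qed (use h in auto)
    ultimately have "(\<lambda>n. (pert.orbit_integral f (s + h n) x - pert.orbit_integral f s x) / (s + h n - s)) \<longlonglongrightarrow> transition Peps s f x"
      by (rule filterlim_compose)
    then show ?thesis by (simp add: orbit_average_def[OF f B h])
  qed
  have transition_0: "transition Peps 0 f = f" using pert.transition_0[OF f_meas] by auto
  have conv: "(\<lambda>n. \<integral>x. orbit_average f (h n) s x \<partial>\<mu>) \<longlonglongrightarrow> (\<integral>x. transition Peps s f x \<partial>\<mu>)"
    "(\<lambda>n. variance_\<mu> (orbit_average f (h n) s)) \<longlonglongrightarrow> variance_\<mu> (transition Peps s f)" if s: "0 \<le> s" for s
    using lim[OF s] s
    by (auto intro!: bounded_limit_mean_variance[where B = B] orbit_average_measurable[OF f B h] orbit_average_bound[OF f B h]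
        pert.measurable_transition pert.transition_bound f_meas B)
  note conv_0 = conv[of 0, unfolded transition_0]
  show "variance_\<mu> (transition Peps t f) \<le> exp (- (2 * (\<gamma> - \<epsilon>)) * t) * variance_\<mu> f"
  proof (rule LIMSEQ_le[OF conv(2)[OF t]])
    show "(\<lambda>n. exp (- (2 * (\<gamma> - \<epsilon>)) * t) * variance_\<mu> (orbit_average f (h n) 0)) \<longlonglongrightarrow> exp (- (2 * (\<gamma> - \<epsilon>)) * t) * variance_\<mu> f"
      by (intro tendsto_mult_left conv_0) simp
  qed (use variance_orbit_average_decay[OF f B h t] in auto)
  show "\<bar>(\<integral>x. transition Peps t f x \<partial>\<mu>) - (\<integral>x. f x \<partial>\<mu>)\<bar> \<le> \<epsilon> / (\<gamma> - \<epsilon>) * sqrt (variance_\<mu> f)"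
  proof (rule LIMSEQ_le)
    show "(\<lambda>n. \<bar>(\<integral>x. orbit_average f (h n) t x \<partial>\<mu>) - (\<integral>x. orbit_average f (h n) 0 x \<partial>\<mu>)\<bar>) \<longlonglongrightarrow>
        \<bar>(\<integral>x. transition Peps t f x \<partial>\<mu>) - (\<integral>x. f x \<partial>\<mu>)\<bar>"
      by (intro tendsto_rabs tendsto_diff conv(1)[OF t] conv_0) simp
    show "(\<lambda>n. \<epsilon> / (\<gamma> - \<epsilon>) * sqrt (variance_\<mu> (orbit_average f (h n) 0))) \<longlonglongrightarrow> \<epsilon> / (\<gamma> - \<epsilon>) * sqrt (variance_\<mu> f)"
      by (intro tendsto_mult_left tendsto_real_sqrt conv_0) simp
  qed (use mean_orbit_average_drift[OF f B h t] in auto)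
qed

lemma
  fixes h :: "'a \<Rightarrow> real"
  assumes t: "0 \<le> t" and h: "h \<in> borel_measurable borel" and B: "\<And>x. \<bar>h x\<bar> \<le> B"
  shows variance_decay: "variance_\<mu> (transition Peps t h) \<le> exp (- (2 * (\<gamma> - \<epsilon>)) * t) * variance_\<mu> h"
    and mean_drift: "\<bar>(\<integral>x. transition Peps t h x \<partial>\<mu>) - (\<integral>x. h x \<partial>\<mu>)\<bar> \<le> \<epsilon> / (\<gamma> - \<epsilon>) * sqrt (variance_\<mu> h)"
proof -
  obtain g' where g': "\<And>n::nat. continuous_on UNIV (g' n)" "\<And>n x. \<bar>g' n x\<bar> \<le> B"
    "AE x in \<mu>. (\<lambda>n. g' n x) \<longlonglongrightarrow> h x"
    "(\<lambda>n. \<integral>x. \<bar>transition Peps t (g' n) x - transition Peps t h x\<bar> \<partial>\<mu>) \<longlonglongrightarrow> 0"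
    using pert.transition_continuous_approximation[OF sets_\<mu> \<mu>.prob_space_axioms t h B] by blast
  have g'_meas: "g' n \<in> borel_measurable borel" for n using g'(1) by (rule borel_measurable_continuous_onI)
  have "\<exists>r. strict_mono r \<and> (AE x in \<mu>. (\<lambda>n. transition Peps t (g' (r n)) x - transition Peps t h x) \<longlonglongrightarrow> 0)"
    using g'(4)
    by (intro tendsto_L1_AE_subseq \<mu>.L2_integrable L2_diff L2_transition[OF t h B] L2_transition[OF t g'_meas g'(2)]) simp
  then obtain r where r: "strict_mono r"
    "AE x in \<mu>. (\<lambda>n. transition Peps t (g' (r n)) x - transition Peps t h x) \<longlonglongrightarrow> 0" by blast
  define g where "g n = g' (r n)" for n
  have g: "continuous_on UNIV (g n)" "\<bar>g n x\<bar> \<le> B" "g n \<in> borel_measurable borel" for n x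
    using g' g'_meas by (auto simp: g_def)
  have g_lim: "AE x in \<mu>. (\<lambda>n. g n x) \<longlonglongrightarrow> h x"
    using g'(3) by eventually_elim (use LIMSEQ_subseq_LIMSEQ[OF _ r(1)] in \<open>force simp: g_def o_def\<close>)
  have Pg_lim: "AE x in \<mu>. (\<lambda>n. transition Peps t (g n) x) \<longlonglongrightarrow> transition Peps t h x"
    using r(2) by eventually_elim (simp add: g_def LIM_zero_iff)
  note conv_0 = bounded_limit_mean_variance[OF g(3,2) h B g_lim]
  have conv: "(\<lambda>n. \<integral>x. transition Peps t (g n) x \<partial>\<mu>) \<longlonglongrightarrow> (\<integral>x. transition Peps t h x \<partial>\<mu>)"
    "(\<lambda>n. variance_\<mu> (transition Peps t (g n))) \<longlonglongrightarrow> variance_\<mu> (transition Peps t h)"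
    using Pg_lim
    by (auto intro!: bounded_limit_mean_variance[where B = B] pert.measurable_transition[OF t] pert.transition_bound[OF t] g h B)
  show "variance_\<mu> (transition Peps t h) \<le> exp (- (2 * (\<gamma> - \<epsilon>)) * t) * variance_\<mu> h"
    by (rule LIMSEQ_le[OF conv(2) tendsto_mult_left[OF conv_0(2)]])
      (use variance_decay_continuous[OF t g(1,2)] in auto)
  show "\<bar>(\<integral>x. transition Peps t h x \<partial>\<mu>) - (\<integral>x. h x \<partial>\<mu>)\<bar> \<le> \<epsilon> / (\<gamma> - \<epsilon>) * sqrt (variance_\<mu> h)"
    by (rule LIMSEQ_le[OF tendsto_rabs[OF tendsto_diff[OF conv(1) conv_0(1)]] tendsto_mult_left[OF tendsto_real_sqrt[OF conv_0(2)]]])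
      (use mean_drift_continuous[OF t g(1,2)] in auto)
qed

text \<open>The variance of a harmonic function does not change in time, yet it decays.\<close>

lemma harmonic_AE_constant:
  fixes h :: "'a \<Rightarrow> real"
  assumes h: "h \<in> borel_measurable borel" and B: "\<And>x. \<bar>h x\<bar> \<le> B" and harmonic: "transition Peps 1 h = h"
  shows "AE x in \<mu>. h x = (\<integral>y. h y \<partial>\<mu>)"
proof -
  have "variance_\<mu> h \<le> exp (- (2 * (\<gamma> - \<epsilon>))) * variance_\<mu> h"
    using variance_decay[OF _ h B, of 1] harmonic by simp
  moreover have "exp (- (2 * (\<gamma> - \<epsilon>))) < 1" using gap by simp
  ultimately have "variance_\<mu> h = 0"
    using variance_\<mu>_nonneg[of h] mult_strict_right_mono[of "exp (- (2 * (\<gamma> - \<epsilon>)))" 1 "variance_\<mu> h"]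
    by (cases "variance_\<mu> h = 0") auto
  moreover have "(\<lambda>x. h x - (\<integral>y. h y \<partial>\<mu>)) \<in> L2 \<mu>"
    by (intro L2_diff L2_bounded_borel[OF h B] L2_bounded_borel[of "\<lambda>_. \<integral>y. h y \<partial>\<mu>" "\<bar>\<integral>y. h y \<partial>\<mu>\<bar>"]) auto
  ultimately have "AE x in \<mu>. h x - (\<integral>y. h y \<partial>\<mu>) = 0"
    by (intro L2_norm_eq_0_AE) (auto simp: variance_\<mu>_L2_norm)
  then show ?thesis by simp
qed

subsection \<open>Invariant distributions of the perturbed process\<close>

context
  fixes \<nu> :: "'a measure"
  assumes \<nu>: "invariant_distribution Peps \<nu>" and ac: "absolutely_continuous \<mu> \<nu>"
begin

interpretation \<nu>: prob_space \<nu>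
  using \<nu> by (simp add: invariant_distribution_def)

lemma sets_\<nu>: "sets \<nu> = sets borel"
  using \<nu> by (simp add: invariant_distribution_def)

lemma AE_\<mu>_imp_AE_\<nu>: "AE x in \<mu>. A x \<Longrightarrow> AE x in \<nu>. A x"
  using absolutely_continuous_AE[OF _ ac] sets_\<nu> by simp

text \<open>Since the variance of \<open>transition Peps n h\<close> tends to \<open>0\<close>, a subsequence approaches its own \<open>\<mu>\<close>-means \<open>m n\<close>
  \<open>\<mu>\<close>-almost everywhere, hence also \<open>\<nu>\<close>-almost everywhere. Its \<open>\<nu>\<close>-mean is constantly that of \<open>h\<close>, so the
  numbers \<open>m n\<close> converge to it along the subsequence; and \<open>m n\<close> differs from the \<open>\<mu>\<close>-mean of \<open>h\<close> by a bounded
  drift.\<close>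

lemma invariant_mean_le_L2_norm:
  fixes h :: "'a \<Rightarrow> real"
  assumes h: "h \<in> borel_measurable borel" and B: "\<And>x. \<bar>h x\<bar> \<le> B"
  shows "\<bar>\<integral>x. h x \<partial>\<nu>\<bar> \<le> (1 + \<epsilon> / (\<gamma> - \<epsilon>)) * L2_norm \<mu> h"
proof -
  define m where "m n = (\<integral>x. transition Peps (real n) h x \<partial>\<mu>)" for n
  define u where "u n x = transition Peps (real n) h x - m n" for n x
  have B0: "0 \<le> B" using B[of undefined] by linarith
  have h_L2: "h \<in> L2 \<mu>" by (rule L2_bounded_borel[OF h B])
  have Ph: "transition Peps (real n) h \<in> borel_measurable borel" "\<bar>transition Peps (real n) h x\<bar> \<le> B" for n x
    by (auto intro: pert.measurable_transition pert.transition_bound h B)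
  have m_bound: "\<bar>m n\<bar> \<le> B" for n
  proof -
    have "\<bar>m n\<bar> \<le> (\<integral>x. \<bar>transition Peps (real n) h x\<bar> \<partial>\<mu>)" unfolding m_def by (rule integral_abs_bound)
    also have "\<dots> \<le> (\<integral>x. B \<partial>\<mu>)"
      using \<mu>.L2_integrable[OF L2_bounded_borel[OF Ph]] Ph(2) by (intro integral_mono) auto
    finally show ?thesis using \<mu>.prob_space by simp
  qed
  have u: "u n \<in> borel_measurable borel" "\<bar>u n x\<bar> \<le> 2 * B" for n x
  proof -
    show "u n \<in> borel_measurable borel" unfolding u_def[abs_def] by (intro borel_measurable_diff Ph measurable_const) simp
    show "\<bar>u n x\<bar> \<le> 2 * B" unfolding u_def using Ph(2)[of n x] m_bound[of n] by linarith
  qed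
  have var_le: "variance_\<mu> h \<le> (L2_norm \<mu> h)\<^sup>2"
    by (simp add: variance_\<mu>_eq[OF h B] L2_norm_sq)
  have "(\<lambda>n. exp (- (2 * (\<gamma> - \<epsilon>)) * real n) * variance_\<mu> h) \<longlonglongrightarrow> 0 * variance_\<mu> h"
  proof (intro tendsto_mult_right)
    have "(\<lambda>n. exp (- (2 * (\<gamma> - \<epsilon>))) ^ n) \<longlonglongrightarrow> 0"
      using gap by (intro LIMSEQ_power_zero) simp
    then show "(\<lambda>n. exp (- (2 * (\<gamma> - \<epsilon>)) * real n)) \<longlonglongrightarrow> 0"
      by (simp add: exp_of_nat_mult[symmetric] mult.commute)
  qed
  then have "(\<lambda>n. sqrt (exp (- (2 * (\<gamma> - \<epsilon>)) * real n) * variance_\<mu> h)) \<longlonglongrightarrow> 0"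
    using tendsto_real_sqrt by fastforce
  then have "(\<lambda>n. \<integral>x. norm (u n x) \<partial>\<mu>) \<longlonglongrightarrow> 0"
  proof (rule Lim_null_comparison[rotated], intro always_eventually allI)
    fix n
    have "(\<integral>x. \<bar>u n x\<bar> \<partial>\<mu>) \<le> L2_norm \<mu> (u n)" by (rule \<mu>.integral_abs_le_L2_norm[OF L2_bounded_borel[OF u]])
    also have "\<dots> = sqrt (variance_\<mu> (transition Peps (real n) h))"
      by (simp add: variance_\<mu>_L2_norm u_def[abs_def] m_def)
    also have "\<dots> \<le> sqrt (exp (- (2 * (\<gamma> - \<epsilon>)) * real n) * variance_\<mu> h)"
      by (rule real_sqrt_le_mono[OF variance_decay[OF _ h B]]) simp
    finally show "norm (\<integral>x. norm (u n x) \<partial>\<mu>) \<le> sqrt (exp (- (2 * (\<gamma> - \<epsilon>)) * real n) * variance_\<mu> h)" by simp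
  qed
  then have "\<exists>r. strict_mono r \<and> (AE x in \<mu>. (\<lambda>n. u (r n) x) \<longlonglongrightarrow> 0)"
    by (intro tendsto_L1_AE_subseq \<mu>.L2_integrable L2_bounded_borel[OF u])
  then obtain r where r: "AE x in \<mu>. (\<lambda>n. u (r n) x) \<longlonglongrightarrow> 0" by blast
  have u_\<nu>: "u n \<in> borel_measurable \<nu>" for n
    using u(1)[of n] measurable_cong_sets[OF sets_\<nu> refl] by blast
  have "(\<lambda>n. \<integral>x. u (r n) x \<partial>\<nu>) \<longlonglongrightarrow> (\<integral>x. 0 \<partial>\<nu>)"
    by (rule \<nu>.bounded_convergence[where B = "2 * B"]) (use AE_\<mu>_imp_AE_\<nu>[OF r] u(2) u_\<nu> in auto)
  moreover have "(\<integral>x. u n x \<partial>\<nu>) = (\<integral>x. h x \<partial>\<nu>) - m n" for n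
  proof -
    have "transition Peps (real n) h \<in> borel_measurable \<nu>"
      using Ph(1)[of n] measurable_cong_sets[OF sets_\<nu> refl] by blast
    then have "integrable \<nu> (transition Peps (real n) h)"
      using Ph(2) by (intro \<nu>.integrable_const_bound[of _ B]) auto
    then show ?thesis
      using pert.integral_transition_invariant[OF \<nu> _ h B, of "real n"] \<nu>.prob_space by (simp add: u_def)
  qed
  ultimately have "(\<lambda>n. (\<integral>x. h x \<partial>\<nu>) - m (r n)) \<longlonglongrightarrow> 0" by simp
  then have "(\<lambda>n. (\<integral>x. h x \<partial>\<nu>) - ((\<integral>x. h x \<partial>\<nu>) - m (r n))) \<longlonglongrightarrow> (\<integral>x. h x \<partial>\<nu>) - 0"
    by (intro tendsto_intros)
  then have "(\<lambda>n. \<bar>m (r n)\<bar>) \<longlonglongrightarrow> \<bar>\<integral>x. h x \<partial>\<nu>\<bar>" using tendsto_rabs by simp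
  moreover have "\<bar>m n\<bar> \<le> (1 + \<epsilon> / (\<gamma> - \<epsilon>)) * L2_norm \<mu> h" for n
  proof -
    have "\<bar>m n - (\<integral>x. h x \<partial>\<mu>)\<bar> \<le> \<epsilon> / (\<gamma> - \<epsilon>) * sqrt (variance_\<mu> h)"
      unfolding m_def by (rule mean_drift[OF _ h B]) simp
    also have "\<dots> \<le> \<epsilon> / (\<gamma> - \<epsilon>) * L2_norm \<mu> h"
      using real_sqrt_le_mono[OF var_le] gap Lhat_pos by (intro mult_left_mono) auto
    finally show ?thesis using \<mu>.abs_integral_le_L2_norm[OF h_L2] by (simp add: distrib_right)
  qed
  ultimately show ?thesis by (intro LIMSEQ_le_const2) auto
qed

text \<open>The bound for bounded functions passes to \<open>f\<close> by monotone convergence of its truncations. It says that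
  the density of \<open>\<nu>\<close> is in \<open>L\<^sup>2 \<mu>\<close>, without mentioning the density.\<close>

lemma L2_subset_invariant_L1:
  assumes f: "f \<in> L2 \<mu>" shows "integrable \<nu> f"
proof -
  have f_meas: "f \<in> borel_measurable borel" using L2_measurable[OF f] measurable_\<mu> by simp
  then have f_\<nu>: "f \<in> borel_measurable \<nu>" using measurable_cong_sets[OF sets_\<nu> refl] by blast
  have nonneg: "0 \<le> 1 + \<epsilon> / (\<gamma> - \<epsilon>)" using gap Lhat_pos by simp
  have trunc: "(\<integral>\<^sup>+x. ennreal (min \<bar>f x\<bar> (real n)) \<partial>\<nu>) \<le> ennreal ((1 + \<epsilon> / (\<gamma> - \<epsilon>)) * L2_norm \<mu> f)" for n
  proof -
    let ?k = "\<lambda>x. min \<bar>f x\<bar> (real n)"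
    have k: "?k \<in> borel_measurable borel" "\<bar>?k x\<bar> \<le> real n" for x using f_meas by auto
    have "(\<integral>\<^sup>+x. ennreal (?k x) \<partial>\<nu>) = ennreal (\<integral>x. ?k x \<partial>\<nu>)"
      using f_\<nu> by (intro nn_integral_eq_integral \<nu>.integrable_const_bound[of _ "real n"]) auto
    also have "\<dots> \<le> ennreal ((1 + \<epsilon> / (\<gamma> - \<epsilon>)) * L2_norm \<mu> ?k)"
      using invariant_mean_le_L2_norm[OF k] by (intro ennreal_leI) simp
    also have "L2_norm \<mu> ?k \<le> L2_norm \<mu> f"
      unfolding L2_norm_def
    proof (intro real_sqrt_le_mono integral_mono)
      show "integrable \<mu> (\<lambda>x. (?k x)\<^sup>2)" using L2_bounded_borel[OF k] by (rule L2_square_integrable)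
      show "integrable \<mu> (\<lambda>x. (f x)\<^sup>2)" using f by (rule L2_square_integrable)
      show "(?k x)\<^sup>2 \<le> (f x)\<^sup>2" for x by (simp add: abs_le_square_iff[symmetric])
    qed
    then have "ennreal ((1 + \<epsilon> / (\<gamma> - \<epsilon>)) * L2_norm \<mu> ?k) \<le> ennreal ((1 + \<epsilon> / (\<gamma> - \<epsilon>)) * L2_norm \<mu> f)"
      using nonneg by (intro ennreal_leI mult_left_mono) auto
    finally show ?thesis .
  qed
  have "(\<lambda>n. \<integral>\<^sup>+x. ennreal (min \<bar>f x\<bar> (real n)) \<partial>\<nu>) \<longlonglongrightarrow> (\<integral>\<^sup>+x. ennreal \<bar>f x\<bar> \<partial>\<nu>)"
  proof (rule nn_integral_LIMSEQ)
    show "incseq (\<lambda>n x. ennreal (min \<bar>f x\<bar> (real n)))"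
      by (auto simp: incseq_def le_fun_def intro!: ennreal_leI)
    show "(\<lambda>n. ennreal (min \<bar>f x\<bar> (real n))) \<longlonglongrightarrow> ennreal \<bar>f x\<bar>" for x
    proof (rule tendsto_eventually)
      obtain N where "\<bar>f x\<bar> \<le> real N" using real_arch_simple by blast
      then show "\<forall>\<^sub>F n in sequentially. ennreal (min \<bar>f x\<bar> (real n)) = ennreal \<bar>f x\<bar>"
        unfolding eventually_sequentially by (intro exI[of _ N]) (auto simp: min_def)
    qed
  qed (use f_\<nu> in auto)
  then have "(\<integral>\<^sup>+x. ennreal \<bar>f x\<bar> \<partial>\<nu>) \<le> ennreal ((1 + \<epsilon> / (\<gamma> - \<epsilon>)) * L2_norm \<mu> f)"
    by (rule LIMSEQ_le_const2) (use trunc in auto)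
  then have "(\<integral>\<^sup>+x. ennreal \<bar>f x\<bar> \<partial>\<nu>) < \<infinity>" using le_less_trans by fastforce
  with f_\<nu> show ?thesis by (simp add: integrable_iff_bounded)
qed

end
end

section \<open>Time averages of an ergodic Markov process\<close>

text \<open>From integer times to real times: a monotone quantity at time \<open>t\<close> lies between its values at
  \<open>\<lfloor>t\<rfloor>\<close> and \<open>\<lfloor>t\<rfloor> + 1\<close>, and both integers are asymptotic to \<open>t\<close>.\<close>

lemma ennreal_average_squeeze:
  fixes I :: "real \<Rightarrow> ennreal" and S :: "nat \<Rightarrow> real"
  assumes lower: "\<And>n t. real n \<le> t \<Longrightarrow> ennreal (S n) \<le> I t"
    and upper: "\<And>n t. t < real n \<Longrightarrow> I t \<le> ennreal (S n)"
    and nonneg: "\<And>n. 0 \<le> S n" and lim: "(\<lambda>n. S n / real n) \<longlonglongrightarrow> L"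
  shows "((\<lambda>t. I t / ennreal t) \<longlongrightarrow> ennreal L) at_top"
proof -
  define k where "k t = nat \<lfloor>t\<rfloor>" for t :: real
  have k_top: "filterlim k at_top at_top" unfolding k_def by real_asymp
  have Suc_top: "filterlim (\<lambda>t. Suc (k t)) at_top at_top"
    using filterlim_compose[OF filterlim_Suc k_top] .
  have "((\<lambda>t. S (k t) / real (k t) * (real (k t) / t)) \<longlongrightarrow> L * 1) at_top"
  proof (intro tendsto_mult filterlim_compose[OF lim k_top])
    show "((\<lambda>t. real (k t) / t) \<longlongrightarrow> 1) at_top" unfolding k_def by real_asymp
  qed
  moreover have "\<forall>\<^sub>F t in at_top. S (k t) / real (k t) * (real (k t) / t) = S (k t) / t"
    using eventually_ge_at_top[of 1]
  proof eventually_elim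
    case (elim t)
    then have "k t > 0" unfolding k_def by linarith
    then show ?case by simp
  qed
  ultimately have "((\<lambda>t. S (k t) / t) \<longlongrightarrow> L * 1) at_top" by (rule Lim_transform_eventually)
  then have "((\<lambda>t. S (k t) / t) \<longlongrightarrow> L) at_top" by simp
  then have low: "((\<lambda>t. ennreal (S (k t) / t)) \<longlongrightarrow> ennreal L) at_top" by (rule tendsto_ennrealI)
  have "((\<lambda>t. S (Suc (k t)) / real (Suc (k t)) * (real (Suc (k t)) / t)) \<longlongrightarrow> L * 1) at_top"
  proof (intro tendsto_mult filterlim_compose[OF lim Suc_top])
    show "((\<lambda>t. real (Suc (k t)) / t) \<longlongrightarrow> 1) at_top" unfolding k_def by real_asymp
  qed
  then have "((\<lambda>t. S (Suc (k t)) / t) \<longlongrightarrow> L) at_top" by simp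
  then have up: "((\<lambda>t. ennreal (S (Suc (k t)) / t)) \<longlongrightarrow> ennreal L) at_top" by (rule tendsto_ennrealI)
  show ?thesis
  proof (rule tendsto_sandwich[OF _ _ low up])
    show "\<forall>\<^sub>F t in at_top. ennreal (S (k t) / t) \<le> I t / ennreal t"
      using eventually_ge_at_top[of 1]
    proof eventually_elim
      case (elim t)
      then have "real (k t) \<le> t" unfolding k_def by linarith
      then have "ennreal (S (k t)) / ennreal t \<le> I t / ennreal t" by (intro divide_right_mono_ennreal lower)
      then show ?case using elim nonneg by (simp add: divide_ennreal)
    qed
    show "\<forall>\<^sub>F t in at_top. I t / ennreal t \<le> ennreal (S (Suc (k t)) / t)"
      using eventually_ge_at_top[of 1]
    proof eventually_elim
      case (elim t)
      then have "t < real (Suc (k t))" unfolding k_def by linarith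
      then have "I t / ennreal t \<le> ennreal (S (Suc (k t))) / ennreal t" by (intro divide_right_mono_ennreal upper)
      then show ?case using elim nonneg by (simp add: divide_ennreal)
    qed
  qed
qed

text \<open>Only the positive part of \<open>f\<close> counts, since \<open>ennreal\<close> maps negative numbers to \<open>0\<close>; for a function of
  either sign, this is used for \<open>f\<close> and for \<open>- f\<close>.\<close>

definition occupation :: "('a \<Rightarrow> real) \<Rightarrow> real set \<Rightarrow> (real \<Rightarrow> 'a) \<Rightarrow> ennreal" where
  "occupation f A \<omega> = (\<integral>\<^sup>+s\<in>A. ennreal (f (\<omega> (max 0 s))) \<partial>lborel)"

lemma measurable_path_function:
  fixes f :: "'a::metric_space \<Rightarrow> real"
  assumes [measurable]: "f \<in> borel_measurable borel" and \<omega>: "\<omega> \<in> space path_space"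
  shows "(\<lambda>s. f (\<omega> (max 0 s))) \<in> borel_measurable borel"
proof -
  have "(\<lambda>s. (s, \<omega>)) \<in> borel \<rightarrow>\<^sub>M borel \<Otimes>\<^sub>M path_space" using \<omega> by measurable
  from measurable_compose[OF this measurable_eval_pair] have "(\<lambda>s. \<omega> (max 0 s)) \<in> borel \<rightarrow>\<^sub>M borel" by simp
  then show ?thesis by (rule measurable_compose) simp
qed

lemma occupation_cong: "A \<subseteq> {0..} \<Longrightarrow> occupation f A \<omega> = (\<integral>\<^sup>+s\<in>A. ennreal (f (\<omega> s)) \<partial>lborel)"
  unfolding occupation_def by (rule nn_integral_cong) (auto simp: max_def split: split_indicator)

lemma occupation_mono: "A \<subseteq> B \<Longrightarrow> occupation f A \<omega> \<le> occupation f B \<omega>"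
  unfolding occupation_def by (intro nn_integral_mono) (auto split: split_indicator)

lemma occupation_measurable:
  fixes f :: "'a::metric_space \<Rightarrow> real"
  assumes [measurable]: "f \<in> borel_measurable borel" "A \<in> sets borel"
  shows "occupation f A \<in> borel_measurable path_space"
proof -
  have "(\<lambda>p. ((snd p) (max 0 (fst p) :: real) :: 'a)) \<in> lborel \<Otimes>\<^sub>M path_space \<rightarrow>\<^sub>M borel"
    using measurable_eval_pair measurable_cong_sets[OF sets_pair_measure_cong[OF sets_lborel refl] refl] by blast
  then have [measurable]: "(\<lambda>(\<omega>, s). \<omega> (max 0 s) :: 'a) \<in> path_space \<Otimes>\<^sub>M lborel \<rightarrow>\<^sub>M borel"
    using measurable_compose[OF measurable_pair_swap', of "\<lambda>p. ((snd p) (max 0 (fst p) :: real) :: 'a)" lborel path_space borel]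
    by (simp add: case_prod_beta')
  show ?thesis unfolding occupation_def[abs_def]
    by (rule sigma_finite_measure.borel_measurable_nn_integral[OF lborel.sigma_finite_measure_axioms]) measurable
qed

lemma occupation_time_shift:
  fixes f :: "'a::metric_space \<Rightarrow> real"
  assumes f: "f \<in> borel_measurable borel" and \<omega>: "\<omega> \<in> space path_space" and r: "0 \<le> r"
  shows "occupation f {0..<1} (time_shift r \<omega>) = occupation f {r..<r + 1} \<omega>"
proof -
  have "(\<lambda>s. f (\<omega> (max 0 s))) \<in> borel_measurable borel" by (rule measurable_path_function[OF f \<omega>])
  then have "(\<integral>\<^sup>+s. ennreal (f (\<omega> (max 0 s))) * indicator {r..<r + 1} s \<partial>lborel)
      = (\<integral>\<^sup>+s. ennreal (f (\<omega> (max 0 (r + s)))) * indicator {r..<r + 1} (r + s) \<partial>lborel)"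
    using nn_integral_real_affine[of "\<lambda>s. ennreal (f (\<omega> (max 0 s))) * indicator {r..<r + 1} s" 1 r] by simp
  also have "\<dots> = (\<integral>\<^sup>+s. ennreal (f (time_shift r \<omega> (max 0 s))) * indicator {0..<1} s \<partial>lborel)"
    using r by (intro nn_integral_cong) (auto simp: time_shift_def max_def split: split_indicator)
  finally show ?thesis by (simp add: occupation_def)
qed

lemma occupation_sum:
  fixes f :: "'a::metric_space \<Rightarrow> real"
  assumes f: "f \<in> borel_measurable borel" and \<omega>: "\<omega> \<in> space path_space"
  shows "(\<Sum>i<n. occupation f {real i..<real i + 1} \<omega>) = occupation f {0..<real n} \<omega>"
proof (induction n)
  case (Suc n)
  have [measurable]: "(\<lambda>s. f (\<omega> (max 0 s))) \<in> borel_measurable borel" by (rule measurable_path_function[OF f \<omega>])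
  have "occupation f {0..<real (Suc n)} \<omega> =
    (\<integral>\<^sup>+s. ennreal (f (\<omega> (max 0 s))) * indicator {0..<real n} s + ennreal (f (\<omega> (max 0 s))) * indicator {real n..<real n + 1} s \<partial>lborel)"
    unfolding occupation_def by (intro nn_integral_cong) (auto split: split_indicator)
  also have "\<dots> = occupation f {0..<real n} \<omega> + occupation f {real n..<real n + 1} \<omega>"
    unfolding occupation_def by (rule nn_integral_add) measurable
  finally show ?case using Suc by simp
qed (simp add: occupation_def)

lemma (in stationary_markov_process) nn_integral_occupation:
  assumes [measurable]: "f \<in> borel_measurable borel"
  shows "(\<integral>\<^sup>+\<omega>. occupation f {0..<1} \<omega> \<partial>Q) = (\<integral>\<^sup>+x. ennreal (f x) \<partial>\<nu>)"
proof -
  interpret Q: prob_space Q by (rule prob_space_Q)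
  interpret pair: pair_sigma_finite lborel Q by standard
  have "(\<lambda>p. ((snd p) (max 0 (fst p) :: real) :: 'a)) \<in> lborel \<Otimes>\<^sub>M Q \<rightarrow>\<^sub>M borel"
    using measurable_eval_pair measurable_cong_sets[OF sets_pair_measure_cong[OF sets_lborel sets_Q] refl] by blast
  then have [measurable]: "(\<lambda>(s, \<omega>). \<omega> (max 0 s) :: 'a) \<in> lborel \<Otimes>\<^sub>M Q \<rightarrow>\<^sub>M borel" by (simp add: case_prod_beta')
  have f_ennreal: "(\<lambda>x. ennreal (f x)) \<in> borel_measurable borel" by measurable
  have "(\<integral>\<^sup>+\<omega>. occupation f {0..<1} \<omega> \<partial>Q) = (\<integral>\<^sup>+s. \<integral>\<^sup>+\<omega>. ennreal (f (\<omega> (max 0 s))) * indicator {0..<1} s \<partial>Q \<partial>lborel)"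
    unfolding occupation_def by (rule pair.Fubini') measurable
  also have "\<dots> = (\<integral>\<^sup>+s. (\<integral>\<^sup>+x. ennreal (f x) \<partial>\<nu>) * indicator {0..<1} (s::real) \<partial>lborel)"
  proof (rule nn_integral_cong)
    fix s :: real
    have ev: "(\<lambda>\<omega>. \<omega> (max 0 s)) \<in> Q \<rightarrow>\<^sub>M borel"
      using measurable_eval[of "max 0 s"] measurable_cong_sets[OF sets_Q refl] by simp
    have "(\<integral>\<^sup>+x. ennreal (f x) \<partial>\<nu>) = (\<integral>\<^sup>+x. ennreal (f x) \<partial>distr Q borel (\<lambda>\<omega>. \<omega> (max 0 s)))"
      by (subst distr_Q_eval) simp_all
    also have "\<dots> = (\<integral>\<^sup>+\<omega>. ennreal (f (\<omega> (max 0 s))) \<partial>Q)" by (rule nn_integral_distr[OF ev]) (simp add: f_ennreal)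
    finally show "(\<integral>\<^sup>+\<omega>. ennreal (f (\<omega> (max 0 s))) * indicator {0..<1} s \<partial>Q) = (\<integral>\<^sup>+x. ennreal (f x) \<partial>\<nu>) * indicator {0..<1} s"
      by (simp split: split_indicator)
  qed
  also have "\<dots> = (\<integral>\<^sup>+x. ennreal (f x) \<partial>\<nu>)" by (simp add: nn_integral_cmult_indicator)
  finally show ?thesis .
qed

text \<open>Ergodicity in the form in which it is obtained from the decay of the variance.\<close>

locale ergodic_markov_process = stationary_markov_process P \<nu>
  for P :: "'a::metric_space \<Rightarrow> (real \<Rightarrow> 'a) measure" and \<nu> +
  assumes harmonic_constant: "\<And>h. h \<in> borel_measurable borel \<Longrightarrow> (\<And>x. 0 \<le> h x \<and> h x \<le> 1) \<Longrightarrow>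
    transition P 1 h = h \<Longrightarrow> \<exists>c. AE x in \<nu>. h x = c"
begin

lemma ergodic_time_shift: "ergodic_transformation Q (time_shift 1)"
proof -
  interpret Q: prob_space Q by (rule prob_space_Q)
  have meas: "time_shift 1 \<in> Q \<rightarrow>\<^sub>M Q"
    using measurable_time_shift[of 1] measurable_cong_sets[OF sets_Q sets_Q] by simp
  have "distr Q Q (time_shift 1) = distr Q path_space (time_shift 1)"
    by (rule distr_cong) simp_all
  then have "distr Q Q (time_shift 1) = Q" by (simp add: distr_Q_time_shift)
  moreover have "measure Q B = 0 \<or> measure Q B = 1" if "B \<in> sets Q" and inv: "time_shift 1 -` B \<inter> space Q = B" for B
  proof -
    have B: "B \<in> sets path_space" using that by simp
    have "transition P 1 (\<lambda>x. measure (P x) B) = (\<lambda>x. measure (P x) B)"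
      using shift_invariant_harmonic[OF B, of 1] inv by auto
    then obtain c where "AE x in \<nu>. measure (P x) B = c"
      using harmonic_constant[OF measurable_measure_P[OF B]] prob_space.prob_le_1[OF prob_space_P] by auto
    then show ?thesis using shift_invariant_trivial[OF B] inv by simp
  qed
  ultimately show ?thesis using meas by unfold_locales auto
qed

text \<open>The set where \<open>A\<close> fails need not be measurable; the null set that contains it is.\<close>

lemma AE_Q_imp_AE_P:
  assumes "AE \<omega> in Q. A \<omega>" shows "AE x in \<nu>. AE \<omega> in P x. A \<omega>"
proof -
  obtain N where N: "{\<omega> \<in> space Q. \<not> A \<omega>} \<subseteq> N" "N \<in> null_sets Q"
    using assms by (auto simp: eventually_ae_filter)
  then have N_sets: "N \<in> sets path_space" by auto
  have "AE \<omega> in Q. \<omega> \<notin> N" using N(2) by (rule AE_not_in)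
  then have "AE x in \<nu>. AE \<omega> in P x. \<omega> \<notin> N"
    unfolding Q_def by (subst (asm) AE_bind[OF kernel_\<nu>]) (use N_sets in measurable)
  then show ?thesis
  proof eventually_elim
    case (elim x)
    then show ?case using AE_space[of "P x"] by eventually_elim (use N(1) in auto)
  qed
qed

text \<open>Birkhoff's theorem for the shift by one unit of time and the function
  \<open>\<omega> \<mapsto> \<integral>\<^sub>0\<^sup>1 max 0 (f (\<omega> s)) ds\<close>, whose ergodic sums are the integrals over \<open>{0..<n}\<close>.\<close>

lemma time_average_finite:
  assumes f: "f \<in> borel_measurable borel" and fin: "(\<integral>\<^sup>+x. ennreal (f x) \<partial>\<nu>) < \<infinity>"
  shows "AE \<omega> in Q. ((\<lambda>t. occupation f {0..t} \<omega> / ennreal t) \<longlongrightarrow> (\<integral>\<^sup>+x. ennreal (f x) \<partial>\<nu>)) at_top"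
proof -
  interpret T: ergodic_transformation Q "time_shift 1" by (rule ergodic_time_shift)
  define G where "G \<omega> = enn2real (occupation f {0..<1} \<omega>)" for \<omega>
  have G_nonneg: "0 \<le> G \<omega>" for \<omega> by (simp add: G_def)
  have occ_meas: "occupation f {0..<1} \<in> borel_measurable Q"
    using occupation_measurable[OF f, of "{0..<1}"] measurable_cong_sets[OF sets_Q refl] by auto
  have occ_int: "(\<integral>\<^sup>+\<omega>. occupation f {0..<1} \<omega> \<partial>Q) < \<infinity>"
    using fin nn_integral_occupation[OF f] by simp
  have occ_fin: "AE \<omega> in Q. occupation f {0..<1} \<omega> \<noteq> \<infinity>"
    using nn_integral_PInf_AE[OF occ_meas] occ_int by simp
  have G_meas: "G \<in> borel_measurable Q" unfolding G_def using occ_meas by measurable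
  have G_eq: "(\<integral>\<^sup>+\<omega>. ennreal (G \<omega>) \<partial>Q) = (\<integral>\<^sup>+x. ennreal (f x) \<partial>\<nu>)"
    unfolding nn_integral_occupation[OF f, symmetric]
    by (rule nn_integral_cong_AE) (use occ_fin in eventually_elim, auto simp: G_def less_top)
  have G_int: "integrable Q G"
    using G_meas G_eq fin by (simp add: integrable_iff_bounded G_def)
  have G_mean: "ennreal (\<integral>\<omega>. G \<omega> \<partial>Q) = (\<integral>\<^sup>+x. ennreal (f x) \<partial>\<nu>)"
    using nn_integral_eq_integral[OF G_int AE_I2] G_eq G_nonneg by simp
  have "AE \<omega> in Q. \<forall>k. occupation f {0..<1} ((time_shift 1 ^^ k) \<omega>) \<noteq> \<infinity>"
    unfolding AE_all_countable
  proof
    fix k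
    have "AE \<omega> in distr Q path_space (time_shift (real k)). occupation f {0..<1} \<omega> \<noteq> \<infinity>"
      using occ_fin unfolding distr_Q_time_shift[OF of_nat_0_le_iff] .
    then have "AE \<omega> in Q. occupation f {0..<1} (time_shift (real k) \<omega>) \<noteq> \<infinity>"
      by (subst (asm) AE_distr_iff)
        (use measurable_time_shift[of "real k"] measurable_cong_sets[OF sets_Q refl] occupation_measurable[OF f, of "{0..<1}"] in auto)
    then show "AE \<omega> in Q. occupation f {0..<1} ((time_shift 1 ^^ k) \<omega>) \<noteq> \<infinity>"
      using AE_space[of Q] by eventually_elim (simp add: funpow_time_shift)
  qed
  then show ?thesis using T.birkhoff[OF G_int] AE_space[of Q]
  proof eventually_elim
    case (elim \<omega>)
    then have \<omega>: "\<omega> \<in> space path_space" by simp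
    define S where "S n = (\<Sum>i<n. G ((time_shift 1 ^^ i) \<omega>))" for n
    have S_eq: "ennreal (S n) = occupation f {0..<real n} \<omega>" for n
    proof -
      have "ennreal (S n) = (\<Sum>i<n. ennreal (G ((time_shift 1 ^^ i) \<omega>)))"
        unfolding S_def by (rule sum_ennreal[symmetric]) (simp add: G_def)
      also have "\<dots> = (\<Sum>i<n. occupation f {0..<1} (time_shift (real i) \<omega>))"
        using elim(1) \<omega> by (intro sum.cong) (auto simp: G_def funpow_time_shift less_top)
      also have "\<dots> = occupation f {0..<real n} \<omega>"
        using occupation_time_shift[OF f \<omega>] occupation_sum[OF f \<omega>] by simp
      finally show ?thesis .
    qed
    show ?case unfolding G_mean[symmetric]
    proof (rule ennreal_average_squeeze[where S = S])
      show "ennreal (S n) \<le> occupation f {0..t} \<omega>" if "real n \<le> t" for n t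
        unfolding S_eq using that by (intro occupation_mono) auto
      show "occupation f {0..t} \<omega> \<le> ennreal (S n)" if "t < real n" for n t
        unfolding S_eq using that by (intro occupation_mono) auto
      show "0 \<le> S n" for n unfolding S_def by (intro sum_nonneg) (simp add: G_def)
      show "(\<lambda>n. S n / real n) \<longlonglongrightarrow> (\<integral>\<omega>. G \<omega> \<partial>Q)" using elim(2) by (simp add: S_def)
    qed
  qed
qed

text \<open>If the mean is infinite, the averages dominate those of the truncations \<open>min f n\<close>, whose limits are
  finite and grow without bound.\<close>

lemma time_average_nonneg:
  assumes f: "f \<in> borel_measurable borel"
  shows "AE \<omega> in Q. ((\<lambda>t. occupation f {0..t} \<omega> / ennreal t) \<longlongrightarrow> (\<integral>\<^sup>+x. ennreal (f x) \<partial>\<nu>)) at_top"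
proof (cases "(\<integral>\<^sup>+x. ennreal (f x) \<partial>\<nu>) < \<infinity>")
  case True
  then show ?thesis by (rule time_average_finite[OF f])
next
  case False
  define g where "g n x = min (f x) (real n)" for n x
  interpret \<nu>: prob_space \<nu> by (rule prob_space_\<nu>)
  have g_meas: "g n \<in> borel_measurable borel" for n unfolding g_def[abs_def] using f by measurable
  have g_fin: "(\<integral>\<^sup>+x. ennreal (g n x) \<partial>\<nu>) < \<infinity>" for n
  proof -
    have "(\<integral>\<^sup>+x. ennreal (g n x) \<partial>\<nu>) \<le> (\<integral>\<^sup>+x. ennreal (real n) \<partial>\<nu>)"
      by (intro nn_integral_mono ennreal_leI) (simp add: g_def)
    also have "\<dots> < \<infinity>" using \<nu>.emeasure_space_1 by simp
    finally show ?thesis .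
  qed
  have "(\<lambda>n. \<integral>\<^sup>+x. ennreal (g n x) \<partial>\<nu>) \<longlonglongrightarrow> (\<integral>\<^sup>+x. ennreal (f x) \<partial>\<nu>)"
  proof (rule nn_integral_LIMSEQ)
    show "incseq (\<lambda>n x. ennreal (g n x))"
      by (auto simp: incseq_def le_fun_def g_def intro!: ennreal_leI)
    show "(\<lambda>n. ennreal (g n x)) \<longlonglongrightarrow> ennreal (f x)" for x
    proof (rule tendsto_eventually)
      obtain N where "f x \<le> real N" using real_arch_simple by blast
      then show "\<forall>\<^sub>F n in sequentially. ennreal (g n x) = ennreal (f x)"
        unfolding eventually_sequentially g_def by (intro exI[of _ N]) (auto simp: min_def)
    qed
  qed (use g_meas measurable_cong_sets[OF sets_\<nu> refl] in auto)
  then have top: "(\<lambda>n. \<integral>\<^sup>+x. ennreal (g n x) \<partial>\<nu>) \<longlonglongrightarrow> \<top>" using False by (simp add: less_top[symmetric])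
  have "AE \<omega> in Q. \<forall>n. ((\<lambda>t. occupation (g n) {0..t} \<omega> / ennreal t) \<longlongrightarrow> (\<integral>\<^sup>+x. ennreal (g n x) \<partial>\<nu>)) at_top"
    unfolding AE_all_countable using time_average_finite[OF g_meas g_fin] by simp
  then show ?thesis
  proof eventually_elim
    case (elim \<omega>)
    have "((\<lambda>t. occupation f {0..t} \<omega> / ennreal t) \<longlongrightarrow> \<top>) at_top"
    proof (rule order_tendstoI)
      fix a :: ennreal assume "a < \<top>"
      with top have "\<forall>\<^sub>F n in sequentially. a < (\<integral>\<^sup>+x. ennreal (g n x) \<partial>\<nu>)" by (rule order_tendstoD)
      then obtain n where "a < (\<integral>\<^sup>+x. ennreal (g n x) \<partial>\<nu>)" by (auto simp: eventually_sequentially)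
      then have "\<forall>\<^sub>F t in at_top. a < occupation (g n) {0..t} \<omega> / ennreal t"
        using elim order_tendstoD(1) by blast
      then show "\<forall>\<^sub>F t in at_top. a < occupation f {0..t} \<omega> / ennreal t"
      proof eventually_elim
        case (elim t)
        have "occupation (g n) {0..t} \<omega> \<le> occupation f {0..t} \<omega>"
          unfolding occupation_def g_def by (intro nn_integral_mono mult_right_mono ennreal_leI) auto
        then have "occupation (g n) {0..t} \<omega> / ennreal t \<le> occupation f {0..t} \<omega> / ennreal t"
          by (rule divide_right_mono_ennreal)
        with elim show ?case by (rule less_le_trans)
      qed
    qed simp
    then show ?case using False by (simp add: less_top[symmetric])
  qed
qed

text \<open>Convergence of the averages of both parts of \<open>f\<close> to finite limits also shows that both parts are
  integrable over \<open>{0..t}\<close>: the integral up to some later time is finite.\<close>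

lemma time_average_integrable:
  assumes f: "f \<in> borel_measurable borel" and int: "integrable \<nu> f"
  shows "AE \<omega> in Q. (\<forall>t\<ge>0. set_integrable lborel {0..t} (\<lambda>s. f (\<omega> s))) \<and>
     ((\<lambda>t. (1 / t) * (LINT s:{0..t}|lborel. f (\<omega> s))) \<longlongrightarrow> (LINT x|\<nu>. f x)) at_top"
proof -
  let ?L = "\<integral>\<^sup>+x. ennreal (f x) \<partial>\<nu>" and ?L' = "\<integral>\<^sup>+x. ennreal (- f x) \<partial>\<nu>"
  have L: "?L < \<infinity>" "?L' < \<infinity>" using int by (auto simp: real_integrable_def less_top)
  have f': "(\<lambda>x. - f x) \<in> borel_measurable borel" using f by measurable
  show ?thesis using time_average_nonneg[OF f] time_average_nonneg[OF f'] AE_space[of Q]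
  proof eventually_elim
    case (elim \<omega>)
    then have \<omega>: "\<omega> \<in> space path_space" by simp
    have finite: "occupation g {0..t} \<omega> < \<infinity>"
      if lim: "((\<lambda>t. occupation g {0..t} \<omega> / ennreal t) \<longlongrightarrow> c) at_top" and c: "c < \<infinity>" for g c t
    proof -
      have "\<forall>\<^sub>F u in at_top. occupation g {0..u} \<omega> / ennreal u < \<infinity>"
        using lim c by (rule order_tendstoD)
      then have "\<forall>\<^sub>F u in at_top. occupation g {0..u} \<omega> / ennreal u < \<infinity> \<and> max 1 t \<le> u"
        by (intro eventually_conj eventually_ge_at_top)
      then obtain u where u: "occupation g {0..u} \<omega> / ennreal u < \<infinity>" "max 1 t \<le> u"
        by (auto simp: eventually_at_top_linorder)
      have "occupation g {0..u} \<omega> < \<infinity>"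
        using u by (cases "occupation g {0..u} \<omega> = \<top>") (auto simp: ennreal_top_divide less_top[symmetric])
      moreover have "occupation g {0..t} \<omega> \<le> occupation g {0..u} \<omega>" using u by (intro occupation_mono) auto
      ultimately show ?thesis by (rule le_less_trans[rotated])
    qed
    have path: "(\<lambda>s. f (\<omega> (max 0 s))) \<in> borel_measurable borel" by (rule measurable_path_function[OF f \<omega>])
    have ind: "indicator {0..t} s *\<^sub>R f (\<omega> s) = indicator {0..t} s * f (\<omega> (max 0 s))" for t s :: real
      by (auto simp: max_def split: split_indicator)
    have pos: "(\<integral>\<^sup>+s. ennreal (indicator {0..t} s * f (\<omega> (max 0 s))) \<partial>lborel) = occupation f {0..t} \<omega>"
      and neg: "(\<integral>\<^sup>+s. ennreal (- (indicator {0..t} s * f (\<omega> (max 0 s)))) \<partial>lborel) = occupation (\<lambda>x. - f x) {0..t} \<omega>" for t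
      unfolding occupation_def by (auto intro!: nn_integral_cong split: split_indicator)
    have int_t: "set_integrable lborel {0..t} (\<lambda>s. f (\<omega> s))" for t
      unfolding set_integrable_def ind real_integrable_def
      using path finite[OF elim(1) L(1), of t] finite[OF elim(2) L(2), of t] pos neg by (auto simp: less_top)
    have LINT_t: "(LINT s:{0..t}|lborel. f (\<omega> s)) = enn2real (occupation f {0..t} \<omega>) - enn2real (occupation (\<lambda>x. - f x) {0..t} \<omega>)" for t
      using real_lebesgue_integral_def[OF int_t[unfolded set_integrable_def, of t]]
      unfolding set_lebesgue_integral_def ind pos neg .
    have lim: "((\<lambda>t. enn2real (occupation g {0..t} \<omega>) / t) \<longlongrightarrow> enn2real c) at_top"
      if lim: "((\<lambda>t. occupation g {0..t} \<omega> / ennreal t) \<longlongrightarrow> c) at_top" and c: "c < \<infinity>" for g c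
    proof -
      have "((\<lambda>t. enn2real (occupation g {0..t} \<omega> / ennreal t)) \<longlongrightarrow> enn2real c) at_top"
        using lim c by (intro tendsto_enn2real) (auto simp: less_top)
      moreover have "\<forall>\<^sub>F t in at_top. enn2real (occupation g {0..t} \<omega> / ennreal t) = enn2real (occupation g {0..t} \<omega>) / t"
        using eventually_gt_at_top[of 0]
      proof eventually_elim
        case (elim t)
        obtain r where "occupation g {0..t} \<omega> = ennreal r" "r \<ge> 0"
          using finite[OF lim c, of t] by (cases "occupation g {0..t} \<omega>") auto
        then show ?case using elim by (simp add: divide_ennreal)
      qed
      ultimately show ?thesis by (rule Lim_transform_eventually)
    qed
    have "((\<lambda>t. enn2real (occupation f {0..t} \<omega>) / t - enn2real (occupation (\<lambda>x. - f x) {0..t} \<omega>) / t) \<longlongrightarrow> enn2real ?L - enn2real ?L') at_top"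
      by (intro tendsto_diff lim elim L)
    then have "((\<lambda>t. (1 / t) * (LINT s:{0..t}|lborel. f (\<omega> s))) \<longlongrightarrow> (LINT x|\<nu>. f x)) at_top"
      unfolding LINT_t real_lebesgue_integral_def[OF int] by (simp add: diff_divide_distrib)
    with int_t show ?case by blast
  qed
qed

end

section \<open>Time averages of the perturbed process\<close>

theorem corollary1:
  fixes P Peps :: "'a::metric_space \<Rightarrow> (real \<Rightarrow> 'a) measure"
    and \<mu> \<mu>eps :: "'a measure"
    and Lhat :: "('a \<Rightarrow> real) \<Rightarrow> 'a \<Rightarrow> real"
    and Seps :: "real \<Rightarrow> ('a \<Rightarrow> real) \<Rightarrow> 'a \<Rightarrow> real"
    and \<epsilon> \<gamma> :: real
    and f :: "'a \<Rightarrow> real"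
  assumes "markov_process P"
    and "markov_process Peps"
    and "invariant_distribution P \<mu>"
    and "ergodic_distribution P \<mu>"
    and "contraction_semigroup \<mu> (transition P)"
    and "L2_bounded_operator \<mu> Lhat"
    and "\<epsilon> = L2_operator_norm \<mu> Lhat"
    and "\<epsilon> > 0"
    and "C0_semigroup \<mu> Seps"
    and "generator \<mu> Seps = perturbed_graph \<mu> (generator \<mu> (transition P)) Lhat"
    and "\<gamma> > 0"
    and "poincare_inequality \<mu> (generator \<mu> (transition P)) \<gamma>"
    and "\<And>t g. t \<ge> 0 \<Longrightarrow> continuous_on UNIV g \<Longrightarrow> bounded (range g) \<Longrightarrow>
           AE \<eta> in \<mu>. Seps t g \<eta> = transition Peps t g \<eta>"
    and "\<epsilon> < \<gamma>"
    and "invariant_distribution Peps \<mu>eps"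
    and "absolutely_continuous \<mu> \<mu>eps"
    and "f \<in> borel_measurable borel"
  shows "((\<forall>x. f x \<ge> 0) \<longrightarrow>
            (AE \<eta> in \<mu>eps. AE \<omega> in Peps \<eta>.
               ((\<lambda>t. (\<integral>\<^sup>+s\<in>{0..t}. ennreal (f (\<omega> s)) \<partial>lborel) / ennreal t)
                  \<longlongrightarrow> (\<integral>\<^sup>+x. ennreal (f x) \<partial>\<mu>eps)) at_top)) \<and>
         (integrable \<mu>eps f \<longrightarrow>
            (AE \<eta> in \<mu>eps. AE \<omega> in Peps \<eta>.
               (\<forall>t\<ge>0. set_integrable lborel {0..t} (\<lambda>s. f (\<omega> s))) \<and>
               ((\<lambda>t. (1 / t) * (LINT s:{0..t}|lborel. f (\<omega> s)))
                  \<longlongrightarrow> (LINT x|\<mu>eps. f x)) at_top)) \<and>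
         (bounded (range f) \<or> f \<in> L2 \<mu> \<longrightarrow> integrable \<mu>eps f)"
proof -
  have cadlag: "cadlag_markov_process P" "cadlag_markov_process Peps"
    using assms(1,2) by (auto intro: cadlag_markov_process.intro)
  interpret l2_perturbation P Peps \<mu> Lhat Seps \<gamma>
    by (intro l2_perturbation.intro l2_perturbation_axioms.intro cadlag assms(3,6,9,10,12,13))
      (use assms(7,8,14) in auto)
  have AE_transfer: "AE x in \<mu>eps. A x" if "AE x in \<mu>. A x" for A
    using absolutely_continuous_AE[OF _ assms(16) that] assms(15)
    by (simp add: invariant_distribution_def)
  interpret stat: stationary_markov_process Peps \<mu>eps
    by (intro stationary_markov_process.intro stationary_markov_process_axioms.intro cadlag assms(15))
  interpret erg: ergodic_markov_process Peps \<mu>eps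
  proof
    fix h :: "'a \<Rightarrow> real"
    assume h: "h \<in> borel_measurable borel" "\<And>x. 0 \<le> h x \<and> h x \<le> 1" "transition Peps 1 h = h"
    have "AE x in \<mu>. h x = (\<integral>y. h y \<partial>\<mu>)"
      by (rule harmonic_AE_constant[of h 1]) (use h in auto)
    then show "\<exists>c. AE x in \<mu>eps. h x = c" using AE_transfer by blast
  qed
  have nonneg: "AE \<eta> in \<mu>eps. AE \<omega> in Peps \<eta>.
      ((\<lambda>t. (\<integral>\<^sup>+s\<in>{0..t}. ennreal (f (\<omega> s)) \<partial>lborel) / ennreal t) \<longlongrightarrow> (\<integral>\<^sup>+x. ennreal (f x) \<partial>\<mu>eps)) at_top"
    using erg.AE_Q_imp_AE_P[OF erg.time_average_nonneg[OF assms(17)]] by (simp add: occupation_cong)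
  have bounded: "integrable \<mu>eps f" if range_bounded: "bounded (range f)"
  proof -
    obtain B where "\<forall>y\<in>range f. norm y \<le> B" using range_bounded unfolding bounded_iff by blast
    then have "\<bar>f x\<bar> \<le> B" for x by simp
    then have "f \<in> L2 \<mu>" by (rule L2_bounded_borel[OF assms(17)])
    then show ?thesis by (rule L2_subset_invariant_L1[OF assms(15,16)])
  qed
  show ?thesis
    using nonneg bounded erg.AE_Q_imp_AE_P[OF erg.time_average_integrable[OF assms(17)]]
      L2_subset_invariant_L1[OF assms(15,16), of f] by blast
qed

end
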